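(* Let $q=q(\mu)>0$ be defined for $0<\mu<1$ with $q(\mu)\to0$ as $\mu\to0$ in such a way that the finite positive limit $\alpha=\lim_{\mu\to0}2\sqrt{q(\mu)}/\mu$ exists. For $n\ge0$ (with $n\ge1$ for the minus sign) let $$F^\pm_n[\alpha;\mu](x,y)=q(\mu)^{n/2}\,M^\pm_n\big[2\sqrt{q(\mu)}\big](\xi,\eta)$$ under the change of variables $x=\cosh\xi\cos\eta$, $y=\sinh\xi\sin\eta$. When $\mu\to0$, the $2\sqrt{q(\mu)}$-metamonogenic functions $F^\pm_n[\alpha;\mu]$, evaluated at $w/\mu$, tend pointwise in the unit disk $B_1(0)=\{w\in\mathbb{C}:|w|<1\}$ to the $\alpha$-metamonogenic limit $F^\pm_n[\alpha]$ defined by $$F^\pm_n[\alpha](w)=\beta_nJ_n(\alpha|w|)\Phi^\pm_n(w)-\frac{\beta_n}{|w|}(\mathbf{i}\,\mathrm{Re}\,w+\mathbf{j}\,\mathrm{Im}\,w)J_n'(\alpha|w|)\Phi^\pm_n(w)\mp\frac{n\beta_n}{\alpha|w|^2}(\mathbf{i}\,\mathrm{Im}\,w-\mathbf{j}\,\mathrm{Re}\,w)J_n(\alpha|w|)\Phi^\mp_n(w).$$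
   Context: Points $(x,y)\in\mathbb{R}^2$ are identified with $x+iy\in\mathbb{C}$. $\mathbb{R}^3$ is identified with the reduced quaternions $a_0+\mathbf{i}a_1+\mathbf{j}a_2\in\mathbb{H}$. $D=\mathbf{i}\,\partial/\partial x+\mathbf{j}\,\partial/\partial y$; for $\lambda\in\mathbb{R}\setminus\{0\}$ an $\mathbb{R}^3$-valued function is $\lambda$-metamonogenic if it is in the kernel of $D+\lambda$. The expression of $D$ in elliptical coordinates $(\xi,\eta)$, $\xi\ge0$, $0\le\eta\le2\pi$, is $$\mathcal{D}=\frac{2}{\cosh2\xi-\cos2\eta}\Big((\mathbf{i}\sinh\xi\cos\eta+\mathbf{j}\cosh\xi\sin\eta)\frac{\partial}{\partial\xi}+(\mathbf{j}\sinh\xi\cos\eta-\mathbf{i}\cosh\xi\sin\eta)\frac{\partial}{\partial\eta}\Big).$$ Mathieu functions: for $q>0$, $\mathrm{ce}_n(\eta,q)$ ($n\ge0$) and $\mathrm{se}_n(\eta,q)$ ($n\ge1$) are the even, respectively odd, $2\pi$-periodic solutions of $\phi''+(a-2q\cos2\eta)\phi=0$ for the increasing sequences of eigenvalues $a=a_n(q)$, respectively $a=b_n(q)$. They are normalized so that the $L^2([0,2\pi])$-norms are equal to $\sqrt\pi$, except that $\mathrm{ce}_0\equiv1$; signs are such that $\mathrm{ce}_n(\eta,q)\to\cos n\eta$ and $\mathrm{se}_n(\eta,q)\to\sin n\eta$ as $q\to0$. Modified Mathieu functions: $\mathrm{Ce}_n(\xi,q)=\mathrm{ce}_n(i\xi,q)$,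 $\mathrm{Se}_n(\xi,q)=-i\,\mathrm{se}_n(i\xi,q)$. Put $\zeta^+_n[q](\xi,\eta)=\mathrm{Ce}_n(\xi,q)\,\mathrm{ce}_n(\eta,q)$, $\zeta^-_n[q](\xi,\eta)=\mathrm{Se}_n(\xi,q)\,\mathrm{se}_n(\eta,q)$. For $\lambda\in\mathbb{R}\setminus\{0\}$, the $\lambda$-reduced quaternionic Mathieu functions are $M^\pm_n[\lambda]=-\frac1\lambda(\mathcal{D}-\lambda)\,\zeta^\pm_n[\lambda^2/4]$. $J_n$ is the Bessel function of the first kind of order $n$. $\Phi^+_n(w)=\cos(n\arg w)$, $\Phi^-_n(w)=\sin(n\arg w)$. $\beta_0=1/\sqrt2$ and $\beta_n=2^{n-1}n!$ for $n\ge1$.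
   Formalization: β_0 is 1 instead of 1/√2, with which the case n=0 is false; ce_0≡1 is read as ce_0 having L²-norm √(2π) and tending to 1; F_n[α;μ] is metamonogenic away from the foci ±1, where 𝒟 is 0/0; F_n[α] at w=0 is its continuous extension. *)

theory Defs
  imports "HOL-Complex_Analysis.Complex_Analysis"
begin

text \<open>Quaternions \<open>a\<^sub>0 + i a\<^sub>1 + j a\<^sub>2 + k a\<^sub>3\<close> are 4-tuples, which gives them the library's norm,
  topology and real scaling. \<open>\<real>\<^sup>3\<close> is the subspace \<open>a\<^sub>3 = 0\<close> of reduced quaternions.
  Points of the plane are complex numbers.\<close>

type_synonym quat = "real \<times> real \<times> real \<times> real"

fun qmult :: "quat \<Rightarrow> quat \<Rightarrow> quat" where
  "qmult (a0, a1, a2, a3) (b0, b1, b2, b3) =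
     (a0 * b0 - a1 * b1 - a2 * b2 - a3 * b3,
      a0 * b1 + a1 * b0 + a2 * b3 - a3 * b2,
      a0 * b2 - a1 * b3 + a2 * b0 + a3 * b1,
      a0 * b3 + a1 * b2 - a2 * b1 + a3 * b0)"

definition qre :: "real \<Rightarrow> quat" where "qre t = (t, 0, 0, 0)"
definition qi :: quat where "qi = (0, 1, 0, 0)"
definition qj :: quat where "qj = (0, 0, 1, 0)"

definition reduced :: "quat \<Rightarrow> bool" where
  "reduced a \<longleftrightarrow> snd (snd (snd a)) = 0"

definition Dirac :: "(complex \<Rightarrow> quat) \<Rightarrow> complex \<Rightarrow> quat" where
  "Dirac F z = qmult qi (frechet_derivative F (at z) 1)
             + qmult qj (frechet_derivative F (at z) \<i>)"

definition metamonogenic :: "real \<Rightarrow> complex set \<Rightarrow> (complex \<Rightarrow> quat) \<Rightarrow> bool" where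
  "metamonogenic lam S F \<longleftrightarrow> lam \<noteq> 0 \<and>
     (\<forall>z\<in>S. reduced (F z) \<and> F differentiable (at z) \<and> Dirac F z + lam *\<^sub>R F z = 0)"

definition elliptic_Dirac :: "(real \<Rightarrow> real \<Rightarrow> quat) \<Rightarrow> real \<Rightarrow> real \<Rightarrow> quat" where
  "elliptic_Dirac G \<xi> \<eta> = (2 / (cosh (2 * \<xi>) - cos (2 * \<eta>))) *\<^sub>R
     (qmult ((sinh \<xi> * cos \<eta>) *\<^sub>R qi + (cosh \<xi> * sin \<eta>) *\<^sub>R qj)
            (vector_derivative (\<lambda>t. G t \<eta>) (at \<xi>))
    + qmult ((sinh \<xi> * cos \<eta>) *\<^sub>R qj - (cosh \<xi> * sin \<eta>) *\<^sub>R qi)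
            (vector_derivative (\<lambda>t. G \<xi> t) (at \<eta>)))"

definition elliptic_point :: "real \<Rightarrow> real \<Rightarrow> complex" where
  "elliptic_point \<xi> \<eta> = Complex (cosh \<xi> * cos \<eta>) (sinh \<xi> * sin \<eta>)"


text \<open>Upper sign: the even family \<open>ce\<close>; lower sign: the odd family \<open>se\<close>.\<close>

datatype parity = Plus | Minus

fun opposite :: "parity \<Rightarrow> parity" where
  "opposite Plus = Minus"
| "opposite Minus = Plus"

fun parity_sign :: "parity \<Rightarrow> real" where
  "parity_sign Plus = 1"
| "parity_sign Minus = -1"

definition mathieu_solution :: "real \<Rightarrow> real \<Rightarrow> (real \<Rightarrow> real) \<Rightarrow> bool" where
  "mathieu_solution q a \<phi> \<longleftrightarrow> (\<exists>\<phi>'. \<forall>\<eta>. (\<phi> has_real_derivative \<phi>' \<eta>) (at \<eta>) \<and>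
     (\<exists>d. (\<phi>' has_real_derivative d) (at \<eta>) \<and> d + (a - 2 * q * cos (2 * \<eta>)) * \<phi> \<eta> = 0))"

definition mathieu_eigenfunction ::
    "parity \<Rightarrow> real \<Rightarrow> real \<Rightarrow> (real \<Rightarrow> real) \<Rightarrow> bool" where
  "mathieu_eigenfunction s q a \<phi> \<longleftrightarrow> mathieu_solution q a \<phi> \<and>
     (\<forall>\<eta>. \<phi> (- \<eta>) = parity_sign s * \<phi> \<eta>) \<and> (\<forall>\<eta>. \<phi> (\<eta> + 2 * pi) = \<phi> \<eta>) \<and> (\<exists>\<eta>. \<phi> \<eta> \<noteq> 0)"

definition mathieu_spectrum :: "parity \<Rightarrow> real \<Rightarrow> real set" where
  "mathieu_spectrum s q = {a. \<exists>\<phi>. mathieu_eigenfunction s q a \<phi>}"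

text \<open>\<open>a = a\<^sub>n(q)\<close> (numbered from \<open>n = 0\<close>) or \<open>a = b\<^sub>n(q)\<close> (numbered from \<open>n = 1\<close>): the number of
  strictly smaller eigenvalues of the same parity gives the position in the increasing sequence.\<close>

definition mathieu_eigenvalue :: "parity \<Rightarrow> nat \<Rightarrow> real \<Rightarrow> real \<Rightarrow> bool" where
  "mathieu_eigenvalue s n q a \<longleftrightarrow> a \<in> mathieu_spectrum s q \<and>
     finite {a' \<in> mathieu_spectrum s q. a' < a} \<and>
     n = card {a' \<in> mathieu_spectrum s q. a' < a} + (case s of Plus \<Rightarrow> 0 | Minus \<Rightarrow> 1)"

text \<open>\<open>f q\<close> is \<open>ce\<^sub>n(\<sqdot>, q)\<close> or \<open>se\<^sub>n(\<sqdot>, q)\<close> as an entire function. The sign is fixed by the behaviour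
  of the whole family as \<open>q\<close> tends to 0. The \<open>L\<^sup>2\<close>-norm is \<open>\<surd>\<pi>\<close>, except that \<open>ce\<^sub>0\<close> has the norm
  \<open>\<surd>(2\<pi>)\<close> of the constant 1, its limit as \<open>q\<close> tends to 0 (for \<open>q > 0\<close> it is not itself constant).\<close>

definition mathieu_family :: "parity \<Rightarrow> nat \<Rightarrow> (real \<Rightarrow> complex \<Rightarrow> complex) \<Rightarrow> bool" where
  "mathieu_family s n f \<longleftrightarrow>
     (\<forall>q>0. f q holomorphic_on UNIV \<and>
        (\<exists>a \<phi>. mathieu_eigenvalue s n q a \<and> mathieu_eigenfunction s q a \<phi> \<and>
           (\<forall>\<eta>. f q (of_real \<eta>) = of_real (\<phi> \<eta>)) \<and>
           sqrt (integral {0..2 * pi} (\<lambda>\<eta>. (\<phi> \<eta>)\<^sup>2)) =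
             (if s = Plus \<and> n = 0 then sqrt (2 * pi) else sqrt pi))) \<and>
     (\<forall>\<eta>::real. ((\<lambda>q. f q (of_real \<eta>)) \<longlongrightarrow>
        of_real (case s of Plus \<Rightarrow> cos (real n * \<eta>) | Minus \<Rightarrow> sin (real n * \<eta>))) (at_right 0))"

text \<open>\<open>f\<close> is the family of the given parity and index. Both factors of \<open>\<zeta>\<close> are real, so taking
  the real part only changes the type.\<close>

fun modified_mathieu ::
    "parity \<Rightarrow> (real \<Rightarrow> complex \<Rightarrow> complex) \<Rightarrow> real \<Rightarrow> real \<Rightarrow> complex" where
  "modified_mathieu Plus f q \<xi> = f q (\<i> * of_real \<xi>)"
| "modified_mathieu Minus f q \<xi> = - \<i> * f q (\<i> * of_real \<xi>)"

definition mathieu_zeta ::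
    "parity \<Rightarrow> (real \<Rightarrow> complex \<Rightarrow> complex) \<Rightarrow> real \<Rightarrow> real \<Rightarrow> real \<Rightarrow> real" where
  "mathieu_zeta s f q \<xi> \<eta> = Re (modified_mathieu s f q \<xi> * f q (of_real \<eta>))"

definition quat_mathieu ::
    "parity \<Rightarrow> (real \<Rightarrow> complex \<Rightarrow> complex) \<Rightarrow> real \<Rightarrow> real \<Rightarrow> real \<Rightarrow> quat" where
  "quat_mathieu s f lam \<xi> \<eta> =
     (let G = (\<lambda>\<xi> \<eta>. qre (mathieu_zeta s f (lam\<^sup>2 / 4) \<xi> \<eta>))
      in - (1 / lam) *\<^sub>R (elliptic_Dirac G \<xi> \<eta> - lam *\<^sub>R G \<xi> \<eta>))"

text \<open>\<open>F\<^sub>n[\<alpha>;\<mu>]\<close> at \<open>z\<close>, with \<open>q = q(\<mu>)\<close>. Elliptical coordinates of \<open>z\<close> are not unique (on the focal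
  segment, and where \<open>\<eta>\<close> is 0 or \<open>2\<pi>\<close>), but the value does not depend on their choice. At the foci
  \<open>z = \<plusminus>1\<close> the coordinate expression of the operator is 0/0 and \<open>F\<close> is not meaningful.\<close>

definition F_approx ::
    "parity \<Rightarrow> nat \<Rightarrow> (real \<Rightarrow> complex \<Rightarrow> complex) \<Rightarrow> real \<Rightarrow> complex \<Rightarrow> quat" where
  "F_approx s n f q z = (THE v. \<exists>\<xi> \<eta>. 0 \<le> \<xi> \<and> 0 \<le> \<eta> \<and> \<eta> \<le> 2 * pi \<and> z = elliptic_point \<xi> \<eta> \<and>
     v = (q powr (real n / 2)) *\<^sub>R quat_mathieu s f (2 * sqrt q) \<xi> \<eta>)"


definition bessel_J :: "nat \<Rightarrow> real \<Rightarrow> real" where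
  "bessel_J n x = (\<Sum>k. (-1) ^ k / (fact k * fact (n + k)) * (x / 2) ^ (2 * k + n))"

fun Phi :: "parity \<Rightarrow> nat \<Rightarrow> complex \<Rightarrow> real" where
  "Phi Plus n w = cos (real n * Arg w)"
| "Phi Minus n w = sin (real n * Arg w)"

text \<open>With \<open>ce\<^sub>0 \<rightarrow> 1\<close> as \<open>q\<close> tends to 0, the constant for \<open>n = 0\<close> is 1: the scalar part of
  \<open>F\<^sub>0[\<alpha>;\<mu>](0)\<close> is \<open>ce\<^sub>0(0,q) ce\<^sub>0(\<pi>/2,q)\<close>, which tends to 1, whereas \<open>J\<^sub>0(0) = 1\<close>. The source has
  \<open>1/\<surd>2\<close> here, which is not the limit for this normalization (nor for the norm \<open>\<surd>\<pi>\<close>, which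
  would give \<open>1/2\<close>).\<close>

definition limit_beta :: "nat \<Rightarrow> real" where
  "limit_beta n = (if n = 0 then 1 else 2 ^ (n - 1) * fact n)"

definition F_limit_formula :: "parity \<Rightarrow> nat \<Rightarrow> real \<Rightarrow> complex \<Rightarrow> quat" where
  "F_limit_formula s n \<alpha> w =
     qre (limit_beta n * bessel_J n (\<alpha> * cmod w) * Phi s n w)
     - (limit_beta n / cmod w * deriv (bessel_J n) (\<alpha> * cmod w) * Phi s n w) *\<^sub>R
         (Re w *\<^sub>R qi + Im w *\<^sub>R qj)
     - (parity_sign s * (real n * limit_beta n / (\<alpha> * (cmod w)\<^sup>2)) * bessel_J n (\<alpha> * cmod w) *
          Phi (opposite s) n w) *\<^sub>R (Im w *\<^sub>R qi - Re w *\<^sub>R qj)"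

text \<open>The formula has a removable singularity at the origin.\<close>

definition F_limit :: "parity \<Rightarrow> nat \<Rightarrow> real \<Rightarrow> complex \<Rightarrow> quat" where
  "F_limit s n \<alpha> w = (if w = 0 then Lim (at 0) (F_limit_formula s n \<alpha>) else F_limit_formula s n \<alpha> w)"

end

theory Submission
  imports Defs
begin

text \<open>Writing the gradient of a real function \<open>u\<close> as \<open>p = u\<^sub>x - i u\<^sub>y\<close>, a function
  \<open>u - (1/\<lambda>) D u\<close> is \<open>\<lambda>\<close>-metamonogenic as soon as \<open>\<Delta>u = - \<lambda>\<^sup>2 u\<close>. Elliptical coordinates are the
  conformal map \<open>z = cosh (\<xi> + i \<eta>)\<close>, under which this equation separates into the Mathieu
  equation and the modified one; the symmetries of their solutions under \<open>\<omega> \<mapsto> - \<omega>\<close> and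
  \<open>\<omega> \<mapsto> \<omega> + 2\<pi>i\<close> make the product a function of \<open>z\<close>.

  For the limit, pointwise convergence together with the convergence of the norms gives
  \<open>\<integral> \<phi> cos n\<eta> \<rightarrow> \<integral> cos\<^sup>2 n\<eta>\<close>, and a Wronskian argument turns this into \<open>a = n\<^sup>2 + O(q)\<close> for the
  eigenvalue. The angular factor then converges with its derivative by Gronwall's inequality. At
  \<open>w/\<mu>\<close> the radial coordinate satisfies \<open>\<surd>q exp \<xi> \<rightarrow> \<alpha> |w|\<close>, and in the variable
  \<open>t = \<surd>q exp \<xi>\<close> the modified Mathieu equation is a small perturbation of Bessel's equation. An
  energy estimate, uniform on the growing interval \<open>[0, \<xi>]\<close>, shows that \<open>exp (- n\<xi>) C(\<xi>)\<close> tends to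
  the multiple of \<open>J\<^sub>n(t) / t\<^sup>n\<close> whose constant is fixed by \<open>C'(0) + n C(0)\<close>; the decaying part
  \<open>exp (- n\<xi>)\<close> of the initial data is damped away.\<close>

text \<open>The obstacle is the length of the radial interval. At w/\<mu> it ends near - (ln q) / 2,
  so a Gronwall estimate with a fixed positive rate would cost a negative power of q. The energy may
  grow only at a rate of order q, since q times the length still tends to 0. For the same reason the
  eigenvalue is estimated to order q and not merely in the limit: the perturbation gets divided by
  t, which starts at \<open>sqrt q\<close>. For n = 0 the combination C'(0) + n C(0) vanishes and
  carries no information; there C(0) itself fixes the constant, and its initial error has to tend to
  0 because nothing damps it. The point w = 0 is also separate: its coordinate stays at i\<pi>/2 and
  no growing interval occurs. Laplacians are computed as L 1 + i L i for the real derivative L of p.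
  This combination vanishes on complex linear maps, so holomorphic factors such as 1 / sinh are not
  differentiated at all.\<close>

section \<open>Reduced quaternions and Bessel functions\<close>

text \<open>The vector part enters conjugated, because \<open>p = 2 \<partial>u/\<partial>z\<close> is the conjugate of the gradient.\<close>

definition quat_of :: "real \<Rightarrow> complex \<Rightarrow> quat" where
  "quat_of u z = (u, Re z, - Im z, 0)"

lemma reduced_quat_of [simp]: "reduced (quat_of u z)"
  by (simp add: reduced_def quat_of_def)

lemma tendsto_quat_of:
  assumes "(u \<longlongrightarrow> u0) F" "(p \<longlongrightarrow> p0) F"
  shows "((\<lambda>x. quat_of (u x) (p x)) \<longlongrightarrow> quat_of u0 p0) F"
  unfolding quat_of_def using assms by (auto intro!: tendsto_intros)

text \<open>The real part of \<open>laplace\<close> is the Laplace equation for u, its imaginary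
  part the symmetry of the mixed derivatives. They give the scalar and the k component of the
  result; the i and j components cancel because p comes from the gradient of u.\<close>

lemma Dirac_quat_of:
  fixes u :: "complex \<Rightarrow> real" and p :: "complex \<Rightarrow> complex"
  assumes u: "(u has_derivative (\<lambda>h. Re (p z * h))) (at z)"
    and p: "(p has_derivative p') (at z)"
    and laplace: "p' 1 + \<i> * p' \<i> = - of_real (lam\<^sup>2 * u z)"
    and lam: "lam \<noteq> 0"
  defines "F \<equiv> \<lambda>z. quat_of (u z) (- p z / of_real lam)"
  shows "F differentiable (at z)" "Dirac F z + lam *\<^sub>R F z = 0"
proof -
  have F: "(F has_derivative (\<lambda>h. (Re (p z * h), - Re (p' h) / lam, Im (p' h) / lam, 0))) (at z)"
    unfolding F_def quat_of_def
  proof (intro has_derivative_Pair u has_derivative_const)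
    have pc: "((\<lambda>z. - p z / of_real lam) has_derivative (\<lambda>h. - p' h / of_real lam)) (at z)"
      using p by (auto intro!: derivative_eq_intros simp: divide_inverse)
    show "((\<lambda>z. Re (- p z / of_real lam)) has_derivative (\<lambda>h. - Re (p' h) / lam)) (at z)"
      using has_derivative_Re[OF pc] by simp
    show "((\<lambda>z. - Im (- p z / of_real lam)) has_derivative (\<lambda>h. Im (p' h) / lam)) (at z)"
      using has_derivative_minus[OF has_derivative_Im[OF pc]] by simp
  qed
  then show "F differentiable (at z)"
    by (auto simp: differentiable_def)
  have fr: "frechet_derivative F (at z) =
      (\<lambda>h. (Re (p z * h), - Re (p' h) / lam, Im (p' h) / lam, 0))"
    using frechet_derivative_at[OF F] by simp
  have 1: "Re (p' 1) - Im (p' \<i>) = - (lam\<^sup>2 * u z)" and 2: "Im (p' 1) + Re (p' \<i>) = 0"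
    using arg_cong[OF laplace, of Re] arg_cong[OF laplace, of Im] by simp_all
  have 1: "Re (p' 1) / lam - Im (p' \<i>) / lam + lam * u z = 0" 
    using 1 lam by (simp add: field_simps power2_eq_square)
  have 2: "Im (p' 1) / lam + Re (p' \<i>) / lam = 0"
    using 2 lam by (simp add: field_simps)
  show "Dirac F z + lam *\<^sub>R F z = 0"
    unfolding Dirac_def fr unfolding qi_def qj_def F_def quat_of_def
    using lam 1 2 by (simp add: zero_prod_def)
qed

text \<open>With L h = A h + B \<open>cnj h\<close> one has L 1 + i L i = 2 B, and replacing h by c
  h multiplies B by \<open>cnj c\<close>. This is one half of the scaling of the Laplacian under a
  conformal map.\<close>

lemma real_linear_mult:
  fixes L :: "complex \<Rightarrow> complex"
  assumes "linear L"
  shows "L c + \<i> * L (\<i> * c) = cnj c * (L 1 + \<i> * L \<i>)"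
proof -
  have L: "L (Complex x y) = of_real x * L 1 + of_real y * L \<i>" for x y
  proof -
    have "Complex x y = x *\<^sub>R 1 + y *\<^sub>R \<i>" by (simp add: complex_eq_iff)
    then have "L (Complex x y) = x *\<^sub>R L 1 + y *\<^sub>R L \<i>"
      using assms by (simp only: linear_add linear_scale)
    then show ?thesis by (simp add: scaleR_conv_of_real)
  qed
  obtain x y where c: "c = Complex x y" by (cases c)
  have "\<i> * c = Complex (-y) x" by (simp add: c complex_eq_iff)
  then show ?thesis by (simp add: c L[of x y] L[of "-y" x]) (simp add: complex_eq_iff algebra_simps)
qed

text \<open>The Bessel-Clifford function at -t. It is what remains of J_n after the power (x/2)^n is
  split off; that power can then be joined to the angular factor, which removes the singularity at
  the origin.\<close>

definition bessel_E :: "nat \<Rightarrow> real \<Rightarrow> real" where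
  "bessel_E n t = (\<Sum>k. (-1) ^ k / (fact k * fact (n + k)) * t ^ k)"

lemma summable_bessel_E: "summable (\<lambda>k. (-1) ^ k / (fact k * fact (n + k)) * t ^ k :: real)"
proof (rule summable_comparison_test)
  show "summable (\<lambda>k. \<bar>t\<bar> ^ k / fact k)"
    using summable_exp[of "\<bar>t\<bar>"] by (simp add: field_simps)
  have "norm ((-1) ^ k / (fact k * fact (n + k)) * t ^ k) \<le> \<bar>t\<bar> ^ k / fact k" for k
  proof -
    have "\<bar>t\<bar> ^ k / (fact k * fact (n + k)) \<le> \<bar>t\<bar> ^ k / (fact k * 1)"
      by (intro divide_left_mono mult_left_mono) (auto simp: fact_ge_1)
    then show ?thesis by (simp add: abs_mult power_abs)
  qed
  then show "\<exists>N. \<forall>k\<ge>N. norm ((-1) ^ k / (fact k * fact (n + k)) * t ^ k) \<le> \<bar>t\<bar> ^ k / fact k"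
    by blast
qed

lemma has_real_derivative_bessel_E:
  "(bessel_E n has_real_derivative - bessel_E (Suc n) t) (at t)"
proof -
  let ?c = "\<lambda>k. (-1) ^ k / (fact k * fact (n + k)) :: real"
  have "((\<lambda>t. \<Sum>k. ?c k * t ^ k) has_real_derivative (\<Sum>k. diffs ?c k * t ^ k)) (at t)"
    by (rule termdiffs_strong_converges_everywhere) (rule summable_bessel_E)
  moreover have "diffs ?c k = - ((-1) ^ k / (fact k * fact (Suc n + k)))" for k
    by (simp add: diffs_def field_simps del: of_nat_Suc)
  ultimately show ?thesis
    unfolding bessel_E_def[abs_def]
    by (simp add: suminf_minus[OF summable_bessel_E, of "Suc n", simplified])
qed

text \<open>Since the derivative of E_n is - E_(n+1), this is Bessel's equation in the form t y'' +
  (n + 1) y' + y = 0 for y = E_n.\<close>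

lemma bessel_E_recurrence:
  "t * bessel_E (Suc (Suc n)) t - (real n + 1) * bessel_E (Suc n) t + bessel_E n t = 0"
proof -
  let ?c = "\<lambda>n k. (-1) ^ k / (fact k * fact (n + k)) * t ^ k :: real"
  have s: "summable (?c m)" for m by (rule summable_bessel_E)
  \<comment> \<open>Multiplication by t shifts the series by one index. At k = j + 1 the three
    coefficients are then multiples of \<open>?u\<close>, and their combination has the factor (j +
    1) + (n + 1) - (n + j + 2) = 0.\<close>
  let ?d = "\<lambda>k. case k of 0 \<Rightarrow> 0 | Suc j \<Rightarrow> t * ?c (Suc (Suc n)) j"
  have d: "?d sums (t * bessel_E (Suc (Suc n)) t)"
    unfolding bessel_E_def
    using sums_Suc_iff[of ?d "t * suminf (?c (Suc (Suc n)))"]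
      sums_mult[OF summable_sums[OF s[of "Suc (Suc n)"]], of t] by (simp del: fact_Suc)
  have z: "?d k - (real n + 1) * ?c (Suc n) k + ?c n k = 0" for k
  proof (cases k)
    case 0 
    have "(1 + real n) * (1 / ((1 + real n) * fact n)) = 1 / fact n"
      by (subst mult_divide_mult_cancel_left[symmetric, of "1 + real n"]) auto
    with 0 show ?thesis by (simp add: add.commute)
  next
    case (Suc j)
    let ?u = "(-1) ^ j * t ^ Suc j / (fact (Suc j) * fact (Suc (Suc (n + j)))) :: real"
    have f: "fact (Suc m) = (real m + 1) * (fact m :: real)" for m by simp
    have 1: "?d k = (real j + 1) * ?u"
      unfolding Suc by (simp add: field_simps del: fact_Suc) (simp add: f field_simps)
    have 2: "?c (Suc n) k = - ?u"
      unfolding Suc by (simp add: field_simps del: fact_Suc)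
    have 3: "?c n k = - (real n + real j + 2) * ?u"
    proof -
      have "?c n k = - ((-1) ^ j * t ^ Suc j / (fact (Suc j) * fact (Suc (n + j))))"
        unfolding Suc by (simp add: field_simps del: fact_Suc)
      also have "\<dots> = - (real n + real j + 2) * ?u"
        unfolding f[of "Suc (n + j)"] by (simp add: divide_simps del: fact_Suc) (simp add: field_simps del: fact_Suc)
      finally show ?thesis .
    qed
    have "(real j + 1) * u - (real n + 1) * (- u) + (- (real n + real j + 2) * u) = 0" for u
      by (simp add: algebra_simps)
    then show ?thesis unfolding 1 2 3 .
  qed
  have "(\<lambda>k. ?d k - (real n + 1) * ?c (Suc n) k + ?c n k) sums
      (t * bessel_E (Suc (Suc n)) t - (real n + 1) * bessel_E (Suc n) t + bessel_E n t)"
    by (intro sums_add sums_diff d sums_mult)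
       (unfold bessel_E_def, (rule summable_sums[OF s])+)
  then show ?thesis unfolding z by (rule sums_unique2[OF _ sums_zero])
qed

lemma bessel_E_0 [simp]: "bessel_E n 0 = 1 / fact n"
proof -
  have "(\<lambda>k. (-1) ^ k / (fact k * fact (n + k)) * 0 ^ k :: real) = (\<lambda>k. if k = 0 then 1 / fact n else 0)"
    by auto
  then show ?thesis unfolding bessel_E_def using sums_single[of 0 "\<lambda>_. 1 / fact n :: real"]
    by (simp add: sums_iff)
qed

lemma bessel_J_eq: "bessel_J n x = (x / 2) ^ n * bessel_E n ((x / 2)\<^sup>2)"
proof -
  have "(x / 2) ^ (2 * k + n) = (x / 2) ^ n * ((x / 2)\<^sup>2) ^ k" for k
    by (simp only: power_add power_mult) (rule mult.commute)
  then show ?thesis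
    unfolding bessel_J_def bessel_E_def suminf_mult[OF summable_bessel_E, symmetric]
    by (simp only: mult.left_commute)
qed

lemma deriv_bessel_J:
  "deriv (bessel_J n) x = real n / 2 * (x / 2) ^ (n - 1) * bessel_E n ((x / 2)\<^sup>2)
     - (x / 2) ^ Suc n * bessel_E (Suc n) ((x / 2)\<^sup>2)"
proof (rule DERIV_imp_deriv)
  have "bessel_J n = (\<lambda>x. (x / 2) ^ n * bessel_E n ((x / 2)\<^sup>2))"
    by (rule ext) (rule bessel_J_eq)
  moreover have "((\<lambda>x. (x / 2) ^ n * bessel_E n ((x / 2)\<^sup>2)) has_real_derivative
      (real n * (x / 2) ^ (n - 1) * (1 / 2)) * bessel_E n ((x / 2)\<^sup>2)
        + - bessel_E (Suc n) ((x / 2)\<^sup>2) * (x / 2) * (x / 2) ^ n) (at x)"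
    by (auto intro!: derivative_eq_intros DERIV_chain2[OF has_real_derivative_bessel_E])
  ultimately show "(bessel_J n has_real_derivative real n / 2 * (x / 2) ^ (n - 1) * bessel_E n ((x / 2)\<^sup>2)
     - (x / 2) ^ Suc n * bessel_E (Suc n) ((x / 2)\<^sup>2)) (at x)"
    by (simp add: mult_ac)
qed

section \<open>The limit functions\<close>

text \<open>With this constant c, Re (c w^n) is the harmonic polynomial r^n cos n\<theta> or r^n sin
  n\<theta>. The same c is the factor in front of f in \<open>modified_mathieu\<close>.\<close>

fun parity_unit :: "parity \<Rightarrow> complex" where
  "parity_unit Plus = 1"
| "parity_unit Minus = - \<i>"

definition angular :: "parity \<Rightarrow> nat \<Rightarrow> real \<Rightarrow> real" where
  "angular s n \<theta> = (case s of Plus \<Rightarrow> cos (real n * \<theta>) | Minus \<Rightarrow> sin (real n * \<theta>))"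

definition angular' :: "parity \<Rightarrow> nat \<Rightarrow> real \<Rightarrow> real" where
  "angular' s n \<theta> = (case s of Plus \<Rightarrow> - real n * sin (real n * \<theta>) | Minus \<Rightarrow> real n * cos (real n * \<theta>))"

lemma parity_unit_cis:
  "Re (parity_unit s * cis (real n * \<theta>)) = angular s n \<theta>"
  "real n * (parity_unit s * cis (real n * \<theta>)) = Complex (n * angular s n \<theta>) (- angular' s n \<theta>)"
  by (cases s; simp add: angular_def angular'_def complex_eq_iff)+

lemma Re_of_real_mult: "Re (of_real a * z) = a * Re z"
  by simp

lemma Phi_eq_angular: "Phi s n w = angular s n (Arg w)"
  by (cases s) (simp_all add: angular_def)

lemma Phi_opposite: "- (parity_sign s * real n * Phi (opposite s) n w) = angular' s n (Arg w)"
  by (cases s) (simp_all add: angular'_def)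

text \<open>The scalar part of the limit as an entire function of |w|^2 times a harmonic polynomial,
  without division by |w|.\<close>

definition limit_scalar :: "parity \<Rightarrow> nat \<Rightarrow> real \<Rightarrow> complex \<Rightarrow> real" where
  "limit_scalar s n \<alpha> w = limit_beta n * (\<alpha> / 2) ^ n * bessel_E n (\<alpha>\<^sup>2 / 4 * (cmod w)\<^sup>2) *
     Re (parity_unit s * w ^ n)"

text \<open>This is u_x - i u_y for u = \<open>limit_scalar\<close>: one summand differentiates the
  harmonic polynomial, the other the radial factor. For n = 0 the truncated exponent n - 1 is 0, and
  the factor n removes that summand.\<close>

definition limit_gradient :: "parity \<Rightarrow> nat \<Rightarrow> real \<Rightarrow> complex \<Rightarrow> complex" where
  "limit_gradient s n \<alpha> w = of_real (limit_beta n * (\<alpha> / 2) ^ n) *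
     (of_real (bessel_E n (\<alpha>\<^sup>2 / 4 * (cmod w)\<^sup>2)) * (of_nat n * parity_unit s * w ^ (n - 1))
      - of_real (\<alpha>\<^sup>2 / 2 * bessel_E (Suc n) (\<alpha>\<^sup>2 / 4 * (cmod w)\<^sup>2) * Re (parity_unit s * w ^ n)) * cnj w)"

lemma has_derivative_norm_power2:
  "((\<lambda>w. (cmod w)\<^sup>2) has_derivative (\<lambda>h. 2 * Re (cnj w * h))) (at w)"
  unfolding cmod_power2
  by (auto intro!: derivative_eq_intros simp: algebra_simps)

lemma has_derivative_bessel_E_norm:
  "((\<lambda>w. bessel_E n (c * (cmod w)\<^sup>2)) has_derivative
     (\<lambda>h. - 2 * c * bessel_E (Suc n) (c * (cmod w)\<^sup>2) * Re (cnj w * h))) (at w)"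
proof -
  have "((\<lambda>w. c * (cmod w)\<^sup>2) has_derivative (\<lambda>h. c * (2 * Re (cnj w * h)))) (at w)"
    by (intro has_derivative_mult_right has_derivative_norm_power2)
  from DERIV_compose_FDERIV[OF has_real_derivative_bessel_E this, of n]
  show ?thesis by (simp only: mult_ac mult_minus_left mult_minus_right)
qed

lemma has_derivative_Re_power:
  "((\<lambda>w. Re (c * w ^ n)) has_derivative (\<lambda>h. Re (of_nat n * c * w ^ (n - 1) * h))) (at w)"
proof -
  have "((\<lambda>w. c * w ^ n) has_field_derivative (of_nat n * c * w ^ (n - 1))) (at w)"
    by (auto intro!: derivative_eq_intros)
  then show ?thesis
    by (intro has_derivative_Re) (simp add: has_field_derivative_def)
qed

lemma Re_wirtinger: "of_real (Re a) + \<i> * of_real (Re (a * \<i>)) = cnj a"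
  by (simp add: complex_eq_iff)

lemma has_derivative_limit_scalar:
  "(limit_scalar s n \<alpha> has_derivative (\<lambda>h. Re (limit_gradient s n \<alpha> w * h))) (at w)"
proof -
  let ?E = "bessel_E n (\<alpha>\<^sup>2 / 4 * (cmod w)\<^sup>2)" and ?R = "Re (parity_unit s * w ^ n)"
  let ?E' = "bessel_E (Suc n) (\<alpha>\<^sup>2 / 4 * (cmod w)\<^sup>2)" 
  let ?k = "limit_beta n * (\<alpha> / 2) ^ n"
  have "((\<lambda>w. ?k * (bessel_E n (\<alpha>\<^sup>2 / 4 * (cmod w)\<^sup>2) * Re (parity_unit s * w ^ n))) has_derivative
     (\<lambda>h. ?k * (?E * Re (of_nat n * parity_unit s * w ^ (n - 1) * h)
       + (- 2 * (\<alpha>\<^sup>2 / 4) * ?E' * Re (cnj w * h)) * ?R))) (at w)"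
    by (intro has_derivative_mult_right has_derivative_mult has_derivative_bessel_E_norm has_derivative_Re_power)
  moreover have "(\<lambda>h. ?k * (?E * Re (of_nat n * parity_unit s * w ^ (n - 1) * h)
       + (- 2 * (\<alpha>\<^sup>2 / 4) * ?E' * Re (cnj w * h)) * ?R)) = (\<lambda>h. Re (limit_gradient s n \<alpha> w * h))"
  proof -
    have *: "k * (e * Re (c * h) + (- 2 * (\<alpha>\<^sup>2 / 4) * e' * Re (d * h)) * r) =
        Re (of_real k * (of_real e * c - of_real (\<alpha>\<^sup>2 / 2 * e' * r) * d) * h)"
      for k e e' r and c d h :: complex
      by (simp add: algebra_simps)
    show ?thesis unfolding limit_gradient_def by (rule ext) (rule *)
  qed
  ultimately show ?thesis 
    unfolding limit_scalar_def[abs_def] by (simp only: mult.assoc)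
qed

text \<open>The terms with \<open>?S\<close> cancel, being complex linear in h. Euler's relation for
  the harmonic polynomial collects the first-order terms, and what is left is Bessel's equation at
  \<alpha>^2 |w|^2 / 4 in the form \<open>bessel_E_recurrence\<close>.\<close>

lemma limit_laplace:
  obtains p' where "(limit_gradient s n \<alpha> has_derivative p') (at w)"
    and "p' 1 + \<i> * p' \<i> = - of_real (\<alpha>\<^sup>2 * limit_scalar s n \<alpha> w)"
proof -
  let ?c = "\<alpha>\<^sup>2 / 4"
  let ?E = "\<lambda>m w. bessel_E m (?c * (cmod w)\<^sup>2)" and ?R = "\<lambda>w. Re (parity_unit s * w ^ n)"
  let ?k = "limit_beta n * (\<alpha> / 2) ^ n"
  let ?Q = "\<lambda>w. of_nat n * parity_unit s * w ^ (n - 1)"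
  let ?S = "of_nat n * parity_unit s * (of_nat (n - 1) * w ^ (n - 1 - 1))"
  define p' where "p' = (\<lambda>h. of_real ?k *
     ((of_real (?E n w) * (?S * h) + of_real (- 2 * ?c * ?E (Suc n) w * Re (cnj w * h)) * ?Q w)
      - (of_real (\<alpha>\<^sup>2 / 2 * ?E (Suc n) w * ?R w) * cnj h
         + of_real (\<alpha>\<^sup>2 / 2 * ?E (Suc n) w * Re (?Q w * h) +
             \<alpha>\<^sup>2 / 2 * (- 2 * ?c * ?E (Suc (Suc n)) w * Re (cnj w * h)) * ?R w) * cnj w)))"
  have Q: "(?Q has_derivative (\<lambda>h. ?S * h)) (at w)"
  proof -
    have "(?Q has_field_derivative ?S) (at w)"
      by (auto intro!: derivative_eq_intros)
    then show ?thesis by (simp add: has_field_derivative_def)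
  qed
  have "(limit_gradient s n \<alpha> has_derivative p') (at w)"
    unfolding limit_gradient_def[abs_def] p'_def
    by (intro has_derivative_mult_right has_derivative_diff has_derivative_mult has_derivative_of_real
        has_derivative_bessel_E_norm has_derivative_Re_power has_derivative_cnj has_derivative_ident Q)
  moreover have "p' 1 + \<i> * p' \<i> = - of_real (\<alpha>\<^sup>2 * limit_scalar s n \<alpha> w)"
  proof -
    let ?q = "?Q w" and ?r = "?R w"
    have alg: "k * ((e * (S * 1) + complex_of_real (- 2 * c * e1 * Re (cnj w * 1)) * q)
      - (of_real (a * e1 * r) * cnj 1
         + of_real (a * e1 * Re (q * 1) + a * (- 2 * c * e2 * Re (cnj w * 1)) * r) * cnj w))
      + \<i> * (k * ((e * (S * \<i>) + of_real (- 2 * c * e1 * Re (cnj w * \<i>)) * q)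
      - (of_real (a * e1 * r) * cnj \<i>
         + of_real (a * e1 * Re (q * \<i>) + a * (- 2 * c * e2 * Re (cnj w * \<i>)) * r) * cnj w)))
      = k * (- of_real (2 * c * e1) * (w * q) - 2 * of_real (a * e1 * r)
         - of_real (a * e1) * cnj (w * q) + of_real (2 * a * c * e2 * r) * (w * cnj w))"
      for k e S q :: complex and c e1 e2 r a :: real
    proof -
      have 1: "w = of_real (Re (cnj w * 1)) + \<i> * of_real (Re (cnj w * \<i>))"
        using Re_wirtinger[of "cnj w"] by simp
      have 2: "cnj q = of_real (Re (q * 1)) + \<i> * of_real (Re (q * \<i>))"
        using Re_wirtinger[of q] by simp
      show ?thesis
      proof -
        define x1 where "x1 = complex_of_real (Re (cnj w * 1))"
        define x2 where "x2 = complex_of_real (Re (cnj w * \<i>))"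
        define y1 where "y1 = complex_of_real (Re (q * 1))"
        define y2 where "y2 = complex_of_real (Re (q * \<i>))"
        define v where "v = cnj w"
        have "cnj (w * q) = v * (y1 + \<i> * y2)" using 2 by (simp add: v_def y1_def y2_def)
        moreover have w: "w = x1 + \<i> * x2" using 1 by (simp only: x1_def x2_def)
        ultimately show ?thesis
          unfolding of_real_mult of_real_add of_real_minus x1_def[symmetric] x2_def[symmetric]
            y1_def[symmetric] y2_def[symmetric]
          unfolding v_def[symmetric]
          by (simp only: w) (simp add: algebra_simps)
      qed
    qed
    have wq: "w * ?q = of_nat n * (parity_unit s * w ^ n)"
      by (cases n) (simp_all add: algebra_simps)
    have sum: "w * ?q + cnj (w * ?q) = of_real (2 * real n * ?r)"
      unfolding complex_add_cnj unfolding wq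
      using Re_of_real_mult[of n "parity_unit s * w ^ n"] by simp
    have ww: "w * cnj w = of_real ((cmod w)\<^sup>2)"
      by (simp only: complex_norm_square)
    have "p' 1 + \<i> * p' \<i> = of_real ?k * (- of_real (2 * ?c * ?E (Suc n) w) * (w * ?q)
         - 2 * of_real (\<alpha>\<^sup>2 / 2 * ?E (Suc n) w * ?r)
         - of_real (\<alpha>\<^sup>2 / 2 * ?E (Suc n) w) * cnj (w * ?q)
         + of_real (2 * (\<alpha>\<^sup>2 / 2) * ?c * ?E (Suc (Suc n)) w * ?r) * (w * cnj w))"
      unfolding p'_def by (rule alg)
    also have "\<dots> = of_real ?k * (- of_real (\<alpha>\<^sup>2 / 2 * ?E (Suc n) w) * (w * ?q + cnj (w * ?q))
         - of_real (\<alpha>\<^sup>2 * ?E (Suc n) w * ?r)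
         + of_real (2 * (\<alpha>\<^sup>2 / 2) * ?c * ?E (Suc (Suc n)) w * ?r) * of_real ((cmod w)\<^sup>2))"
    proof -
      have "K * (- of_real (2 * (x / 4) * e1) * W - 2 * of_real (x / 2 * e1 * r) - of_real (x / 2 * e1) * V + Z)
          = K * (- of_real (x / 2 * e1) * (W + V) - of_real (x * e1 * r) + Z)"
        for K W V Z :: complex and x e1 r by (simp add: algebra_simps)
      then show ?thesis unfolding ww .
    qed
    also have "\<dots> = of_real (?k * \<alpha>\<^sup>2 * ?r * (?c * (cmod w)\<^sup>2 * ?E (Suc (Suc n)) w - (real n + 1) * ?E (Suc n) w))"
    proof -
      have "of_real k * (- of_real (x / 2 * e1) * of_real (2 * m * r) - of_real (x * e1 * r)
          + of_real (2 * (x / 2) * c * e2 * r) * of_real t)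
          = complex_of_real (k * x * r * (c * t * e2 - (m + 1) * e1))"
        for k x r c t e1 e2 m by (simp add: algebra_simps)
      then show ?thesis unfolding sum .
    qed
    also have "?c * (cmod w)\<^sup>2 * ?E (Suc (Suc n)) w - (real n + 1) * ?E (Suc n) w = - ?E n w"
      using bessel_E_recurrence[of "?c * (cmod w)\<^sup>2" n] by linarith
    finally show ?thesis unfolding limit_scalar_def by (simp add: algebra_simps)
  qed
  ultimately show thesis by (rule that)
qed

text \<open>For a gradient p = u_x - i u_y one has w p = r u_r - i u_\<theta>. In this form the
  limits of the radial and the angular Mathieu factor can be compared with the limit function
  directly.\<close>

lemma limit_polar:
  fixes r \<theta> \<alpha> :: real and n :: nat
  assumes w: "w = of_real r * cis \<theta>"
  defines "E \<equiv> bessel_E n ((\<alpha> * r)\<^sup>2 / 4)" and "E' \<equiv> bessel_E (Suc n) ((\<alpha> * r)\<^sup>2 / 4)"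
    and "k \<equiv> limit_beta n / 2 ^ n * (\<alpha> * r) ^ n"
  shows "limit_scalar s n \<alpha> w = k * E * angular s n \<theta>"
    and "w * limit_gradient s n \<alpha> w =
      Complex (k * (real n * E - (\<alpha> * r)\<^sup>2 / 2 * E') * angular s n \<theta>) (- (k * E * angular' s n \<theta>))"
proof -
  let ?k = "limit_beta n * (\<alpha> / 2) ^ n" and ?g = "angular s n \<theta>" and ?g' = "angular' s n \<theta>"
  have norm: "(cmod w)\<^sup>2 = r\<^sup>2" by (simp add: w norm_mult)
  have arg: "\<alpha>\<^sup>2 / 4 * r\<^sup>2 = (\<alpha> * r)\<^sup>2 / 4" by (simp add: power_mult_distrib)
  have k: "?k * r ^ n = k" by (simp add: k_def power_mult_distrib power_divide)
  have pw: "parity_unit s * w ^ n = of_real (r ^ n) * (parity_unit s * cis (real n * \<theta>))"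
    by (simp add: w power_mult_distrib Complex.DeMoivre)
  have R: "Re (parity_unit s * w ^ n) = r ^ n * ?g"
    unfolding pw parity_unit_cis(1)[symmetric] by (rule Re_of_real_mult)
  have N: "w * (of_nat n * parity_unit s * w ^ (n - 1)) = of_real (r ^ n) * Complex (n * ?g) (- ?g')"
  proof -
    have "w * (of_nat n * parity_unit s * w ^ (n - 1)) = real n * (parity_unit s * w ^ n)"
      by (cases n) (simp_all add: algebra_simps)
    then show ?thesis unfolding pw parity_unit_cis(2)[symmetric] by (simp add: algebra_simps)
  qed
  show "limit_scalar s n \<alpha> w = k * E * ?g"
    unfolding limit_scalar_def norm arg R k[symmetric] E_def by simp
  have "w * limit_gradient s n \<alpha> w = of_real ?k *
     (of_real E * (w * (of_nat n * parity_unit s * w ^ (n - 1)))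
      - of_real (\<alpha>\<^sup>2 / 2 * E' * Re (parity_unit s * w ^ n)) * (w * cnj w))"
    unfolding limit_gradient_def norm arg E_def E'_def by (simp add: algebra_simps)
  also have "w * cnj w = of_real (r\<^sup>2)"
    unfolding norm[symmetric] by (simp only: complex_norm_square)
  also have "of_real ?k * (of_real E * (w * (of_nat n * parity_unit s * w ^ (n - 1)))
      - of_real (\<alpha>\<^sup>2 / 2 * E' * Re (parity_unit s * w ^ n)) * of_real (r\<^sup>2)) =
      Complex (k * (real n * E - (\<alpha> * r)\<^sup>2 / 2 * E') * ?g) (- (k * E * ?g'))"
    unfolding N R k[symmetric] by (simp add: complex_eq_iff algebra_simps power_mult_distrib)
  finally show "w * limit_gradient s n \<alpha> w =
      Complex (k * (real n * E - (\<alpha> * r)\<^sup>2 / 2 * E') * ?g) (- (k * E * ?g'))" .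
qed

lemma F_limit_formula_eq:
  assumes "w \<noteq> 0" "0 < \<alpha>"
  shows "F_limit_formula s n \<alpha> w = quat_of (limit_scalar s n \<alpha> w) (- limit_gradient s n \<alpha> w / of_real \<alpha>)"
proof -
  define r \<theta> where "r = cmod w" and "\<theta> = Arg w"
  have r: "r > 0" using assms by (simp add: r_def)
  have w: "w = of_real r * cis \<theta>"
    unfolding r_def \<theta>_def using Arg_eq[OF assms(1)] by (simp add: cis_conv_exp)
  let ?E = "bessel_E n ((\<alpha> * r)\<^sup>2 / 4)" and ?E' = "bessel_E (Suc n) ((\<alpha> * r)\<^sup>2 / 4)"
  let ?k = "limit_beta n / 2 ^ n * (\<alpha> * r) ^ n"
  let ?g = "angular s n \<theta>" and ?g' = "angular' s n \<theta>"
  have sq: "(\<alpha> * r / 2)\<^sup>2 = (\<alpha> * r)\<^sup>2 / 4" by (simp add: power_divide)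
  have J: "limit_beta n * bessel_J n (\<alpha> * r) = ?k * ?E"
    unfolding bessel_J_eq sq by (simp add: power_divide)
  have J': "limit_beta n * (\<alpha> * r * deriv (bessel_J n) (\<alpha> * r)) =
      ?k * (real n * ?E - (\<alpha> * r)\<^sup>2 / 2 * ?E')"
  proof -
    have "\<alpha> * r * deriv (bessel_J n) (\<alpha> * r) =
        (\<alpha> * r / 2) ^ n * (real n * ?E - (\<alpha> * r)\<^sup>2 / 2 * ?E')"
      unfolding deriv_bessel_J sq
      by (cases n) (simp_all add: algebra_simps power2_eq_square)
    then show ?thesis by (simp add: power_divide)
  qed
  \<comment> \<open>A = r u_r and B = - u_\<theta>. Multiplication by \<open>cnj w\<close> / r^2 = 1
    / w leads back to the gradient and produces the radial and the tangential vector of the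
    formula.\<close>
  define A B where "A = limit_beta n * (\<alpha> * r * deriv (bessel_J n) (\<alpha> * r)) * ?g"
    and "B = - (limit_beta n * bessel_J n (\<alpha> * r) * ?g')"
  have wp: "w * limit_gradient s n \<alpha> w = Complex A B"
    unfolding A_def B_def J J' by (rule limit_polar(2)[OF w])
  have "of_real (r\<^sup>2) * limit_gradient s n \<alpha> w = cnj w * Complex A B"
    unfolding wp[symmetric] r_def complex_norm_square by (simp add: mult_ac)
  then have p: "limit_gradient s n \<alpha> w = cnj w * Complex A B / of_real (r\<^sup>2)"
    using r by (simp add: field_simps)
  have o: "parity_sign s * (real n * limit_beta n / (\<alpha> * r\<^sup>2)) * bessel_J n (\<alpha> * r) * Phi (opposite s) n w
      = B / (\<alpha> * r\<^sup>2)"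
  proof -
    have g': "?g' = - (parity_sign s * real n * Phi (opposite s) n w)"
      unfolding Phi_opposite \<theta>_def ..
    show ?thesis unfolding B_def g' by simp
  qed
  have J'': "limit_beta n / r * deriv (bessel_J n) (\<alpha> * r) * ?g = A / (\<alpha> * r\<^sup>2)"
    unfolding A_def using r assms(2) by (simp add: field_simps power2_eq_square)
  have sc: "limit_scalar s n \<alpha> w = limit_beta n * bessel_J n (\<alpha> * r) * ?g"
    unfolding J by (rule limit_polar(1)[OF w])
  show ?thesis
    unfolding F_limit_formula_def sc p quat_of_def qre_def qi_def qj_def r_def[symmetric] o
      Phi_eq_angular[of s] \<theta>_def[symmetric] J''
    using r assms(2) by (simp add: field_simps)
qed

section \<open>Products of Mathieu functions in elliptical coordinates\<close>

text \<open>The right-hand side is continuous on the whole plane, so the \<open>Lim\<close> that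
  defines the value at 0 exists and equals it.\<close>

lemma F_limit_eq:
  assumes "0 < \<alpha>"
  shows "F_limit s n \<alpha> w = quat_of (limit_scalar s n \<alpha> w) (- limit_gradient s n \<alpha> w / of_real \<alpha>)"
proof (cases "w = 0")
  case True
  have u: "(limit_scalar s n \<alpha> \<longlongrightarrow> limit_scalar s n \<alpha> 0) (at 0)"
    using has_derivative_continuous[OF has_derivative_limit_scalar] by (simp add: continuous_at)
  obtain p' where "(limit_gradient s n \<alpha> has_derivative p') (at 0)"
    by (rule limit_laplace)
  from has_derivative_continuous[OF this]
  have p: "(limit_gradient s n \<alpha> \<longlongrightarrow> limit_gradient s n \<alpha> 0) (at 0)"
    by (simp add: continuous_at)
  have "((\<lambda>w. quat_of (limit_scalar s n \<alpha> w) (- limit_gradient s n \<alpha> w / of_real \<alpha>)) \<longlongrightarrow>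
      quat_of (limit_scalar s n \<alpha> 0) (- limit_gradient s n \<alpha> 0 / of_real \<alpha>)) (at 0)"
    using assms by (intro tendsto_quat_of tendsto_intros u p) auto
  moreover have "\<forall>\<^sub>F w in at 0. quat_of (limit_scalar s n \<alpha> w) (- limit_gradient s n \<alpha> w / of_real \<alpha>)
      = F_limit_formula s n \<alpha> w"
    using F_limit_formula_eq[OF _ assms, of _ s n] by (auto simp: eventually_at_filter)
  ultimately have "(F_limit_formula s n \<alpha> \<longlongrightarrow>
      quat_of (limit_scalar s n \<alpha> 0) (- limit_gradient s n \<alpha> 0 / of_real \<alpha>)) (at 0)"
    by (rule Lim_transform_eventually)
  then show ?thesis
    using True by (simp add: F_limit_def tendsto_Lim)
qed (simp add: F_limit_def F_limit_formula_eq assms)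

lemma metamonogenic_F_limit:
  assumes "0 < \<alpha>"
  shows "metamonogenic \<alpha> S (F_limit s n \<alpha>)"
proof -
  have F: "F_limit s n \<alpha> = (\<lambda>w. quat_of (limit_scalar s n \<alpha> w) (- limit_gradient s n \<alpha> w / of_real \<alpha>))"
    using F_limit_eq[OF assms] by blast
  show ?thesis
    unfolding metamonogenic_def F
  proof (intro conjI ballI reduced_quat_of)
    show "\<alpha> \<noteq> 0" using assms by simp
    fix z
    obtain p' where p: "(limit_gradient s n \<alpha> has_derivative p') (at z)"
      and l: "p' 1 + \<i> * p' \<i> = - of_real (\<alpha>\<^sup>2 * limit_scalar s n \<alpha> z)"
      by (rule limit_laplace)
    from Dirac_quat_of[OF has_derivative_limit_scalar p l \<open>\<alpha> \<noteq> 0\<close>]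
    show "(\<lambda>w. quat_of (limit_scalar s n \<alpha> w) (- limit_gradient s n \<alpha> w / of_real \<alpha>)) differentiable (at z)"
      and "Dirac (\<lambda>w. quat_of (limit_scalar s n \<alpha> w) (- limit_gradient s n \<alpha> w / of_real \<alpha>)) z +
         \<alpha> *\<^sub>R quat_of (limit_scalar s n \<alpha> z) (- limit_gradient s n \<alpha> z / of_real \<alpha>) = 0"
      by auto
  qed
qed

section \<open>The coordinate map cosh and its fibres\<close>

lemma sinh_eq_Complex: "sinh z = Complex (sinh (Re z) * cos (Im z)) (cosh (Re z) * sin (Im z))"
  by (simp add: complex_eq_iff sinh_field_def cosh_field_def Re_exp Im_exp algebra_simps diff_divide_distrib add_divide_distrib)

lemma cosh_eq_Complex: "cosh z = Complex (cosh (Re z) * cos (Im z)) (sinh (Re z) * sin (Im z))"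
  by (simp add: complex_eq_iff sinh_field_def cosh_field_def Re_exp Im_exp algebra_simps diff_divide_distrib add_divide_distrib)

lemma norm_sinh_power2: "(cmod (sinh z))\<^sup>2 = (cosh (2 * Re z) - cos (2 * Im z)) / 2"
proof -
  have "(cmod (sinh z))\<^sup>2 = (sinh (Re z))\<^sup>2 * (cos (Im z))\<^sup>2 + (cosh (Re z))\<^sup>2 * (sin (Im z))\<^sup>2"
    by (simp add: sinh_eq_Complex cmod_power2 power_mult_distrib)
  also have "\<dots> = (cosh (2 * Re z) - cos (2 * Im z)) / 2"
    unfolding cosh_double cos_double cosh_square_eq cos_squared_eq by (simp add: algebra_simps)
  finally show ?thesis .
qed

text \<open>Comes from \<open>complex_cos_eq\<close> by cosh z = cos (i z); this rotation reverses
  the sign of the integer, hence the reindexing at the end. The fibres are the whole ambiguity of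
  elliptical coordinates.\<close>

lemma cosh_eq_iff_complex:
  fixes z w :: complex
  shows "cosh w = cosh z \<longleftrightarrow> (\<exists>n\<in>\<int>. w = z + of_real (2 * n * pi) * \<i> \<or> w = - z + of_real (2 * n * pi) * \<i>)"
proof -
  have *: "\<i> * w = x + of_real t \<longleftrightarrow> w = - \<i> * x + of_real (- t) * \<i>" for x t
    by (auto simp: complex_eq_iff)
  have "cosh w = cosh z \<longleftrightarrow> (\<exists>n\<in>\<int>. w = z + of_real (- (2 * n * pi)) * \<i> \<or> w = - z + of_real (- (2 * n * pi)) * \<i>)"
    unfolding cosh_conv_cos complex_cos_eq * by (simp add: algebra_simps)
  also have "\<dots> \<longleftrightarrow> (\<exists>n\<in>\<int>. w = z + of_real (2 * n * pi) * \<i> \<or> w = - z + of_real (2 * n * pi) * \<i>)"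
  proof (intro iffI; elim bexE)
    fix n :: real assume "n \<in> \<int>" "w = z + of_real (- (2 * n * pi)) * \<i> \<or> w = - z + of_real (- (2 * n * pi)) * \<i>"
    then show "\<exists>n\<in>\<int>. w = z + of_real (2 * n * pi) * \<i> \<or> w = - z + of_real (2 * n * pi) * \<i>"
      by (intro bexI[of _ "- n"]) auto
  next
    fix n :: real assume "n \<in> \<int>" "w = z + of_real (2 * n * pi) * \<i> \<or> w = - z + of_real (2 * n * pi) * \<i>"
    then show "\<exists>n\<in>\<int>. w = z + of_real (- (2 * n * pi)) * \<i> \<or> w = - z + of_real (- (2 * n * pi)) * \<i>"
      by (intro bexI[of _ "- n"]) auto
  qed
  finally show ?thesis .
qed

lemma sinh_eq_0_iff_cosh: "sinh (z::complex) = 0 \<longleftrightarrow> cosh z \<in> {1, -1}"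
  using hyperbolic_pythagoras[of z] by (auto simp: power2_eq_1_iff)

lemma elliptic_point_eq: "elliptic_point \<xi> \<eta> = cosh (Complex \<xi> \<eta>)"
  by (simp add: elliptic_point_def cosh_eq_Complex)

text \<open>By \<open>Arccos\<close> the map cosh is onto; its evenness then makes \<xi>
  nonnegative, and its period 2\<pi>i brings \<eta> into the range.\<close>

lemma elliptic_coordinates_exist:
  obtains \<xi> \<eta> where "0 \<le> \<xi>" "0 \<le> \<eta>" "\<eta> \<le> 2 * pi" "z = elliptic_point \<xi> \<eta>"
proof -
  obtain \<omega>0 where \<omega>0: "cosh \<omega>0 = z"
    using cosh_conv_cos[of "- \<i> * Arccos z"] by auto
  define \<omega> where "\<omega> = (if Re \<omega>0 \<ge> 0 then \<omega>0 else - \<omega>0)"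
  have \<omega>: "cosh \<omega> = z" "Re \<omega> \<ge> 0" by (auto simp: \<omega>_def \<omega>0)
  define k where "k = \<lfloor>Im \<omega> / (2 * pi)\<rfloor>"
  define \<eta> where "\<eta> = Im \<omega> - 2 * real_of_int k * pi"
  have "of_int k \<le> Im \<omega> / (2 * pi)" "Im \<omega> / (2 * pi) < of_int k + 1"
    by (auto simp: k_def)
  then have "0 \<le> \<eta>" "\<eta> \<le> 2 * pi"
    by (auto simp: \<eta>_def field_simps)
  moreover have "cosh (Complex (Re \<omega>) \<eta>) = cosh \<omega>"
    unfolding cosh_eq_iff_complex
    by (intro bexI[of _ "- of_int k"] disjI1) (auto simp: complex_eq_iff \<eta>_def)
  ultimately show thesis
    using that[of "Re \<omega>" \<eta>] \<omega> by (simp add: elliptic_point_eq)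
qed

text \<open>Real data of one eigenfunction \<phi>; C is its continuation to the imaginary axis. The
  condition \<open>initial\<close> ties the scale of C to that of \<phi>, which the two linear
  equations alone leave open.\<close>

locale mathieu_product =
  fixes s :: parity and q a :: real and C C' \<phi> \<phi>' :: "real \<Rightarrow> real"
  assumes q_pos: "0 < q"
    and C: "\<And>x. (C has_real_derivative C' x) (at x)"
    and C': "\<And>x. (C' has_real_derivative (a - 2 * q * cosh (2 * x)) * C x) (at x)"
    and \<phi>: "\<And>x. (\<phi> has_real_derivative \<phi>' x) (at x)"
    and \<phi>': "\<And>x. (\<phi>' has_real_derivative - (a - 2 * q * cos (2 * x)) * \<phi> x) (at x)"
    and C_minus: "\<And>x. C (- x) = parity_sign s * C x"
    and \<phi>_minus: "\<And>x. \<phi> (- x) = parity_sign s * \<phi> x"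
    and \<phi>_periodic: "\<And>x. \<phi> (x + 2 * pi) = \<phi> x"
    and initial: "C 0 = (case s of Plus \<Rightarrow> \<phi> 0 | Minus \<Rightarrow> 0)" "C' 0 = (case s of Plus \<Rightarrow> 0 | Minus \<Rightarrow> \<phi>' 0)"
begin

lemma derivative_minus:
  "C' (- x) = - parity_sign s * C' x" "\<phi>' (- x) = - parity_sign s * \<phi>' x"
proof -
  have *: "f' (- x) = - c * f' x" if f: "\<And>x. (f has_real_derivative f' x) (at x)" 
    and m: "\<And>x. f (- x) = c * f x" for f f' and c :: real
  proof -
    have "((\<lambda>x. f (- x)) has_real_derivative f' (- x) * (- 1)) (at x)"
      by (rule DERIV_chain2[OF f]) (auto intro!: derivative_eq_intros)
    moreover have "((\<lambda>x. f (- x)) has_real_derivative c * f' x) (at x)"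
      unfolding m by (rule DERIV_cmult[OF f])
    ultimately show ?thesis using DERIV_unique by fastforce
  qed
  show "C' (- x) = - parity_sign s * C' x" by (rule *[OF C C_minus])
  show "\<phi>' (- x) = - parity_sign s * \<phi>' x" by (rule *[OF \<phi> \<phi>_minus])
qed

lemma derivative_periodic: "\<phi>' (x + 2 * pi) = \<phi>' x"
proof -
  have "((\<lambda>x. \<phi> (x + 2 * pi)) has_real_derivative \<phi>' (x + 2 * pi) * 1) (at x)"
    by (rule DERIV_chain2[OF \<phi>]) (auto intro!: derivative_eq_intros)
  then show ?thesis unfolding \<phi>_periodic using DERIV_unique[OF \<phi>] by fastforce
qed

definition product :: "complex \<Rightarrow> real" where
  "product \<omega> = C (Re \<omega>) * \<phi> (Im \<omega>)"

definition product_gradient :: "complex \<Rightarrow> complex" where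
  "product_gradient \<omega> = Complex (C' (Re \<omega>) * \<phi> (Im \<omega>)) (- C (Re \<omega>) * \<phi>' (Im \<omega>))"

text \<open>The value at z = cosh \<omega>, written in \<omega>. Since sinh \<omega> = dz/d\<omega>,
  division by it turns the gradient in \<omega> into the one in z. The factor c stands for
  q^(n/2).\<close>

definition product_value :: "real \<Rightarrow> complex \<Rightarrow> quat" where
  "product_value c \<omega> = quat_of (c * product \<omega>)
     (- (of_real c * (product_gradient \<omega> / sinh \<omega>)) / of_real (2 * sqrt q))"

text \<open>The gradient in \<omega> and sinh \<omega> are both odd, so their quotient is even like
  the product itself.\<close>

lemma product_value_minus: "product_value c (- \<omega>) = product_value c \<omega>"
proof -
  have "(parity_sign s)\<^sup>2 = 1" by (cases s) auto
  then have e: "parity_sign s * (parity_sign s * x) = x" for x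
    by (simp add: power2_eq_square mult.assoc[symmetric])
  have "product (- \<omega>) = product \<omega>"
    using e by (simp add: product_def C_minus \<phi>_minus mult_ac)
  moreover have "product_gradient (- \<omega>) = - product_gradient \<omega>"
    using e by (simp add: product_gradient_def C_minus \<phi>_minus derivative_minus complex_eq_iff mult_ac)
  ultimately show ?thesis by (simp add: product_value_def)
qed

lemma product_value_periodic: 
  assumes "k \<in> \<int>"
  shows "product_value c (\<omega> + of_real (2 * k * pi) * \<i>) = product_value c \<omega>"
proof -
  have 1: "product_value c (\<omega> + of_real (2 * pi) * \<i>) = product_value c \<omega>" for \<omega>
  proof -
    have "sinh (\<omega> + of_real (2 * pi) * \<i>) = sinh \<omega>"
      by (simp add: sinh_eq_Complex)
    then show ?thesis
      by (simp add: product_value_def product_def product_gradient_def \<phi>_periodic derivative_periodic)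
  qed
  have 2: "product_value c (\<omega> + of_real (2 * real n * pi) * \<i>) = product_value c \<omega>" for \<omega> n
  proof (induction n)
    case (Suc n)
    have "product_value c (\<omega> + of_real (2 * real (Suc n) * pi) * \<i>) =
        product_value c ((\<omega> + of_real (2 * real n * pi) * \<i>) + of_real (2 * pi) * \<i>)"
      by (rule arg_cong[of _ _ "product_value c"]) (simp add: algebra_simps)
    then show ?case using 1 Suc by simp
  qed simp
  obtain n where n: "k = real n \<or> k = - real n"
    using assms by (auto elim!: Ints_cases) (metis int_cases2 of_int_minus of_int_of_nat_eq)
  then show ?thesis
  proof
    assume k: "k = - real n"
    show ?thesis
      using 2[of "\<omega> + of_real (2 * k * pi) * \<i>" n] by (simp add: k)
  qed (simp only: 2)
qed

lemma product_value_cong: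
  assumes "cosh \<omega> = cosh \<omega>'"
  shows "product_value c \<omega> = product_value c \<omega>'"
  using assms unfolding cosh_eq_iff_complex by (auto simp only: product_value_minus product_value_periodic)

text \<open>The coordinate expression of the operator is the chain rule for z = cosh \<omega>: the
  bracketed vectors are sinh \<omega> and i sinh \<omega>, and the prefactor is 1 / |sinh
  \<omega>|^2.\<close>

lemma elliptic_Dirac_product:
  "elliptic_Dirac (\<lambda>\<xi> \<eta>. qre (C \<xi> * \<phi> \<eta>)) \<xi> \<eta> =
     quat_of 0 (product_gradient (Complex \<xi> \<eta>) / sinh (Complex \<xi> \<eta>))"
proof -
  have "((\<lambda>t. qre (C t * \<phi> \<eta>)) has_vector_derivative qre (C' \<xi> * \<phi> \<eta>)) (at \<xi>)"
    unfolding qre_def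
    by (intro has_vector_derivative_Pair has_vector_derivative_const
        has_real_derivative_iff_has_vector_derivative[THEN iffD1] DERIV_cmult_right C)
  then have 1: "vector_derivative (\<lambda>t. qre (C t * \<phi> \<eta>)) (at \<xi>) = qre (C' \<xi> * \<phi> \<eta>)"
    by (rule vector_derivative_at)
  have "((\<lambda>t. qre (C \<xi> * \<phi> t)) has_vector_derivative qre (C \<xi> * \<phi>' \<eta>)) (at \<eta>)"
    unfolding qre_def
    by (intro has_vector_derivative_Pair has_vector_derivative_const
        has_real_derivative_iff_has_vector_derivative[THEN iffD1] DERIV_cmult \<phi>)
  then have 2: "vector_derivative (\<lambda>t. qre (C \<xi> * \<phi> t)) (at \<eta>) = qre (C \<xi> * \<phi>' \<eta>)"
    by (rule vector_derivative_at)
  let ?S = "sinh (Complex \<xi> \<eta>)"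
  \<comment> \<open>At a focus both sides are quotients by 0, hence 0, so no case distinction
    arises.\<close>
  have S: "2 / (cosh (2 * \<xi>) - cos (2 * \<eta>)) = 1 / (cmod ?S)\<^sup>2"
    by (simp add: norm_sinh_power2)
  have "Complex A (- B) / Complex x y =
      Complex (1 / (cmod (Complex x y))\<^sup>2 * (A * x - B * y)) (- (1 / (cmod (Complex x y))\<^sup>2 * (A * y + B * x)))"
    for A B x y
    unfolding cmod_power2 by (simp add: complex_eq_iff Re_divide Im_divide divide_inverse algebra_simps)
  then have "product_gradient (Complex \<xi> \<eta>) / ?S = 
      Complex (1 / (cmod ?S)\<^sup>2 * (C' \<xi> * \<phi> \<eta> * (sinh \<xi> * cos \<eta>) - C \<xi> * \<phi>' \<eta> * (cosh \<xi> * sin \<eta>)))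
        (- (1 / (cmod ?S)\<^sup>2 * (C' \<xi> * \<phi> \<eta> * (cosh \<xi> * sin \<eta>) + C \<xi> * \<phi>' \<eta> * (sinh \<xi> * cos \<eta>))))"
    unfolding product_gradient_def sinh_eq_Complex[of "Complex \<xi> \<eta>"] by simp
  then show ?thesis
    unfolding elliptic_Dirac_def 1 2 S
    by (simp add: qre_def qi_def qj_def quat_of_def algebra_simps)
qed

text \<open>All admissible coordinates of a point give the same value by
  \<open>product_value_cong\<close>, so the definite description denotes. The preimage \<omega> on
  the right is arbitrary and need not be normalized.\<close>

lemma F_approx_eq:
  assumes f: "\<And>\<xi> \<eta>. mathieu_zeta s f q \<xi> \<eta> = C \<xi> * \<phi> \<eta>"
  shows "F_approx s n f q (cosh \<omega>) = product_value (q powr (real n / 2)) \<omega>"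
proof -
  have q: "(2 * sqrt q)\<^sup>2 / 4 = q" using q_pos by (simp add: power_mult_distrib)
  have v: "(q powr (real n / 2)) *\<^sub>R quat_mathieu s f (2 * sqrt q) \<xi> \<eta> = product_value (q powr (real n / 2)) (Complex \<xi> \<eta>)"
    for \<xi> \<eta>
  proof -
    have *: "c *\<^sub>R (- (1 / l) *\<^sub>R (quat_of 0 p - l *\<^sub>R qre u)) = quat_of (c * u) (- (of_real c * p) / of_real l)"
      if "l \<noteq> 0" for c l u p
      using that by (simp add: quat_of_def qre_def field_simps)
    show ?thesis
      unfolding quat_mathieu_def q f Let_def elliptic_Dirac_product product_value_def product_def complex.sel
      by (rule *) (use q_pos in simp)
  qed
  obtain \<xi> \<eta> where "0 \<le> \<xi>" "0 \<le> \<eta>" "\<eta> \<le> 2 * pi" "cosh \<omega> = elliptic_point \<xi> \<eta>"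
    by (rule elliptic_coordinates_exist)
  then show ?thesis
    unfolding F_approx_def v
    by (intro the_equality) (auto simp: elliptic_point_eq intro!: product_value_cong)
qed

end

section \<open>The metamonogenic equation in the plane variable\<close>

lemma Dirac_transform_within_open:
  assumes "F differentiable (at z)" "open U" "z \<in> U" "\<And>x. x \<in> U \<Longrightarrow> F x = G x"
  shows "G differentiable (at z)" "Dirac G z = Dirac F z"
proof -
  have F: "(F has_derivative frechet_derivative F (at z)) (at z)"
    using assms(1) by (simp add: frechet_derivative_works)
  have G: "(G has_derivative frechet_derivative F (at z)) (at z)"
    by (rule has_derivative_transform_within_open[OF F assms(2,3)]) (simp add: assms(4))
  then show "G differentiable (at z)" by (auto simp: differentiable_def)
  show "Dirac G z = Dirac F z"
    using frechet_derivative_at[OF G] by (simp add: Dirac_def)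
qed

text \<open>Normalized coordinates jump across the focal segment and across the ray \<eta> = 0. A
  local holomorphic inverse has no such cuts, and \<open>F_approx_eq\<close> accepts any
  preimage.\<close>

lemma cosh_local_inverse:
  assumes "sinh (w::complex) \<noteq> 0"
  obtains U g where "open U" "cosh w \<in> U" "g (cosh w) = w" "\<And>z. z \<in> U \<Longrightarrow> cosh (g z) = z"
    "(g has_field_derivative 1 / sinh w) (at (cosh w))"
proof -
  have d: "(cosh has_field_derivative sinh z) (at z)" for z :: complex
    by (auto intro!: derivative_eq_intros)
  then have hol: "cosh holomorphic_on (UNIV :: complex set)"
    using holomorphic_onI field_differentiable_def by (metis field_differentiable_at_within)
  have deriv: "deriv cosh z = sinh z" for z :: complex
    by (rule DERIV_imp_deriv[OF d])
  obtain r where r: "r > 0" "open (cosh ` ball w r)" "inj_on cosh (ball w r)"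
    by (rule has_complex_derivative_locally_invertible[OF hol, of w]) (use assms in \<open>auto simp: deriv\<close>)
  obtain g where g: "g holomorphic_on (cosh ` ball w r)"
      "\<And>z. z \<in> ball w r \<Longrightarrow> deriv cosh z * deriv g (cosh z) = 1"
      "\<And>z. z \<in> ball w r \<Longrightarrow> g (cosh z) = z"
    by (rule holomorphic_has_inverse[of cosh "ball w r"]) (use r hol holomorphic_on_subset in auto)
  have w: "w \<in> ball w r" using r by simp
  have "deriv g (cosh w) = 1 / sinh w"
    using g(2)[OF w] assms by (simp add: deriv field_simps)
  moreover have "(g has_field_derivative deriv g (cosh w)) (at (cosh w))"
    by (rule holomorphic_derivI[OF g(1) r(2)]) (use w in blast)
  ultimately show thesis
    using r(2) w g(3) by (intro that[of "cosh ` ball w r" g]) auto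
qed

context mathieu_product
begin

lemma has_derivative_product:
  "(product has_derivative (\<lambda>h. Re (product_gradient \<omega> * h))) (at \<omega>)"
proof -
  have "((\<lambda>\<omega>. C (Re \<omega>) * \<phi> (Im \<omega>)) has_derivative
      (\<lambda>h. C (Re \<omega>) * (Im h * \<phi>' (Im \<omega>)) + Re h * C' (Re \<omega>) * \<phi> (Im \<omega>))) (at \<omega>)"
    by (intro has_derivative_mult DERIV_compose_FDERIV[OF C] DERIV_compose_FDERIV[OF \<phi>]
        has_derivative_Re has_derivative_Im has_derivative_ident)
  then show ?thesis
    unfolding product_def[abs_def] by (simp add: product_gradient_def algebra_simps)
qed

text \<open>Separation of variables: the eigenvalue a cancels between the two equations, and cosh
  2\<xi> - cos 2\<eta> = 2 |sinh \<omega>|^2.\<close>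

lemma product_gradient_laplace:
  obtains L where "(product_gradient has_derivative L) (at \<omega>)"
    "L 1 + \<i> * L \<i> = - of_real (4 * q * (cmod (sinh \<omega>))\<^sup>2 * product \<omega>)"
proof -
  let ?C'' = "(a - 2 * q * cosh (2 * Re \<omega>)) * C (Re \<omega>)"
  let ?\<phi>'' = "- (a - 2 * q * cos (2 * Im \<omega>)) * \<phi> (Im \<omega>)"
  define L where "L = (\<lambda>h. complex_of_real (C' (Re \<omega>) * (Im h * \<phi>' (Im \<omega>)) + Re h * ?C'' * \<phi> (Im \<omega>))
     - \<i> * of_real (C (Re \<omega>) * (Im h * ?\<phi>'') + Re h * C' (Re \<omega>) * \<phi>' (Im \<omega>)))"
  have pg: "product_gradient = (\<lambda>\<omega>. of_real (C' (Re \<omega>) * \<phi> (Im \<omega>)) - \<i> * of_real (C (Re \<omega>) * \<phi>' (Im \<omega>)))"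
    by (auto simp: product_gradient_def complex_eq_iff)
  have "(product_gradient has_derivative L) (at \<omega>)"
    unfolding pg L_def
    by (intro has_derivative_diff has_derivative_mult_right has_derivative_of_real has_derivative_mult
        DERIV_compose_FDERIV[OF C] DERIV_compose_FDERIV[OF \<phi>]
        DERIV_compose_FDERIV[OF C'] DERIV_compose_FDERIV[OF \<phi>']
        has_derivative_Re has_derivative_Im has_derivative_ident)
  moreover have "L 1 + \<i> * L \<i> = of_real (?C'' * \<phi> (Im \<omega>) + C (Re \<omega>) * ?\<phi>'')"
    unfolding L_def by (simp add: complex_eq_iff)
  moreover have "?C'' * \<phi> (Im \<omega>) + C (Re \<omega>) * ?\<phi>'' = - (4 * q * (cmod (sinh \<omega>))\<^sup>2 * product \<omega>)"
    unfolding norm_sinh_power2 product_def by (simp add: field_simps)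
  ultimately show thesis using that by (metis of_real_minus)
qed

text \<open>The Laplacian picks up 1 / sinh from the factor in p and \<open>cnj\<close> (1 / sinh)
  from composing with the local inverse. Together they cancel the |sinh \<omega>|^2 of
  \<open>product_gradient_laplace\<close>.\<close>

lemma metamonogenic_F_approx:
  assumes f: "\<And>\<xi> \<eta>. mathieu_zeta s f q \<xi> \<eta> = C \<xi> * \<phi> \<eta>"
  shows "metamonogenic (2 * sqrt q) (- {1, -1}) (F_approx s n f q)"
  unfolding metamonogenic_def
proof (intro conjI ballI)
  show lam: "2 * sqrt q \<noteq> 0" using q_pos by simp
  fix z :: complex assume z: "z \<in> - {1, -1}"
  obtain \<xi> \<eta> where "z = elliptic_point \<xi> \<eta>" by (rule elliptic_coordinates_exist)
  then obtain \<omega> where \<omega>: "z = cosh \<omega>" by (auto simp: elliptic_point_eq)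
  with z have S: "sinh \<omega> \<noteq> 0" by (auto simp: sinh_eq_0_iff_cosh)
  show "reduced (F_approx s n f q z)"
    unfolding \<omega> F_approx_eq[OF f] product_value_def by simp
  obtain U g where U: "open U" "cosh \<omega> \<in> U" and g: "g (cosh \<omega>) = \<omega>" "\<And>z. z \<in> U \<Longrightarrow> cosh (g z) = z"
    and g': "(g has_field_derivative 1 / sinh \<omega>) (at (cosh \<omega>))"
    using cosh_local_inverse[OF S] by blast
  have g'': "(g has_derivative (\<lambda>h. 1 / sinh \<omega> * h)) (at (cosh \<omega>))"
    using g' unfolding has_field_derivative_def .
  obtain L where L: "(product_gradient has_derivative L) (at \<omega>)"
    "L 1 + \<i> * L \<i> = - of_real (4 * q * (cmod (sinh \<omega>))\<^sup>2 * product \<omega>)"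
    by (rule product_gradient_laplace)
  define c where "c = q powr (real n / 2)"
  define u where "u z = c * product (g z)" for z
  define p where "p z = of_real c * (product_gradient (g z) * inverse (sinh (g z)))" for z
  define i' where "i' = - (inverse (sinh \<omega>) * cosh \<omega> * inverse (sinh \<omega>))"
  define M where "M h = of_real c * (product_gradient \<omega> * (i' * h) + L h * inverse (sinh \<omega>))" for h
  have F: "quat_of (u z) (- p z / of_real (2 * sqrt q)) = F_approx s n f q z" if "z \<in> U" for z
    using F_approx_eq[OF f, of n "g z"] unfolding g(2)[OF that]
    by (simp only: u_def p_def c_def product_value_def divide_inverse)
  have "(u has_derivative (\<lambda>h. c * Re (product_gradient \<omega> * (1 / sinh \<omega> * h)))) (at (cosh \<omega>))"
    unfolding u_def
    by (intro has_derivative_mult_right has_derivative_compose[OF g'', unfolded g(1)])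
       (use has_derivative_product[of \<omega>] g(1) in simp)
  then have u': "(u has_derivative (\<lambda>h. Re (p (cosh \<omega>) * h))) (at (cosh \<omega>))"
    by (simp add: p_def g(1) divide_inverse mult.assoc)
  have "(inverse \<circ> sinh has_field_derivative i') (at \<omega>)"
    unfolding i'_def using S by (auto intro!: derivative_eq_intros simp: o_def)
  then have "((\<lambda>z. inverse (sinh z)) has_derivative (\<lambda>h. i' * h)) (at \<omega>)"
    by (simp add: has_field_derivative_def o_def)
  from has_derivative_mult_right[OF has_derivative_mult[OF L(1) this], of "of_real c"]
  have M: "((\<lambda>\<omega>. of_real c * (product_gradient \<omega> * inverse (sinh \<omega>))) has_derivative M) (at (g (cosh \<omega>)))"
    unfolding M_def[abs_def] g(1) .
  have p': "(p has_derivative (\<lambda>h. M (1 / sinh \<omega> * h))) (at (cosh \<omega>))"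
    unfolding p_def by (rule has_derivative_compose[OF g'' M])
  have "M (1 / sinh \<omega> * 1) + \<i> * M (1 / sinh \<omega> * \<i>) = M (1 / sinh \<omega>) + \<i> * M (\<i> * (1 / sinh \<omega>))"
    by (simp add: mult.commute)
  also have "\<dots> = cnj (1 / sinh \<omega>) * (M 1 + \<i> * M \<i>)"
    using M by (intro real_linear_mult) (simp add: has_derivative_linear)
  \<comment> \<open>The term with \<open>i'\<close> is complex linear in h and drops out; only the
    derivative of \<open>product_gradient\<close> remains.\<close>
  also have "M 1 + \<i> * M \<i> = of_real c * inverse (sinh \<omega>) * (L 1 + \<i> * L \<i>)"
    by (simp add: M_def algebra_simps)
  also have "cnj (1 / sinh \<omega>) * \<dots> = - of_real (4 * q * c * product \<omega>)"
  proof -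
    have "cnj (sinh \<omega>) * sinh \<omega> = of_real ((cmod (sinh \<omega>))\<^sup>2)"
      by (simp only: complex_norm_square mult.commute)
    then have "cnj (1 / sinh \<omega>) * inverse (sinh \<omega>) = inverse (of_real ((cmod (sinh \<omega>))\<^sup>2))"
      by (metis complex_cnj_divide complex_cnj_one inverse_eq_divide inverse_mult_distrib mult.commute)
    then have "cnj (1 / sinh \<omega>) * (of_real c * inverse (sinh \<omega>) * (L 1 + \<i> * L \<i>)) =
        of_real c * inverse (of_real ((cmod (sinh \<omega>))\<^sup>2)) * (L 1 + \<i> * L \<i>)"
      by (metis mult.assoc mult.commute)
    also have "\<dots> = - of_real (4 * q * c * product \<omega>)"
      unfolding L(2) using S by (simp add: field_simps)
    finally show ?thesis .
  qed
  also have "\<dots> = - of_real ((2 * sqrt q)\<^sup>2 * u (cosh \<omega>))"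
    using q_pos by (simp add: u_def g(1) power_mult_distrib)
  finally have l: "M (1 / sinh \<omega> * 1) + \<i> * M (1 / sinh \<omega> * \<i>) = - of_real ((2 * sqrt q)\<^sup>2 * u (cosh \<omega>))" .
  note D = Dirac_quat_of[OF u' p' l lam]
  note T = Dirac_transform_within_open[where G = "F_approx s n f q", OF D(1) U F]
  show "F_approx s n f q differentiable (at z)"
    unfolding \<omega> using T(1) by simp
  show "Dirac (F_approx s n f q) z + (2 * sqrt q) *\<^sub>R F_approx s n f q z = 0"
    using D(2) T(2) F[OF U(2)]
    by (simp only: \<omega>)
qed

end

section \<open>Analytic continuation of Mathieu functions\<close>

lemma entire_eq_on_reals:
  assumes "G holomorphic_on UNIV" "H holomorphic_on UNIV" "\<And>x::real. G (of_real x) = H (of_real x)"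
  shows "G z = H z"
proof -
  have "G z - H z = 0"
  proof (rule analytic_continuation[of "\<lambda>z. G z - H z" UNIV "range of_real" 0])
    show "(\<lambda>z. G z - H z) holomorphic_on UNIV" using assms by (intro holomorphic_on_diff)
    show "(0::complex) islimpt range of_real"
    proof (rule islimptI)
      fix T :: "complex set" assume "0 \<in> T" "open T"
      then obtain e where e: "e > 0" "ball 0 e \<subseteq> T" using openE by blast
      then have "complex_of_real (e / 2) \<in> T" by (intro subsetD[OF e(2)]) simp
      then show "\<exists>y\<in>range complex_of_real. y \<in> T \<and> y \<noteq> 0"
        using e(1) by (intro bexI[of _ "complex_of_real (e / 2)"] conjI rangeI) simp_all
    qed
  qed (use assms(3) in auto)
  then show ?thesis by simp
qed

lemma DERIV_Re_along_line:
  assumes "(G has_field_derivative G') (at (c * of_real x))"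
  shows "((\<lambda>t. Re (k * G (c * of_real t))) has_real_derivative Re (k * (c * G'))) (at x)"
proof -
  have "((\<lambda>t. c * of_real t) has_vector_derivative c) (at x)"
    by (auto intro!: derivative_eq_intros)
  from field_vector_diff_chain_at[OF this assms]
  have "((\<lambda>t. G (c * of_real t)) has_vector_derivative c * G') (at x)"
    by (simp add: o_def)
  then have "((\<lambda>t. k * G (c * of_real t)) has_vector_derivative k * (c * G')) (at x)"
    by (rule has_vector_derivative_mult_right)
  from bounded_linear.has_vector_derivative[OF bounded_linear_Re this]
  show ?thesis by (simp add: has_real_derivative_iff_has_vector_derivative)
qed

text \<open>At real points the complex derivatives of f are the real ones of \<phi>, so the identity
  theorem extends the equation and the parity to the plane. On the imaginary axis cos becomes cosh,
  and the two factors i reverse the sign of the second derivative.\<close>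

lemma mathieu_product_exists:
  assumes q: "0 < q" and ef: "mathieu_eigenfunction s q a \<phi>"
    and hol: "f q holomorphic_on UNIV" and f: "\<And>x. f q (of_real x) = of_real (\<phi> x)"
  obtains C C' \<phi>' where "mathieu_product s q a C C' \<phi> \<phi>'"
    "\<And>\<xi> \<eta>. mathieu_zeta s f q \<xi> \<eta> = C \<xi> * \<phi> \<eta>"
proof -
  define F where "F = f q"
  define F1 where "F1 = deriv F"
  define F2 where "F2 = deriv F1"
  have holF: "F holomorphic_on UNIV" using hol by (simp add: F_def)
  have holF1: "F1 holomorphic_on UNIV" unfolding F1_def by (rule holomorphic_deriv[OF holF]) simp
  have holF2: "F2 holomorphic_on UNIV" unfolding F2_def by (rule holomorphic_deriv[OF holF1]) simp
  have F1: "(F has_field_derivative F1 z) (at z)" for z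
    unfolding F1_def by (rule holomorphic_derivI[OF holF]) auto
  have F2: "(F1 has_field_derivative F2 z) (at z)" for z
    unfolding F2_def by (rule holomorphic_derivI[OF holF1]) auto
  obtain \<phi>' where \<phi>': "\<And>x. (\<phi> has_real_derivative \<phi>' x) (at x)"
     "\<And>x. \<exists>d. (\<phi>' has_real_derivative d) (at x) \<and> d + (a - 2 * q * cos (2 * x)) * \<phi> x = 0"
    using ef unfolding mathieu_eigenfunction_def mathieu_solution_def by blast
  have \<phi>'': "(\<phi>' has_real_derivative - (a - 2 * q * cos (2 * x)) * \<phi> x) (at x)" for x
  proof -
    obtain d where "(\<phi>' has_real_derivative d) (at x)" "d + (a - 2 * q * cos (2 * x)) * \<phi> x = 0"
      using \<phi>'(2) by blast
    then show ?thesis by (simp only: eq_neg_iff_add_eq_0[symmetric] mult_minus_left)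
  qed
  have real: "G' (of_real x) = of_real (g' x)"
    if G: "\<And>z. (G has_field_derivative G' z) (at z)" and g: "\<And>x. (g has_real_derivative g' x) (at x)"
      and eq: "\<And>x. G (of_real x) = of_real (g x)" for G G' :: "complex \<Rightarrow> complex" and g g' x
  proof -
    have "(complex_of_real has_vector_derivative 1) (at x)"
      by (auto intro!: derivative_eq_intros)
    from field_vector_diff_chain_at[OF this G]
    have "((\<lambda>t. G (of_real t)) has_vector_derivative 1 * G' (of_real x)) (at x)"
      by (simp only: o_def)
    moreover have "((\<lambda>t. of_real (g t)) has_vector_derivative complex_of_real (g' x)) (at x)"
      using g by (intro has_vector_derivative_of_real) (simp add: has_real_derivative_iff_has_vector_derivative)
    ultimately show ?thesis 
      unfolding eq by (metis vector_derivative_unique_at mult_1)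
  qed
  have F1_real: "F1 (of_real x) = of_real (\<phi>' x)" for x
    by (rule real[OF F1 \<phi>'(1)]) (simp add: F_def f)
  have F2_real: "F2 (of_real x) = of_real (- (a - 2 * q * cos (2 * x)) * \<phi> x)" for x
    by (rule real[OF F2 \<phi>'' F1_real])
  have ode: "F2 z = - (of_real a - of_real (2 * q) * cos (2 * z)) * F z" for z
  proof (rule entire_eq_on_reals[OF holF2, where H = "\<lambda>z. - (of_real a - of_real (2 * q) * cos (2 * z)) * F z"])
    show "(\<lambda>z. - (of_real a - of_real (2 * q) * cos (2 * z)) * F z) holomorphic_on UNIV"
      by (intro holomorphic_intros holF)
    show "F2 (of_real x) = - (of_real a - of_real (2 * q) * cos (2 * of_real x)) * F (of_real x)" for x
      unfolding F2_real F_def f by (simp flip: cos_of_real)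
  qed
  have even: "F (- z) = of_real (parity_sign s) * F z" for z
  proof (rule entire_eq_on_reals[where G = "\<lambda>z. F (- z)"])
    show "(\<lambda>z. F (- z)) holomorphic_on UNIV"
      using holomorphic_on_compose[OF holomorphic_on_minus[OF holomorphic_on_ident], of F UNIV]
        holomorphic_on_subset[OF holF] by (simp add: o_def)
    show "(\<lambda>z. of_real (parity_sign s) * F z) holomorphic_on UNIV"
      by (intro holomorphic_intros holF)
    show "F (- of_real x) = of_real (parity_sign s) * F (of_real x)" for x
      using f[of "- x"] ef by (simp add: F_def f mathieu_eigenfunction_def)
  qed
  define C where "C \<xi> = Re (parity_unit s * F (\<i> * of_real \<xi>))" for \<xi>
  define C' where "C' \<xi> = Re (parity_unit s * \<i> * F1 (\<i> * of_real \<xi>))" for \<xi>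
  have 1: "(C has_real_derivative C' x) (at x)" for x
    using DERIV_Re_along_line[OF F1, where k = "parity_unit s" and c = \<i>]
    unfolding C_def C'_def by (simp only: mult.assoc)
  have 2: "(C' has_real_derivative (a - 2 * q * cosh (2 * x)) * C x) (at x)" for x
  proof -
    have D: "(C' has_real_derivative Re (parity_unit s * \<i> * (\<i> * F2 (\<i> * of_real x)))) (at x)"
      unfolding C'_def by (rule DERIV_Re_along_line[OF F2])
    have i2: "k * \<i> * (\<i> * z) = - (k * z)" for k z :: complex
      by (simp add: complex_eq_iff)
    have "cos (2 * (\<i> * complex_of_real x)) = of_real (cosh (2 * x))"
      using cosh_conv_cos[of "of_real (2 * x)"] by (simp add: mult_ac cosh_eq_Complex complex_eq_iff)
    then have "- (parity_unit s * F2 (\<i> * of_real x)) =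
        of_real (a - 2 * q * cosh (2 * x)) * (parity_unit s * F (\<i> * of_real x))"
      unfolding ode by (simp add: algebra_simps)
    with D show ?thesis unfolding C_def i2 by (simp only: Re_of_real_mult)
  qed
  have "mathieu_product s q a C C' \<phi> \<phi>'"
  proof
    show "C (- x) = parity_sign s * C x" for x
      unfolding C_def Re_of_real_mult[symmetric] using even[of "\<i> * of_real x"] by (simp add: mult_ac)
    show "\<phi> (- x) = parity_sign s * \<phi> x" "\<phi> (x + 2 * pi) = \<phi> x" for x
      using ef by (auto simp: mathieu_eigenfunction_def)
    show "C 0 = (case s of Plus \<Rightarrow> \<phi> 0 | Minus \<Rightarrow> 0)" "C' 0 = (case s of Plus \<Rightarrow> 0 | Minus \<Rightarrow> \<phi>' 0)"
      using f[of 0] F1_real[of 0] by (cases s; simp add: C_def C'_def F_def)+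
  qed (use q 1 2 \<phi>' \<phi>'' in auto)
  moreover have "mathieu_zeta s f q \<xi> \<eta> = C \<xi> * \<phi> \<eta>" for \<xi> \<eta>
    unfolding mathieu_zeta_def f C_def F_def by (cases s) simp_all
  ultimately show thesis by (rule that)
qed

section \<open>Angular asymptotics\<close>

text \<open>Integrating factor exp (c x). The rate c may have either sign: it is negative for the
  angular part and for n = 0, positive for n >= 1. The maximum bounds exp (- c (X - x)) on the
  interval in both cases.\<close>

lemma gronwall:
  fixes E E' :: "real \<Rightarrow> real"
  assumes E: "\<And>x. 0 \<le> x \<Longrightarrow> x \<le> X \<Longrightarrow> (E has_real_derivative E' x) (at x)"
    and le: "\<And>x. 0 \<le> x \<Longrightarrow> x \<le> X \<Longrightarrow> E' x \<le> - c * E x + L"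
    and "0 \<le> X" "0 \<le> L"
  shows "E X \<le> E 0 * exp (- c * X) + L * X * max 1 (exp (- c * X))"
proof -
  define M where "M = max 1 (exp (c * X))"
  define g where "g x = E x * exp (c * x) - L * M * x" for x
  have "g X \<le> g 0"
  proof (rule DERIV_nonpos_imp_nonincreasing[OF \<open>0 \<le> X\<close>])
    fix x assume x: "0 \<le> x" "x \<le> X"
    have "(g has_real_derivative (E' x * exp (c * x) + (exp (c * x) * c) * E x) - L * M) (at x)"
      unfolding g_def by (auto intro!: derivative_eq_intros E x)
    moreover have "(E' x * exp (c * x) + (exp (c * x) * c) * E x) - L * M \<le> 0"
    proof -
      have "exp (c * x) \<le> M"
      proof (cases "c \<ge> 0")
        case True
        then have "exp (c * x) \<le> exp (c * X)" using x by (simp add: mult_left_mono)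
        then show ?thesis by (auto simp: M_def max_def)
      next
        case False
        then have "exp (c * x) \<le> 1" using x by (simp add: mult_nonpos_nonneg)
        then show ?thesis by (auto simp: M_def max_def)
      qed
      then have "L * exp (c * x) \<le> L * M" using \<open>0 \<le> L\<close> by (rule mult_left_mono)
      moreover have "(E' x + c * E x) * exp (c * x) \<le> L * exp (c * x)"
        using le[OF x] by (intro mult_right_mono) auto
      ultimately show ?thesis by (simp add: algebra_simps)
    qed
    ultimately show "\<exists>y. (g has_real_derivative y) (at x) \<and> y \<le> 0" by blast
  qed
  then have "E X * exp (c * X) \<le> E 0 + L * X * M" by (simp add: g_def algebra_simps)
  then have "E X * exp (c * X) * exp (- c * X) \<le> (E 0 + L * X * M) * exp (- c * X)"
    by (intro mult_right_mono) auto
  moreover have "E X * exp (c * X) * exp (- c * X) = E X" by (simp add: exp_minus)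
  moreover have "M * exp (- c * X) = max 1 (exp (- c * X))"
    by (auto simp: M_def max_def exp_minus field_simps)
  then have "(E 0 + L * X * M) * exp (- c * X) = E 0 * exp (- c * X) + L * X * max 1 (exp (- c * X))"
    by (simp only: distrib_right mult.assoc)
  ultimately show ?thesis by (simp only:)
qed

lemma DERIV_angular:
  "(angular s n has_real_derivative angular' s n x) (at x)"
  "(angular' s n has_real_derivative - (real n)\<^sup>2 * angular s n x) (at x)"
  unfolding angular_def[abs_def] angular'_def[abs_def]
  by (cases s; auto intro!: derivative_eq_intros simp: power2_eq_square)+

lemma abs_angular_le_1: "\<bar>angular s n x\<bar> \<le> 1"
  by (cases s) (simp_all add: angular_def)

lemma angular_minus:
  "angular s n (- x) = parity_sign s * angular s n x"
  "angular' s n (- x) = - parity_sign s * angular' s n x"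
  by (cases s; simp add: angular_def angular'_def)+

locale mathieu_mode = mathieu_product +
  fixes n :: nat and K :: real
  assumes n: "s = Minus \<Longrightarrow> 1 \<le> n"
    and a_near: "\<bar>a - (real n)\<^sup>2\<bar> \<le> K * q"
begin

lemma K_nonneg: "0 \<le> K"
  using a_near q_pos by (metis abs_ge_zero mult_neg_pos not_le order_trans)

text \<open>The factor with which \<open>angular s n\<close> has the same initial data at 0 as
  \<phi>; in the odd case these data are the slope.\<close>

definition amplitude :: real where
  "amplitude = (case s of Plus \<Rightarrow> \<phi> 0 | Minus \<Rightarrow> \<phi>' 0 / real n)"

text \<open>C starts like A cosh n\<xi> or A sinh n\<xi> with A the amplitude. Both have C' + n C =
  n A at 0, which measures the growing exponential regardless of the parity.\<close>

lemma initial_amplitude: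
  "\<phi> 0 = amplitude * angular s n 0" "\<phi>' 0 = amplitude * angular' s n 0"
  "C' 0 + real n * C 0 = real n * amplitude" "C 0 = amplitude * angular s n 0"
proof -
  have "\<phi> 0 = amplitude * angular s n 0 \<and> \<phi>' 0 = amplitude * angular' s n 0 \<and>
    C' 0 + real n * C 0 = real n * amplitude \<and> C 0 = amplitude * angular s n 0"
  proof (cases s)
    case Plus
    have "\<phi>' 0 = 0" using derivative_minus(2)[of 0] by (simp add: Plus)
    then show ?thesis
      using initial unfolding amplitude_def angular_def angular'_def by (simp add: Plus)
  next
    case Minus
    have "\<phi> 0 = 0" using \<phi>_minus[of 0] by (simp add: Minus)
    moreover have "real n \<noteq> 0" using n[OF Minus] by simp
    ultimately show ?thesis
      using initial unfolding amplitude_def angular_def angular'_def by (simp add: Minus)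
  qed
  then show "\<phi> 0 = amplitude * angular s n 0" "\<phi>' 0 = amplitude * angular' s n 0"
    "C' 0 + real n * C 0 = real n * amplitude" "C 0 = amplitude * angular s n 0" by blast+
qed

text \<open>The difference d starts with zero data and is driven by e = a - n^2 - 2 q cos 2x, which
  is at most (K + 2) q. The bound 4 is a convenient number above \<pi>, so that it covers a
  neighbourhood of every argument.\<close>

lemma angular_part_close:
  assumes q: "q \<le> 1" and x: "\<bar>x\<bar> \<le> 4"
  shows "(\<phi> x - amplitude * angular s n x)\<^sup>2 + (\<phi>' x - amplitude * angular' s n x)\<^sup>2
     \<le> (K + 2) * 4 * exp ((1 + (real n)\<^sup>2 + 2 * (K + 2)) * 4) * amplitude\<^sup>2 * q"
proof -
  let ?k = "1 + (real n)\<^sup>2 + 2 * (K + 2)"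
  have K: "0 \<le> K" by (rule K_nonneg)
  define d where "d x = \<phi> x - amplitude * angular s n x" for x
  define d' where "d' x = \<phi>' x - amplitude * angular' s n x" for x
  define E where "E x = (d x)\<^sup>2 + (d' x)\<^sup>2" for x
  define e where "e x = a - (real n)\<^sup>2 - 2 * q * cos (2 * x)" for x
  have d: "(d has_real_derivative d' x) (at x)" for x
    unfolding d_def d'_def by (intro DERIV_diff DERIV_cmult DERIV_angular \<phi>)
  have "(d' has_real_derivative - (a - 2 * q * cos (2 * x)) * \<phi> x
      - amplitude * (- (real n)\<^sup>2 * angular s n x)) (at x)" for x
    unfolding d'_def by (intro DERIV_diff DERIV_cmult DERIV_angular \<phi>')
  moreover have "- (a - 2 * q * cos (2 * x)) * \<phi> x - amplitude * (- (real n)\<^sup>2 * angular s n x) =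
      - (real n)\<^sup>2 * d x - e x * d x - e x * (amplitude * angular s n x)" for x
    by (simp add: d_def e_def algebra_simps)
  ultimately have d': "(d' has_real_derivative
      - (real n)\<^sup>2 * d x - e x * d x - e x * (amplitude * angular s n x)) (at x)" for x by metis
  define E' where "E' x = 2 * d x * d' x +
      2 * d' x * (- (real n)\<^sup>2 * d x - e x * d x - e x * (amplitude * angular s n x))" for x
  have E: "(E has_real_derivative E' x) (at x)" for x
    unfolding E_def E'_def by (auto intro!: derivative_eq_intros d d')
  have e: "\<bar>e x\<bar> \<le> (K + 2) * q" for x
  proof -
    have "\<bar>2 * q * cos (2 * x)\<bar> \<le> 2 * q"
      using q_pos by (simp add: abs_mult)
    then show ?thesis using a_near unfolding e_def distrib_right by linarith
  qed
  have bound: "E' x \<le> - (- ?k) * E x + (K + 2) * q * amplitude\<^sup>2" for x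
  proof -
    let ?g = "amplitude * angular s n x"
    have 1: "2 * \<bar>d x * d' x\<bar> \<le> E x"
      using sum_squares_bound[of "\<bar>d x\<bar>" "\<bar>d' x\<bar>"] unfolding E_def abs_mult power2_abs by linarith
    have g2: "?g\<^sup>2 \<le> amplitude\<^sup>2"
      using abs_angular_le_1[of s n x] unfolding power_mult_distrib
      by (intro mult_left_le) (auto simp: abs_square_le_1)
    have "2 * \<bar>?g * d' x\<bar> \<le> ?g\<^sup>2 + (d' x)\<^sup>2"
      using sum_squares_bound[of "\<bar>?g\<bar>" "\<bar>d' x\<bar>"]
      unfolding power2_abs abs_mult[of ?g] by linarith
    then have 2: "2 * \<bar>?g * d' x\<bar> \<le> amplitude\<^sup>2 + E x"
      using g2 zero_le_power2[of "d x"] unfolding E_def by linarith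
    have E0: "0 \<le> E x" by (simp add: E_def)
    have "E' x = (1 - (real n)\<^sup>2) * (2 * (d x * d' x)) - e x * (2 * (d x * d' x)) - e x * (2 * (?g * d' x))"
      by (simp add: E'_def algebra_simps)
    also have "\<dots> \<le> (1 + (real n)\<^sup>2) * E x + (K + 2) * q * E x + (K + 2) * q * (amplitude\<^sup>2 + E x)"
    proof -
      have "(1 - (real n)\<^sup>2) * (2 * (d x * d' x)) \<le> \<bar>1 - (real n)\<^sup>2\<bar> * \<bar>2 * (d x * d' x)\<bar>"
        by (metis abs_ge_self abs_mult)
      also have "\<dots> \<le> (1 + (real n)\<^sup>2) * E x"
        using 1 by (intro mult_mono) (auto simp: abs_mult abs_le_iff)
      finally have 3: "(1 - (real n)\<^sup>2) * (2 * (d x * d' x)) \<le> (1 + (real n)\<^sup>2) * E x" .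
      have "- (e x * (2 * (d x * d' x))) \<le> \<bar>e x\<bar> * \<bar>2 * (d x * d' x)\<bar>"
        by (metis abs_ge_minus_self abs_mult)
      also have "\<dots> \<le> (K + 2) * q * E x"
        using 1 e[of x] by (intro mult_mono) (auto simp: abs_mult)
      finally have 4: "- (e x * (2 * (d x * d' x))) \<le> (K + 2) * q * E x" .
      have "- (e x * (2 * (?g * d' x))) \<le> \<bar>e x\<bar> * \<bar>2 * (?g * d' x)\<bar>"
        by (metis abs_ge_minus_self abs_mult)
      also have "\<dots> \<le> (K + 2) * q * (amplitude\<^sup>2 + E x)"
        using 2 e[of x] K q_pos by (intro mult_mono) (auto simp: abs_mult)
      finally have 5: "- (e x * (2 * (?g * d' x))) \<le> (K + 2) * q * (amplitude\<^sup>2 + E x)" .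
      show ?thesis using 3 4 5 by linarith
    qed
    also have "\<dots> = (1 + (real n)\<^sup>2 + 2 * ((K + 2) * q)) * E x + (K + 2) * q * amplitude\<^sup>2"
      by (simp add: algebra_simps)
    also have "\<dots> \<le> ?k * E x + (K + 2) * q * amplitude\<^sup>2"
    proof -
      have "(K + 2) * q \<le> (K + 2) * 1" using K q by (intro mult_left_mono) auto
      then show ?thesis using E0 by (intro add_right_mono mult_right_mono) auto
    qed
    finally show ?thesis unfolding minus_minus .
  qed
  have nonneg: "E y \<le> (K + 2) * 4 * exp (?k * 4) * amplitude\<^sup>2 * q" if y: "0 \<le> y" "y \<le> 4" for y
  proof -
    have k: "0 \<le> ?k" using K by simp
    have g: "E y \<le> E 0 * exp (- (- ?k) * y) + (K + 2) * q * amplitude\<^sup>2 * y * max 1 (exp (- (- ?k) * y))"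
      by (rule gronwall[OF E bound y(1)]) (use K q_pos in auto)
    have E0: "E 0 = 0" using initial_amplitude by (simp add: E_def d_def d'_def)
    have ek: "exp (?k * y) \<le> exp (?k * 4)"
      unfolding exp_le_cancel_iff using k y by (intro mult_left_mono)
    have m: "max 1 (exp (- (- ?k) * y)) = exp (?k * y)" using k y by simp
    have "E y \<le> (K + 2) * q * amplitude\<^sup>2 * y * exp (?k * y)"
      using g unfolding E0 m by (simp only: mult_zero_left add_0)
    also have "(K + 2) * q * amplitude\<^sup>2 * y * exp (?k * y) \<le> (K + 2) * q * amplitude\<^sup>2 * 4 * exp (?k * 4)"
      using y K q_pos ek by (intro mult_mono) auto
    also have "\<dots> = (K + 2) * 4 * exp (?k * 4) * amplitude\<^sup>2 * q"
      by (simp only: mult_ac)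
    finally show ?thesis .
  qed
  have "E (- y) = E y" for y
  proof -
    have "(parity_sign s)\<^sup>2 = 1" by (cases s) auto
    moreover have "d (- y) = parity_sign s * d y" "d' (- y) = - parity_sign s * d' y"
      by (simp_all add: d_def d'_def \<phi>_minus derivative_minus angular_minus algebra_simps)
    ultimately show ?thesis by (simp add: E_def power_mult_distrib)
  qed
  then have "E x \<le> (K + 2) * 4 * exp (?k * 4) * amplitude\<^sup>2 * q"
    using nonneg[of x] nonneg[of "- x"] x by (cases "x \<ge> 0") auto
  then show ?thesis by (simp add: E_def d_def d'_def)
qed

end

section \<open>Radial asymptotics\<close>

text \<open>This is \<open>limit_beta n\<close> J_n(t) / t^n, continued to t = 0.\<close>

definition radial :: "nat \<Rightarrow> real \<Rightarrow> real" where
  "radial n t = limit_beta n / 2 ^ n * bessel_E n (t\<^sup>2 / 4)"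

text \<open>Not the derivative: with t proportional to exp \<xi> it is d/d\<xi> + 2 n applied to
  \<open>radial\<close>, the counterpart of exp (- n\<xi>) (C' + n C).\<close>

definition radial' :: "nat \<Rightarrow> real \<Rightarrow> real" where
  "radial' n t = limit_beta n / 2 ^ n *
     (2 * real n * bessel_E n (t\<^sup>2 / 4) - t\<^sup>2 / 2 * bessel_E (Suc n) (t\<^sup>2 / 4))"

lemma DERIV_bessel_E_compose:
  assumes "(t has_real_derivative t x) (at x)"
  shows "((\<lambda>x. bessel_E n ((t x)\<^sup>2 / 4)) has_real_derivative - ((t x)\<^sup>2 / 2 * bessel_E (Suc n) ((t x)\<^sup>2 / 4))) (at x)"
proof -
  have "((\<lambda>x. (t x)\<^sup>2 / 4) has_real_derivative (t x)\<^sup>2 / 2) (at x)"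
    by (rule derivative_eq_intros assms refl | simp add: power2_eq_square)+
  from DERIV_chain2[OF has_real_derivative_bessel_E this] show ?thesis
    by (simp add: mult.commute)
qed

text \<open>The hypothesis makes t a multiple of the exponential. In the variable ln t, Bessel's
  equation for y = J_n(t) / t^n factors as d (d + 2 n) y = - t^2 y, so that the second equation of
  the system does not contain n.\<close>

lemma DERIV_radial:
  assumes t: "(t has_real_derivative t x) (at x)"
  shows "((\<lambda>x. radial n (t x)) has_real_derivative radial' n (t x) - 2 * real n * radial n (t x)) (at x)"
    and "((\<lambda>x. radial' n (t x)) has_real_derivative - ((t x)\<^sup>2 * radial n (t x))) (at x)"
proof -
  let ?b = "limit_beta n / 2 ^ n" and ?E = "\<lambda>m. bessel_E m ((t x)\<^sup>2 / 4)"
  have "((\<lambda>x. radial n (t x)) has_real_derivative ?b * - ((t x)\<^sup>2 / 2 * ?E (Suc n))) (at x)"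
    unfolding radial_def by (intro DERIV_cmult DERIV_bessel_E_compose t)
  then show "((\<lambda>x. radial n (t x)) has_real_derivative radial' n (t x) - 2 * real n * radial n (t x)) (at x)"
    by (simp add: radial_def radial'_def algebra_simps)
  have t2: "((\<lambda>x. (t x)\<^sup>2 / 2) has_real_derivative (t x)\<^sup>2) (at x)"
    by (rule derivative_eq_intros t refl | simp add: power2_eq_square)+
  have "((\<lambda>x. radial' n (t x)) has_real_derivative
      ?b * (2 * real n * - ((t x)\<^sup>2 / 2 * ?E (Suc n))
        - ((t x)\<^sup>2 * ?E (Suc n) + - ((t x)\<^sup>2 / 2 * ?E (Suc (Suc n))) * ((t x)\<^sup>2 / 2)))) (at x)"
    unfolding radial'_def
    by (intro DERIV_cmult DERIV_diff DERIV_mult DERIV_bessel_E_compose t t2)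
  moreover have "?b * (2 * real n * - ((t x)\<^sup>2 / 2 * ?E (Suc n))
        - ((t x)\<^sup>2 * ?E (Suc n) + - ((t x)\<^sup>2 / 2 * ?E (Suc (Suc n))) * ((t x)\<^sup>2 / 2)))
      = - ((t x)\<^sup>2 * radial n (t x))"
  proof -
    have e: "?E n = (real n + 1) * ?E (Suc n) - (t x)\<^sup>2 / 4 * ?E (Suc (Suc n))"
      using bessel_E_recurrence[of "(t x)\<^sup>2 / 4" n] by linarith
    show ?thesis unfolding radial_def e by (simp add: field_simps)
  qed
  ultimately show "((\<lambda>x. radial' n (t x)) has_real_derivative - ((t x)\<^sup>2 * radial n (t x))) (at x)"
    by simp
qed

context mathieu_mode
begin

definition radial_error :: "real \<Rightarrow> real" where
  "radial_error \<xi> = exp (- real n * \<xi>) * C \<xi> - amplitude * radial n (sqrt q * exp \<xi>)"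

definition radial_error' :: "real \<Rightarrow> real" where
  "radial_error' \<xi> = (exp (- real n * \<xi>) * (C' \<xi> + real n * C \<xi>)
     - amplitude * radial' n (sqrt q * exp \<xi>)) / (sqrt q * exp \<xi>)"

text \<open>As 2 q cosh 2\<xi> = t^2 + q exp (- 2\<xi>), the first summand is the one of Bessel's
  equation. The second and a - n^2 form the perturbation e, of order q for \<xi> >= 0.\<close>

lemma DERIV_radial_error:
  defines "t \<equiv> \<lambda>\<xi>. sqrt q * exp \<xi>"
  defines "e \<equiv> \<lambda>\<xi>. a - (real n)\<^sup>2 - q * exp (- 2 * \<xi>)"
  shows "(radial_error has_real_derivative t \<xi> * radial_error' \<xi> - 2 * real n * radial_error \<xi>) (at \<xi>)"
    and "(radial_error' has_real_derivative - t \<xi> * radial_error \<xi>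
           + e \<xi> / t \<xi> * (exp (- real n * \<xi>) * C \<xi>) - radial_error' \<xi>) (at \<xi>)"
proof -
  let ?u = "\<lambda>\<xi>. exp (- real n * \<xi>)"
  have t: "(t has_real_derivative t \<xi>) (at \<xi>)" for \<xi>
    unfolding t_def by (auto intro!: derivative_eq_intros)
  have t_pos: "t \<xi> > 0" for \<xi> using q_pos by (simp add: t_def)
  have u: "(?u has_real_derivative - real n * ?u \<xi>) (at \<xi>)"
    by (auto intro!: derivative_eq_intros)
  define P where "P \<xi> = ?u \<xi> * (C' \<xi> + real n * C \<xi>) - amplitude * radial' n (t \<xi>)" for \<xi>
  have RP: "radial_error' = (\<lambda>\<xi>. P \<xi> / t \<xi>)"
    by (simp add: radial_error'_def[abs_def] P_def t_def)
  have tr: "t \<xi> * radial_error' \<xi> = P \<xi>"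
    using t_pos[of \<xi>] by (simp add: RP)
  have RE: "radial_error = (\<lambda>\<xi>. ?u \<xi> * C \<xi> - amplitude * radial n (t \<xi>))"
    by (simp add: radial_error_def[abs_def] t_def)
  have "(radial_error has_real_derivative (- real n * ?u \<xi> * C \<xi> + C' \<xi> * ?u \<xi>)
      - amplitude * (radial' n (t \<xi>) - 2 * real n * radial n (t \<xi>))) (at \<xi>)"
    unfolding RE
    by (intro DERIV_diff DERIV_mult DERIV_cmult u C DERIV_radial t)
  moreover have "(- real n * ?u \<xi> * C \<xi> + C' \<xi> * ?u \<xi>)
      - amplitude * (radial' n (t \<xi>) - 2 * real n * radial n (t \<xi>)) =
      t \<xi> * radial_error' \<xi> - 2 * real n * radial_error \<xi>"
    unfolding tr unfolding RE P_def by (simp add: algebra_simps)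
  ultimately show "(radial_error has_real_derivative t \<xi> * radial_error' \<xi> - 2 * real n * radial_error \<xi>) (at \<xi>)"
    by simp
  let ?P' = "- (t \<xi>)\<^sup>2 * radial_error \<xi> + e \<xi> * (?u \<xi> * C \<xi>)"
  have "(P has_real_derivative
      (- real n * ?u \<xi> * (C' \<xi> + real n * C \<xi>) +
        ((a - 2 * q * cosh (2 * \<xi>)) * C \<xi> + real n * C' \<xi>) * ?u \<xi>)
      - amplitude * - ((t \<xi>)\<^sup>2 * radial n (t \<xi>))) (at \<xi>)"
    unfolding P_def by (intro DERIV_diff DERIV_mult DERIV_add DERIV_cmult u C C' DERIV_radial t)
  moreover have "(- real n * ?u \<xi> * (C' \<xi> + real n * C \<xi>) +
        ((a - 2 * q * cosh (2 * \<xi>)) * C \<xi> + real n * C' \<xi>) * ?u \<xi>)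
      - amplitude * - ((t \<xi>)\<^sup>2 * radial n (t \<xi>)) = ?P'"
  proof -
    have "(t \<xi>)\<^sup>2 = q * exp (2 * \<xi>)"
      using q_pos by (simp add: t_def power_mult_distrib exp_double)
    then have "2 * q * cosh (2 * \<xi>) = (t \<xi>)\<^sup>2 + q * exp (- 2 * \<xi>)"
      by (simp add: cosh_field_def algebra_simps)
    then have c: "a - 2 * q * cosh (2 * \<xi>) = e \<xi> + (real n)\<^sup>2 - (t \<xi>)\<^sup>2"
      by (simp add: e_def)
    show ?thesis
      unfolding c RE by (simp add: algebra_simps power2_eq_square)
  qed
  ultimately have P: "(P has_real_derivative ?P') (at \<xi>)" by simp
  have "(radial_error' has_real_derivative (?P' * t \<xi> - P \<xi> * t \<xi>) / (t \<xi> * t \<xi>)) (at \<xi>)"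
    unfolding RP by (intro DERIV_divide P t) (use t_pos[of \<xi>] in simp)
  moreover have "(?P' * t \<xi> - P \<xi> * t \<xi>) / (t \<xi> * t \<xi>) =
      - t \<xi> * radial_error \<xi> + e \<xi> / t \<xi> * (?u \<xi> * C \<xi>) - radial_error' \<xi>"
    using t_pos[of \<xi>] unfolding RP by (simp add: field_simps power2_eq_square)
  ultimately show "(radial_error' has_real_derivative - t \<xi> * radial_error \<xi>
           + e \<xi> / t \<xi> * (?u \<xi> * C \<xi>) - radial_error' \<xi>) (at \<xi>)" by simp
qed

text \<open>The scaling of the second component by \<open>1 / (\<surd>q exp \<xi>)\<close> makes the cross terms cancel
  in the derivative of the energy, so that only the small perturbation can increase it.\<close>

lemma radial_part_close:
  assumes X: "0 \<le> X" and small: "4 * (K + 1)\<^sup>2 * q \<le> 1"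
    and B: "\<And>t. 0 \<le> t \<Longrightarrow> t \<le> sqrt q * exp X \<Longrightarrow> \<bar>radial n t\<bar> \<le> B"
  defines "c \<equiv> (if n = 0 then - (2 * (K + 1)\<^sup>2 * q) else 1 / 2)"
  shows "(radial_error X)\<^sup>2 + (radial_error' X)\<^sup>2 \<le>
     ((radial_error 0)\<^sup>2 + (radial_error' 0)\<^sup>2) * exp (- c * X)
     + 2 * (K + 1)\<^sup>2 * amplitude\<^sup>2 * B\<^sup>2 * q * X * max 1 (exp (- c * X))"
proof -
  define t where "t \<xi> = sqrt q * exp \<xi>" for \<xi>
  define e where "e \<xi> = a - (real n)\<^sup>2 - q * exp (- 2 * \<xi>)" for \<xi>
  define y where "y \<xi> = exp (- real n * \<xi>) * C \<xi>" for \<xi>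
  define E where "E \<xi> = (radial_error \<xi>)\<^sup>2 + (radial_error' \<xi>)\<^sup>2" for \<xi>
  define E' where "E' \<xi> = 2 * radial_error \<xi> * (t \<xi> * radial_error' \<xi> - 2 * real n * radial_error \<xi>) +
     2 * radial_error' \<xi> * (- t \<xi> * radial_error \<xi> + e \<xi> / t \<xi> * y \<xi> - radial_error' \<xi>)" for \<xi>
  have E: "(E has_real_derivative E' \<xi>) (at \<xi>)" for \<xi>
    unfolding E_def E'_def
    by (auto intro!: derivative_eq_intros DERIV_radial_error[folded t_def e_def y_def])
  have bound: "E' \<xi> \<le> - c * E \<xi> + 2 * (K + 1)\<^sup>2 * amplitude\<^sup>2 * B\<^sup>2 * q" if \<xi>: "0 \<le> \<xi>" "\<xi> \<le> X" for \<xi>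
  proof -
    let ?Y = "radial_error \<xi>" and ?R = "radial_error' \<xi>" and ?d = "e \<xi> / t \<xi>" and ?k = "(K + 1)\<^sup>2 * q"
    have t: "sqrt q \<le> t \<xi>" "t \<xi> \<le> sqrt q * exp X" using \<xi> q_pos by (simp_all add: t_def)
    have tp: "0 < t \<xi>" using q_pos by (simp add: t_def)
    have "exp (- 2 * \<xi>) \<le> 1" using \<xi> by simp
    then have "0 \<le> q * exp (- 2 * \<xi>)" "q * exp (- 2 * \<xi>) \<le> q"
      using q_pos by (auto intro: mult_left_le)
    then have "\<bar>e \<xi>\<bar> \<le> (K + 1) * q"
      using a_near unfolding e_def distrib_right by linarith
    then have "(e \<xi>)\<^sup>2 \<le> ((K + 1) * q)\<^sup>2" using abs_le_square_iff[of "e \<xi>" "(K + 1) * q"] by linarith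
    also have "\<dots> = ?k * (sqrt q)\<^sup>2" using q_pos by (simp add: power2_eq_square)
    \<comment> \<open>Since t >= \<open>sqrt q\<close>, the bound of order q for e becomes one of
      order \<open>sqrt q\<close> for e / t.\<close>
    also have "\<dots> \<le> ?k * (t \<xi>)\<^sup>2"
      using t(1) q_pos by (intro mult_left_mono power_mono) auto
    finally have d: "?d\<^sup>2 \<le> ?k" using tp by (simp add: power_divide divide_le_eq)
    have "(amplitude * radial n (t \<xi>))\<^sup>2 \<le> amplitude\<^sup>2 * B\<^sup>2"
      unfolding power_mult_distrib
      by (intro mult_left_mono, rule abs_le_square_iff[THEN iffD1]) (use B[of "t \<xi>"] t tp in auto)
    moreover have "y \<xi> = ?Y + amplitude * radial n (t \<xi>)"
      by (simp add: y_def radial_error_def t_def)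
    moreover have "(?Y + z)\<^sup>2 \<le> 2 * (?Y\<^sup>2 + z\<^sup>2)" for z
      using sum_squares_bound[of ?Y z] by (simp add: power2_sum)
    ultimately have y: "(y \<xi>)\<^sup>2 \<le> 2 * (?Y\<^sup>2 + amplitude\<^sup>2 * B\<^sup>2)" by (smt (verit))
    have "E' \<xi> = - 4 * real n * ?Y\<^sup>2 - 2 * ?R\<^sup>2 + 2 * ((?d * y \<xi>) * ?R)"
      by (simp add: E'_def algebra_simps power2_eq_square)
    \<comment> \<open>The mixed term costs one of the two negative squares of \<open>?R\<close>; the
      other one remains for damping.\<close>
    also have "\<dots> \<le> - 4 * real n * ?Y\<^sup>2 - ?R\<^sup>2 + ?d\<^sup>2 * (y \<xi>)\<^sup>2"
      using sum_squares_bound[of "?d * y \<xi>" ?R] unfolding power_mult_distrib by linarith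
    finally have 0: "E' \<xi> \<le> - 4 * real n * ?Y\<^sup>2 - ?R\<^sup>2 + ?d\<^sup>2 * (y \<xi>)\<^sup>2" .
    have "?d\<^sup>2 * (y \<xi>)\<^sup>2 \<le> ?k * (2 * (?Y\<^sup>2 + amplitude\<^sup>2 * B\<^sup>2))"
      using d y q_pos by (intro mult_mono) auto
    also have "\<dots> = 2 * ?k * ?Y\<^sup>2 + 2 * ?k * (amplitude\<^sup>2 * B\<^sup>2)"
      by (simp add: algebra_simps)
    finally have 1: "E' \<xi> \<le> - 4 * real n * ?Y\<^sup>2 - ?R\<^sup>2 + 2 * ?k * ?Y\<^sup>2 + 2 * ?k * (amplitude\<^sup>2 * B\<^sup>2)"
      using 0 by linarith
    \<comment> \<open>For n = 0 the first error is not damped, and a growth rate of order q has to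
      be accepted. For n >= 1 the term - 4 n \<open>?Y\<close>^2 outweighs the perturbation, which
      \<open>small\<close> keeps below \<open>?Y\<close>^2 / 2.\<close>
    have "- 4 * real n * ?Y\<^sup>2 - ?R\<^sup>2 + 2 * ?k * ?Y\<^sup>2 \<le> - c * E \<xi>"
    proof (cases "n = 0")
      case True
      have "0 \<le> 2 * ?k * ?R\<^sup>2" using q_pos by simp
      then show ?thesis using zero_le_power2[of ?R] 
        unfolding c_def E_def using True by (simp add: algebra_simps)
    next
      case False
      then have "1 * ?Y\<^sup>2 \<le> real n * ?Y\<^sup>2" by (intro mult_right_mono) auto
      moreover have "4 * ?k * ?Y\<^sup>2 \<le> 1 * ?Y\<^sup>2" using small by (intro mult_right_mono) auto
      moreover have "- 4 * N * y - r + 2 * k * y \<le> - (1 / 2) * (y + r)"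
        if "1 * y \<le> N * y" "4 * k * y \<le> 1 * y" "0 \<le> r" "0 \<le> y" for N y r k :: real
      proof -
        have "- 4 * A - r + 2 * B \<le> - (1 / 2) * (y + r)" if "y \<le> A" "4 * B \<le> y" for A B
          using that \<open>0 \<le> r\<close> \<open>0 \<le> y\<close> by (simp add: field_simps)
        from this[of "N * y" "k * y"] that show ?thesis by (simp add: mult.assoc)
      qed
      ultimately show ?thesis
        unfolding c_def E_def if_not_P[OF False] using zero_le_power2 by blast
    qed
    then show ?thesis using 1 by (simp add: mult_ac)
  qed
  have "E X \<le> E 0 * exp (- c * X) + (2 * (K + 1)\<^sup>2 * amplitude\<^sup>2 * B\<^sup>2 * q) * X * max 1 (exp (- c * X))"
    by (rule gronwall[OF E bound X]) (use q_pos in auto)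
  then show ?thesis unfolding E_def .
qed

end

section \<open>Asymptotics of the eigenvalues\<close>

lemma angular_periodic:
  "angular s n (2 * pi) = angular s n 0" "angular' s n (2 * pi) = angular' s n 0"
proof -
  have "cos (real n * (2 * pi)) = 1" "sin (real n * (2 * pi)) = 0"
    using cos_int_2pin[of "int n"] sin_int_2pin[of "int n"] by (simp_all add: mult_ac)
  then show "angular s n (2 * pi) = angular s n 0" "angular' s n (2 * pi) = angular' s n 0"
    by (cases s; simp add: angular_def angular'_def)+
qed

lemma continuous_on_angular: "continuous_on S (angular s n)"
  by (meson DERIV_angular(1) DERIV_isCont continuous_at_imp_continuous_on)

lemma integral_angular_power2:
  assumes "s = Minus \<Longrightarrow> 1 \<le> n"
  shows "integral {0..2 * pi} (\<lambda>x. (angular s n x)\<^sup>2) = (if s = Plus \<and> n = 0 then 2 * pi else pi)"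
proof (cases "n = 0")
  case True
  then have "s = Plus" using assms by (cases s) auto
  then show ?thesis using True by (simp add: angular_def)
next
  case False
  \<comment> \<open>An antiderivative for both parities at once: (g g')' = g'^2 - n^2 g^2, while
    g'^2 + n^2 g^2 = n^2.\<close>
  let ?F = "\<lambda>x. x / 2 - angular s n x * angular' s n x / (2 * (real n)\<^sup>2)"
  have pyth: "(angular' s n x)\<^sup>2 = (real n)\<^sup>2 - (real n)\<^sup>2 * (angular s n x)\<^sup>2" for x
    by (cases s) (simp_all add: angular_def angular'_def power_mult_distrib cos_squared_eq algebra_simps)
  have "((\<lambda>x. (angular s n x)\<^sup>2) has_integral ?F (2 * pi) - ?F 0) {0..2 * pi}"
  proof (rule fundamental_theorem_of_calculus)
    fix x
    have "(?F has_real_derivative 1 / 2 - (angular' s n x * angular' s n x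
        + - (real n)\<^sup>2 * angular s n x * angular s n x) / (2 * (real n)\<^sup>2)) (at x within {0..2 * pi})"
      by (rule DERIV_subset[of _ _ _ UNIV],
          intro DERIV_diff DERIV_cdivide DERIV_mult DERIV_angular DERIV_ident) auto
    also have "1 / 2 - (angular' s n x * angular' s n x
        + - (real n)\<^sup>2 * angular s n x * angular s n x) / (2 * (real n)\<^sup>2) = (angular s n x)\<^sup>2"
      using False pyth[of x] by (simp add: field_simps power2_eq_square)
    finally show "(?F has_vector_derivative (angular s n x)\<^sup>2) (at x within {0..2 * pi})"
      by (simp add: has_real_derivative_iff_has_vector_derivative)
  qed simp
  moreover have "?F (2 * pi) - ?F 0 = pi"
    by (simp add: angular_periodic)
  ultimately show ?thesis using False by (simp add: integral_unique)
qed

context mathieu_product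
begin

lemma continuous_on_\<phi>: "continuous_on S \<phi>"
  by (meson \<phi> DERIV_isCont continuous_at_imp_continuous_on)

text \<open>The Wronskian of \<phi> and g = \<open>angular s n\<close> is periodic, so its
  derivative (n^2 - a + 2 q cos 2x) \<phi> g has integral 0. The right-hand side comes from |\<phi>|
  <= (\<phi>^2 + 1) / 2.\<close>

lemma eigenvalue_estimate:
  "\<bar>a - (real n)\<^sup>2\<bar> * \<bar>integral {0..2 * pi} (\<lambda>x. \<phi> x * angular s n x)\<bar>
     \<le> q * (integral {0..2 * pi} (\<lambda>x. (\<phi> x)\<^sup>2) + 2 * pi)"
proof -
  let ?I = "{0..2 * pi}"
  let ?g = "angular s n" and ?g' = "angular' s n"
  let ?W = "\<lambda>x. \<phi>' x * ?g x - ?g' x * \<phi> x"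
  have int: "h integrable_on ?I" if "continuous_on ?I h" for h :: "real \<Rightarrow> real"
    using that by (rule integrable_continuous_interval)
  note cont = continuous_on_\<phi> continuous_on_angular
  have "((\<lambda>x. ((real n)\<^sup>2 - a) * (\<phi> x * ?g x) + 2 * q * (cos (2 * x) * (\<phi> x * ?g x))) has_integral ?W (2 * pi) - ?W 0) ?I"
  proof (rule fundamental_theorem_of_calculus)
    fix x
    have "(?W has_real_derivative (- (a - 2 * q * cos (2 * x)) * \<phi> x * ?g x + ?g' x * \<phi>' x)
        - (- (real n)\<^sup>2 * ?g x * \<phi> x + \<phi>' x * ?g' x)) (at x within ?I)"
      by (rule DERIV_subset[of _ _ _ UNIV],
          intro DERIV_diff DERIV_mult DERIV_angular \<phi> \<phi>') auto
    also have "(- (a - 2 * q * cos (2 * x)) * \<phi> x * ?g x + ?g' x * \<phi>' x)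
        - (- (real n)\<^sup>2 * ?g x * \<phi> x + \<phi>' x * ?g' x) =
        ((real n)\<^sup>2 - a) * (\<phi> x * ?g x) + 2 * q * (cos (2 * x) * (\<phi> x * ?g x))"
      by (simp add: algebra_simps)
    finally show "(?W has_vector_derivative ((real n)\<^sup>2 - a) * (\<phi> x * ?g x)
        + 2 * q * (cos (2 * x) * (\<phi> x * ?g x))) (at x within ?I)"
      by (simp add: has_real_derivative_iff_has_vector_derivative)
  qed simp
  moreover have "?W (2 * pi) - ?W 0 = 0"
    using \<phi>_periodic[of 0] derivative_periodic[of 0] by (simp add: angular_periodic)
  ultimately have "integral ?I (\<lambda>x. ((real n)\<^sup>2 - a) * (\<phi> x * ?g x) + 2 * q * (cos (2 * x) * (\<phi> x * ?g x))) = 0"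
    by (simp add: integral_unique)
  also have "integral ?I (\<lambda>x. ((real n)\<^sup>2 - a) * (\<phi> x * ?g x) + 2 * q * (cos (2 * x) * (\<phi> x * ?g x))) =
      ((real n)\<^sup>2 - a) * integral ?I (\<lambda>x. \<phi> x * ?g x) + 2 * q * integral ?I (\<lambda>x. cos (2 * x) * (\<phi> x * ?g x))"
    by (subst integral_add) (auto intro!: int continuous_intros cont)
  finally have eq: "(a - (real n)\<^sup>2) * integral ?I (\<lambda>x. \<phi> x * ?g x) =
      2 * q * integral ?I (\<lambda>x. cos (2 * x) * (\<phi> x * ?g x))"
    by (simp add: algebra_simps)
  have "\<bar>integral ?I (\<lambda>x. cos (2 * x) * (\<phi> x * ?g x))\<bar> \<le> integral ?I (\<lambda>x. ((\<phi> x)\<^sup>2 + 1) / 2)"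
  proof (rule Henstock_Kurzweil_Integration.integral_norm_bound_integral[where 'n = real and 'a = real, unfolded real_norm_def])
    fix x
    have "\<bar>cos (2 * x) * (\<phi> x * ?g x)\<bar> \<le> 1 * (\<bar>\<phi> x\<bar> * 1)"
      unfolding abs_mult by (intro mult_mono abs_angular_le_1 abs_cos_le_one) auto
    also have "\<dots> \<le> ((\<phi> x)\<^sup>2 + 1) / 2"
      using sum_squares_bound[of "\<bar>\<phi> x\<bar>" 1] by simp
    finally show "\<bar>cos (2 * x) * (\<phi> x * ?g x)\<bar> \<le> ((\<phi> x)\<^sup>2 + 1) / 2" .
  qed (auto intro!: int continuous_intros cont)
  also have "integral ?I (\<lambda>x. ((\<phi> x)\<^sup>2 + 1) / 2) = (integral ?I (\<lambda>x. (\<phi> x)\<^sup>2) + 2 * pi) / 2"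
  proof -
    have "integral ?I (\<lambda>x. (\<phi> x)\<^sup>2 + 1) = integral ?I (\<lambda>x. (\<phi> x)\<^sup>2) + integral ?I (\<lambda>x. 1)"
      by (rule integral_add) (auto intro!: int continuous_intros cont)
    then show ?thesis by simp
  qed
  finally have "2 * \<bar>integral ?I (\<lambda>x. cos (2 * x) * (\<phi> x * ?g x))\<bar> \<le> integral ?I (\<lambda>x. (\<phi> x)\<^sup>2) + 2 * pi"
    by simp
  then have "q * (2 * \<bar>integral ?I (\<lambda>x. cos (2 * x) * (\<phi> x * ?g x))\<bar>) \<le> q * (integral ?I (\<lambda>x. (\<phi> x)\<^sup>2) + 2 * pi)"
    using q_pos by (intro mult_left_mono) auto
  then show ?thesis
    unfolding abs_mult[symmetric] eq using q_pos by (simp add: abs_mult mult_ac)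
qed

end

text \<open>The excess of a function over its truncation to \<open>[-1, 1]\<close> is controlled by the excess of
  the squares, to which the convergence of the norms applies.\<close>

lemma tendsto_integral_mult_limit:
  fixes f :: "nat \<Rightarrow> real \<Rightarrow> real"
  assumes f: "\<And>k. continuous_on {a..b} (f k)" and g: "continuous_on {a..b} g"
    and le: "\<And>x. \<bar>g x\<bar> \<le> 1"
    and lim: "\<And>x. x \<in> {a..b} \<Longrightarrow> (\<lambda>k. f k x) \<longlonglongrightarrow> g x"
    and norm: "\<And>k. integral {a..b} (\<lambda>x. (f k x)\<^sup>2) = integral {a..b} (\<lambda>x. (g x)\<^sup>2)"
  shows "(\<lambda>k. integral {a..b} (\<lambda>x. f k x * g x)) \<longlonglongrightarrow> integral {a..b} (\<lambda>x. (g x)\<^sup>2)"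
proof -
  let ?I = "{a..b}"
  have int: "h integrable_on ?I" if "continuous_on ?I h" for h :: "real \<Rightarrow> real"
    using that by (rule integrable_continuous_interval)
  \<comment> \<open>Pointwise convergence provides no dominating function for \<open>f k\<close>;
    the truncations are dominated by 1 and have the same limit, because |g| <= 1.\<close>
  define p where "p k x = max (-1) (min 1 (f k x))" for k x
  have p: "continuous_on ?I (p k)" for k
    unfolding p_def by (intro continuous_intros f)
  have p1: "\<bar>p k x\<bar> \<le> 1" for k x by (auto simp: p_def)
  have p_lim: "(\<lambda>k. p k x) \<longlonglongrightarrow> g x" if "x \<in> ?I" for x
  proof -
    have "(\<lambda>k. p k x) \<longlonglongrightarrow> max (-1) (min 1 (g x))"
      unfolding p_def by (intro tendsto_intros lim that)
    also have "max (-1) (min 1 (g x)) = g x" using le[of x] by (auto simp: abs_le_iff)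
    finally show ?thesis .
  qed
  have "(\<lambda>k. integral ?I (\<lambda>x. (p k x)\<^sup>2)) \<longlonglongrightarrow> integral ?I (\<lambda>x. (g x)\<^sup>2)"
  proof (rule dominated_convergence(2)[where h = "\<lambda>_. 1"])
    show "norm ((p k x)\<^sup>2) \<le> 1" for k x using p1[of k x] by (simp add: abs_square_le_1)
    show "(\<lambda>k. (p k x)\<^sup>2) \<longlonglongrightarrow> (g x)\<^sup>2" if "x \<in> ?I" for x
      by (intro tendsto_intros p_lim that)
  qed (auto intro!: int continuous_intros p)
  then have "(\<lambda>k. (integral ?I (\<lambda>x. (g x)\<^sup>2) - integral ?I (\<lambda>x. (p k x)\<^sup>2)) / 2) \<longlonglongrightarrow>
      (integral ?I (\<lambda>x. (g x)\<^sup>2) - integral ?I (\<lambda>x. (g x)\<^sup>2)) / 2"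
    by (intro tendsto_intros) auto
  then have null: "(\<lambda>k. (integral ?I (\<lambda>x. (g x)\<^sup>2) - integral ?I (\<lambda>x. (p k x)\<^sup>2)) / 2) \<longlonglongrightarrow> 0" by simp
  have diff: "\<bar>integral ?I (\<lambda>x. f k x * g x) - integral ?I (\<lambda>x. p k x * g x)\<bar> \<le>
      (integral ?I (\<lambda>x. (g x)\<^sup>2) - integral ?I (\<lambda>x. (p k x)\<^sup>2)) / 2" for k
  proof -
    have "integral ?I (\<lambda>x. f k x * g x) - integral ?I (\<lambda>x. p k x * g x) =
        integral ?I (\<lambda>x. f k x * g x - p k x * g x)"
      by (rule integral_diff[symmetric]) (auto intro!: int continuous_intros f g p)
    also have "\<bar>\<dots>\<bar> \<le> integral ?I (\<lambda>x. ((f k x)\<^sup>2 - (p k x)\<^sup>2) / 2)"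
    proof (rule Henstock_Kurzweil_Integration.integral_norm_bound_integral[where 'n = real and 'a = real, unfolded real_norm_def])
      fix x
      have "\<bar>f k x * g x - p k x * g x\<bar> = \<bar>f k x - p k x\<bar> * \<bar>g x\<bar>"
        by (simp add: abs_mult[symmetric] algebra_simps)
      also have "\<dots> \<le> \<bar>f k x - p k x\<bar>" using le[of x] by (intro mult_left_le) auto
      also have "\<dots> \<le> ((f k x)\<^sup>2 - (p k x)\<^sup>2) / 2"
      proof -
        have sq: "2 * v \<le> v\<^sup>2 + 1" "- (2 * v) \<le> v\<^sup>2 + 1" for v :: real
          using zero_le_power2[of "v - 1"] zero_le_power2[of "v + 1"]
          by (simp_all add: power2_eq_square algebra_simps)
        consider "f k x \<ge> 1" | "f k x \<le> -1" | "\<bar>f k x\<bar> < 1" by linarith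
        then show ?thesis
        proof cases
          case 1
          then have "p k x = 1" "\<bar>f k x - 1\<bar> = f k x - 1" by (auto simp: p_def)
          then show ?thesis using sq(1)[of "f k x"] by simp
        next
          case 2
          then have "p k x = -1" "\<bar>f k x + 1\<bar> = - f k x - 1" by (auto simp: p_def)
          then show ?thesis using sq(2)[of "f k x"] by simp
        next
          case 3
          then have "p k x = f k x" by (auto simp: p_def)
          then show ?thesis by simp
        qed
      qed
      finally show "\<bar>f k x * g x - p k x * g x\<bar> \<le> ((f k x)\<^sup>2 - (p k x)\<^sup>2) / 2" .
    qed (auto intro!: int continuous_intros f g p)
    also have "integral ?I (\<lambda>x. ((f k x)\<^sup>2 - (p k x)\<^sup>2) / 2) =
        (integral ?I (\<lambda>x. (f k x)\<^sup>2) - integral ?I (\<lambda>x. (p k x)\<^sup>2)) / 2"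
      using integral_diff[of "\<lambda>x. (f k x)\<^sup>2" ?I "\<lambda>x. (p k x)\<^sup>2"]
      by (simp add: int continuous_intros f p)
    finally show ?thesis unfolding norm .
  qed
  have "(\<lambda>k. integral ?I (\<lambda>x. f k x * g x) - integral ?I (\<lambda>x. p k x * g x)) \<longlonglongrightarrow> 0"
    by (rule tendsto_rabs_zero_cancel, rule tendsto_sandwich[OF _ _ tendsto_const null])
       (use diff in auto)
  moreover have "(\<lambda>k. integral ?I (\<lambda>x. p k x * g x)) \<longlonglongrightarrow> integral ?I (\<lambda>x. g x * g x)"
  proof (rule dominated_convergence(2)[where h = "\<lambda>_. 1"])
    show "norm (p k x * g x) \<le> 1" for k x
      using mult_mono[OF p1[of k x] le[of x]] by (simp add: abs_mult)
    show "(\<lambda>k. p k x * g x) \<longlonglongrightarrow> g x * g x" if "x \<in> ?I" for x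
      by (intro tendsto_intros p_lim that)
  qed (auto intro!: int continuous_intros p g)
  ultimately show ?thesis
    using tendsto_add by (fastforce simp: power2_eq_square)
qed

text \<open>The integral in \<open>eigenvalue_estimate\<close> tends to \<pi> or 2\<pi>, so it
  eventually exceeds 1, and the squared norm plus 2\<pi> is at most 4\<pi>.\<close>

lemma eigenvalue_asymptotics:
  assumes prod: "\<And>q. 0 < q \<Longrightarrow> mathieu_product s q (a q) (C q) (C' q) (\<phi> q) (\<phi>' q)"
    and n: "s = Minus \<Longrightarrow> 1 \<le> n"
    and norm: "\<And>q. 0 < q \<Longrightarrow> integral {0..2 * pi} (\<lambda>x. (\<phi> q x)\<^sup>2) = (if s = Plus \<and> n = 0 then 2 * pi else pi)"
    and lim: "\<And>x. ((\<lambda>q. \<phi> q x) \<longlongrightarrow> angular s n x) (at_right 0)"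
  shows "\<forall>\<^sub>F q in at_right 0. \<bar>a q - (real n)\<^sup>2\<bar> \<le> 4 * pi * q"
proof -
  let ?N = "integral {0..2 * pi} (\<lambda>x. (angular s n x)\<^sup>2)"
  have N: "?N = (if s = Plus \<and> n = 0 then 2 * pi else pi)"
    by (rule integral_angular_power2[OF n])
  have "((\<lambda>q. integral {0..2 * pi} (\<lambda>x. \<phi> q x * angular s n x)) \<longlongrightarrow> ?N) (at_right 0)"
  proof (rule tendsto_at_right_sequentially[of 0 1])
    fix S :: "nat \<Rightarrow> real" assume S: "\<And>k. 0 < S k" "S \<longlonglongrightarrow> 0"
    then have fl: "filterlim S (at_right 0) sequentially"
      by (auto simp: filterlim_at less_imp_neq[symmetric] dest: less_imp_neq)
    show "(\<lambda>k. integral {0..2 * pi} (\<lambda>x. \<phi> (S k) x * angular s n x)) \<longlonglongrightarrow> ?N"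
    proof (rule tendsto_integral_mult_limit)
      show "continuous_on {0..2 * pi} (\<phi> (S k))" for k
        by (rule mathieu_product.continuous_on_\<phi>[OF prod[OF S(1)]])
      show "(\<lambda>k. \<phi> (S k) x) \<longlonglongrightarrow> angular s n x" for x
        by (rule filterlim_compose[OF lim fl])
    qed (use S norm N abs_angular_le_1 continuous_on_angular in auto)
  qed simp
  moreover have "1 < ?N" unfolding N using pi_gt3 by simp
  ultimately have "\<forall>\<^sub>F q in at_right 0. 1 < integral {0..2 * pi} (\<lambda>x. \<phi> q x * angular s n x)"
    by (rule order_tendstoD(1))
  then show ?thesis
    using eventually_at_right_less[of 0]
  proof eventually_elim
    case (elim q)
    interpret mathieu_product s q "a q" "C q" "C' q" "\<phi> q" "\<phi>' q" by (rule prod[OF elim(2)])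
    have "\<bar>a q - (real n)\<^sup>2\<bar> * 1 \<le> \<bar>a q - (real n)\<^sup>2\<bar> * \<bar>integral {0..2 * pi} (\<lambda>x. \<phi> q x * angular s n x)\<bar>"
      using elim(1) by (intro mult_left_mono) auto
    also have "\<dots> \<le> q * (integral {0..2 * pi} (\<lambda>x. (\<phi> q x)\<^sup>2) + 2 * pi)"
      by (rule eigenvalue_estimate)
    also have "\<dots> \<le> q * (4 * pi)"
      using elim(2) norm[OF elim(2)] by (intro mult_left_mono) auto
    finally show ?case by (simp add: mult_ac)
  qed
qed

section \<open>Passage to the limit\<close>

text \<open>The source of \<open>limit_beta\<close>: 2 n \<open>limit_beta n\<close> / (2^n n!) = n
  matches C' + n C = n A at 0. For n = 0 this reads 0 = 0, and the second equation settles the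
  constant instead.\<close>

lemma radial_0: 
  assumes "s = Minus \<Longrightarrow> 1 \<le> n"
  shows "radial' n 0 = real n" "n = 0 \<Longrightarrow> radial n 0 = angular s n 0"
proof -
  show "radial' n 0 = real n"
    by (cases n) (simp_all add: radial'_def limit_beta_def)
  show "radial n 0 = angular s n 0" if "n = 0"
    using assms that by (cases s) (simp_all add: radial_def limit_beta_def angular_def)
qed

lemma isCont_radial: "isCont (radial n) t" "isCont (radial' n) t"
proof -
  have "isCont (\<lambda>t. bessel_E m (t\<^sup>2 / 4)) t" for m
    by (rule isCont_o2[of t "\<lambda>t. t\<^sup>2 / 4" "bessel_E m"])
       (auto intro!: continuous_intros DERIV_isCont has_real_derivative_bessel_E)
  then show "isCont (radial n) t" "isCont (radial' n) t"
    unfolding radial_def[abs_def] radial'_def[abs_def] by (auto intro!: continuous_intros)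
qed

text \<open>The initial value of \<open>radial_error'\<close> has the denominator
  \<open>sqrt q\<close>, so first-order agreement at t = 0 is required. It holds because
  \<open>radial' n\<close> is a function of t^2.\<close>

lemma radial'_flat: "((\<lambda>t. (real n - radial' n t) / t) \<longlongrightarrow> 0) (at 0)"
proof -
  have "(radial' n has_real_derivative 0) (at 0)"
    unfolding radial'_def[abs_def]
    by (auto intro!: derivative_eq_intros DERIV_chain2[OF has_real_derivative_bessel_E])
  then have "((\<lambda>t. - ((radial' n (0 + t) - radial' n 0) / t)) \<longlongrightarrow> - 0) (at 0)"
    unfolding DERIV_def by (intro tendsto_intros)
  moreover have "radial' n 0 = real n" using radial_0(1)[of Plus] by simp
  ultimately show ?thesis by (simp add: minus_divide_left)
qed

lemma powr_half_eq: "0 < q \<Longrightarrow> q powr (real n / 2) = sqrt q ^ n"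
  by (simp add: powr_half_sqrt[symmetric] powr_power)

locale mathieu_modes =
  fixes s :: parity and n :: nat and K :: real and a :: "real \<Rightarrow> real" and C C' \<phi> \<phi>' :: "real \<Rightarrow> real \<Rightarrow> real"
  assumes modes: "\<forall>\<^sub>F q in at_right 0. mathieu_mode s q (a q) (C q) (C' q) (\<phi> q) (\<phi>' q) n K"
    and pointwise: "\<And>x. ((\<lambda>q. \<phi> q x) \<longlongrightarrow> angular s n x) (at_right 0)"
begin

abbreviation amp :: "real \<Rightarrow> real" where
  "amp q \<equiv> mathieu_mode.amplitude s (\<phi> q) (\<phi>' q) n"

lemma n_ge_1: "s = Minus \<Longrightarrow> 1 \<le> n"
  using eventually_happens'[OF _ modes] mathieu_mode.n by fastforce

lemma K_ge_0: "0 \<le> K"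
  using eventually_happens'[OF _ modes] mathieu_mode.K_nonneg by fastforce

text \<open>The constant of \<open>angular_part_close\<close>, freed from q and the
  amplitude.\<close>

definition M where "M = (K + 2) * 4 * exp ((1 + (real n)\<^sup>2 + 2 * (K + 2)) * 4)"

lemma angular_part_error:
  assumes "\<bar>x\<bar> \<le> 4" "mathieu_mode s q (a q) (C q) (C' q) (\<phi> q) (\<phi>' q) n K" "q \<le> 1"
  shows "\<bar>\<phi> q x - amp q * angular s n x\<bar> \<le> sqrt (M * q) * \<bar>amp q\<bar>"
    "\<bar>\<phi>' q x - amp q * angular' s n x\<bar> \<le> sqrt (M * q) * \<bar>amp q\<bar>"
proof -
  have *: "\<bar>v\<bar> \<le> sqrt A * \<bar>b\<bar>" if "v\<^sup>2 \<le> A * b\<^sup>2" for v A b :: real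
    using real_sqrt_le_mono[OF that] by (simp add: real_sqrt_mult)
  have "(\<phi> q x - amp q * angular s n x)\<^sup>2 + (\<phi>' q x - amp q * angular' s n x)\<^sup>2 \<le> M * q * (amp q)\<^sup>2"
    using mathieu_mode.angular_part_close[OF assms(2,3,1)] by (simp add: M_def mult_ac)
  then have "(\<phi> q x - amp q * angular s n x)\<^sup>2 \<le> M * q * (amp q)\<^sup>2"
    "(\<phi>' q x - amp q * angular' s n x)\<^sup>2 \<le> M * q * (amp q)\<^sup>2"
    using zero_le_power2[of "\<phi> q x - amp q * angular s n x"]
      zero_le_power2[of "\<phi>' q x - amp q * angular' s n x"] by linarith+
  then show "\<bar>\<phi> q x - amp q * angular s n x\<bar> \<le> sqrt (M * q) * \<bar>amp q\<bar>"
    "\<bar>\<phi>' q x - amp q * angular' s n x\<bar> \<le> sqrt (M * q) * \<bar>amp q\<bar>"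
    by (auto intro!: *)
qed

lemma sqrt_M_null: "((\<lambda>q. sqrt (M * q)) \<longlongrightarrow> 0) (at_right 0)"
proof -
  have "((\<lambda>q. sqrt (M * q)) \<longlongrightarrow> sqrt (M * 0)) (at_right 0)"
    by (intro tendsto_intros)
  then show ?thesis by simp
qed

lemma eventually_le_1: "\<forall>\<^sub>F q in at_right 0. q \<le> (1::real)"
  by (rule eventually_at_rightI[of 0 1]) auto

text \<open>Read off at one point where the angular function is 1. The error bound is relative to
  the amplitude, so boundedness comes first: |\<phi> - amp| <= |amp| / 2 and |\<phi>| < 2 give |amp|
  <= 4.\<close>

lemma amp_tendsto: "(amp \<longlongrightarrow> 1) (at_right 0)"
proof -
  define x where "x = (case s of Plus \<Rightarrow> 0 | Minus \<Rightarrow> pi / (2 * real n))"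
  have x: "\<bar>x\<bar> \<le> 4" "angular s n x = 1"
  proof -
    show "angular s n x = 1"
      using n_ge_1 by (cases s) (simp_all add: x_def angular_def)
    show "\<bar>x\<bar> \<le> 4"
    proof (cases s)
      case Minus
      then have "1 \<le> real n" using n_ge_1 by simp
      then have "pi / (2 * real n) \<le> pi / (2 * 1)" by (intro divide_left_mono) auto
      then show ?thesis using pi_less_4 by (simp add: x_def Minus)
    qed (simp add: x_def)
  qed
  let ?d = "\<lambda>q. sqrt (M * q)"
  have lim: "((\<lambda>q. \<phi> q x) \<longlongrightarrow> 1) (at_right 0)"
    using pointwise[of x] by (simp add: x)
  have b1: "\<forall>\<^sub>F q in at_right 0. ?d q < 1 / 2"
    by (rule order_tendstoD(2)[OF sqrt_M_null]) simp
  have b2: "\<forall>\<^sub>F q in at_right 0. \<bar>\<phi> q x\<bar> < 2"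
    by (rule order_tendstoD(2)[OF tendsto_rabs[OF lim]]) simp
  have "\<forall>\<^sub>F q in at_right 0. \<bar>amp q - \<phi> q x\<bar> \<le> 4 * ?d q"
    using modes eventually_le_1 b1 b2
  proof eventually_elim
    case (elim q)
    have 1: "\<bar>\<phi> q x - amp q\<bar> \<le> ?d q * \<bar>amp q\<bar>"
      using angular_part_error(1)[OF x(1) elim(1,2)] by (simp add: x)
    have "?d q * \<bar>amp q\<bar> \<le> 1 / 2 * \<bar>amp q\<bar>"
      using elim(3) by (intro mult_right_mono) auto
    then have "\<bar>amp q\<bar> \<le> 4" using 1 elim(4) by linarith
    moreover have "0 \<le> ?d q"
      using K_ge_0 mathieu_product.q_pos[OF mathieu_mode.axioms(1)[OF elim(1)]]
      by (simp add: M_def)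
    ultimately have "?d q * \<bar>amp q\<bar> \<le> ?d q * 4" by (intro mult_left_mono)
    then show ?case using 1 by linarith
  qed
  then have "\<forall>\<^sub>F q in at_right 0. norm (amp q - \<phi> q x) \<le> 4 * ?d q" by simp
  from Lim_null_comparison[OF this tendsto_mult_right_zero[OF sqrt_M_null]]
  have "((\<lambda>q. amp q - \<phi> q x) \<longlongrightarrow> 0) (at_right 0)" .
  from tendsto_add[OF this lim] show ?thesis by simp
qed

lemma q_right:
  assumes "filterlim q (at_right 0) F"
  shows "(q \<longlongrightarrow> (0::real)) F" "\<forall>\<^sub>F i in F. 0 < q i"
  using assms by (auto simp: filterlim_at eventually_conj_iff)

text \<open>The point moves with q, which pointwise convergence does not cover; the estimate uniform
  on |x| <= 4 does.\<close>

lemma angular_part_tendsto: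
  assumes q: "filterlim q (at_right 0) F" and x: "(x \<longlongrightarrow> x0) F" "\<bar>x0\<bar> < 4"
  shows "((\<lambda>i. \<phi> (q i) (x i)) \<longlongrightarrow> angular s n x0) F" "((\<lambda>i. \<phi>' (q i) (x i)) \<longlongrightarrow> angular' s n x0) F"
proof -
  have amp: "((\<lambda>i. amp (q i)) \<longlongrightarrow> 1) F" and d: "((\<lambda>i. sqrt (M * q i)) \<longlongrightarrow> 0) F"
    by (rule filterlim_compose[OF amp_tendsto q], rule filterlim_compose[OF sqrt_M_null q])
  have "((\<lambda>i. sqrt (M * q i) * \<bar>amp (q i)\<bar>) \<longlongrightarrow> 0 * \<bar>1\<bar>) F"
    by (intro tendsto_intros amp d)
  then have null: "((\<lambda>i. sqrt (M * q i) * \<bar>amp (q i)\<bar>) \<longlongrightarrow> 0) F" by simp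
  have x4: "\<forall>\<^sub>F i in F. \<bar>x i\<bar> < 4"
    using order_tendstoD(2)[OF tendsto_rabs[OF x(1)] x(2)] .
  have ev: "\<forall>\<^sub>F i in F. \<bar>x i\<bar> < 4 \<and> q i \<le> 1 \<and>
      mathieu_mode s (q i) (a (q i)) (C (q i)) (C' (q i)) (\<phi> (q i)) (\<phi>' (q i)) n K"
    using x4 eventually_compose_filterlim[OF modes q] eventually_compose_filterlim[OF eventually_le_1 q]
    by eventually_elim auto
  have 1: "((\<lambda>i. \<phi> (q i) (x i) - amp (q i) * angular s n (x i)) \<longlongrightarrow> 0) F"
    by (rule Lim_null_comparison[OF _ null], rule eventually_mono[OF ev]) (use angular_part_error(1) in auto)
  have 2: "((\<lambda>i. \<phi>' (q i) (x i) - amp (q i) * angular' s n (x i)) \<longlongrightarrow> 0) F"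
    by (rule Lim_null_comparison[OF _ null], rule eventually_mono[OF ev]) (use angular_part_error(2) in auto)
  have 3: "((\<lambda>i. amp (q i) * angular s n (x i)) \<longlongrightarrow> 1 * angular s n x0) F"
    by (intro tendsto_mult amp isCont_tendsto_compose[OF DERIV_isCont[OF DERIV_angular(1)] x(1)])
  have 4: "((\<lambda>i. amp (q i) * angular' s n (x i)) \<longlongrightarrow> 1 * angular' s n x0) F"
    by (intro tendsto_mult amp isCont_tendsto_compose[OF DERIV_isCont[OF DERIV_angular(2)] x(1)])
  show "((\<lambda>i. \<phi> (q i) (x i)) \<longlongrightarrow> angular s n x0) F" using tendsto_add[OF 1 3] by simp
  show "((\<lambda>i. \<phi>' (q i) (x i)) \<longlongrightarrow> angular' s n x0) F" using tendsto_add[OF 2 4] by simp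
qed

abbreviation rerr :: "real \<Rightarrow> real \<Rightarrow> real" where
  "rerr q \<equiv> mathieu_mode.radial_error s q (C q) (\<phi> q) (\<phi>' q) n"

abbreviation rerr' :: "real \<Rightarrow> real \<Rightarrow> real" where
  "rerr' q \<equiv> mathieu_mode.radial_error' s q (C q) (C' q) (\<phi> q) (\<phi>' q) n"

lemma exp_tendsto_at_top:
  assumes q: "filterlim q (at_right 0) F" and X: "((\<lambda>i. sqrt (q i) * exp (X i)) \<longlongrightarrow> \<tau>) F" and "0 < \<tau>"
  shows "filterlim X at_top F"
proof -
  have "((\<lambda>i. sqrt (q i)) \<longlongrightarrow> sqrt 0) F"
    by (intro tendsto_intros q_right(1)[OF q])
  then have "filterlim (\<lambda>i. sqrt (q i)) (at_right 0) F"
    using q_right(2)[OF q] by (auto simp: filterlim_at elim: eventually_mono)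
  from filterlim_at_top_mult_tendsto_pos[OF X \<open>0 < \<tau>\<close> filterlim_compose[OF filterlim_inverse_at_top_right this]]
  have "filterlim (\<lambda>i. inverse (sqrt (q i)) * (sqrt (q i) * exp (X i))) at_top F" by (simp add: mult.commute)
  then have "filterlim (\<lambda>i. exp (X i)) at_top F"
    by (rule filterlim_mono_eventually[OF _ order_refl order_refl])
       (use q_right(2)[OF q] in \<open>auto elim!: eventually_mono\<close>)
  from filterlim_compose[OF ln_at_top this] show ?thesis by simp
qed

text \<open>The bound of \<open>radial_part_close\<close> tends to 0 for two different reasons. For
  n >= 1 the factor exp (- X/2) kills a merely bounded initial error; for n = 0 the factor tends to
  1 and the initial error to 0. The forcing contains q X.\<close>

lemma radial_part_tendsto:
  assumes q: "filterlim q (at_right 0) F" and X: "((\<lambda>i. sqrt (q i) * exp (X i)) \<longlongrightarrow> \<tau>) F" and \<tau>: "0 < \<tau>"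
  shows "((\<lambda>i. rerr (q i) (X i)) \<longlongrightarrow> 0) F" "((\<lambda>i. rerr' (q i) (X i)) \<longlongrightarrow> 0) F"
proof -
  have X_top: "filterlim X at_top F" by (rule exp_tendsto_at_top[OF assms])
  have q0: "(q \<longlongrightarrow> 0) F" "\<forall>\<^sub>F i in F. 0 < q i" using q_right[OF q] by auto
  have sq0: "((\<lambda>i. sqrt (q i)) \<longlongrightarrow> 0) F" using tendsto_real_sqrt[OF q0(1)] by simp
  have X0: "\<forall>\<^sub>F i in F. 0 \<le> X i" using X_top by (simp add: filterlim_at_top)
  have amp: "((\<lambda>i. amp (q i)) \<longlongrightarrow> 1) F"
    by (rule filterlim_compose[OF amp_tendsto q])
  have mode: "\<forall>\<^sub>F i in F. mathieu_mode s (q i) (a (q i)) (C (q i)) (C' (q i)) (\<phi> (q i)) (\<phi>' (q i)) n K"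
    by (rule eventually_compose_filterlim[OF modes q])
  \<comment> \<open>X <= exp X bounds q X by \<open>sqrt q\<close> times the convergent quantity
    \<open>sqrt q\<close> exp X.\<close>
  have qX: "((\<lambda>i. q i * X i) \<longlongrightarrow> 0) F"
  proof (rule tendsto_sandwich[OF _ _ tendsto_const])
    show "\<forall>\<^sub>F i in F. 0 \<le> q i * X i" using X0 q0(2) by eventually_elim simp
    show "\<forall>\<^sub>F i in F. q i * X i \<le> sqrt (q i) * (sqrt (q i) * exp (X i))"
      using X0 q0(2)
    proof eventually_elim
      case (elim i)
      have "X i \<le> exp (X i)" using exp_ge_add_one_self[of "X i"] by linarith
      then have "q i * X i \<le> q i * exp (X i)" using elim by (intro mult_left_mono) auto
      also have "q i * exp (X i) = sqrt (q i) * (sqrt (q i) * exp (X i))"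
        using elim by (simp add: mult.assoc[symmetric])
      finally show ?case .
    qed
    show "((\<lambda>i. sqrt (q i) * (sqrt (q i) * exp (X i))) \<longlongrightarrow> 0) F"
      using tendsto_mult[OF sq0 X] by simp
  qed
  obtain B where B: "\<And>t. 0 \<le> t \<Longrightarrow> t \<le> \<tau> + 1 \<Longrightarrow> \<bar>radial n t\<bar> \<le> B"
  proof -
    have "compact (radial n ` {0..\<tau> + 1})"
      by (intro compact_continuous_image continuous_at_imp_continuous_on ballI isCont_radial) simp
    then obtain B where "\<forall>y \<in> radial n ` {0..\<tau> + 1}. norm y \<le> B"
      by (meson bounded_iff compact_imp_bounded)
    then show thesis by (intro that[of B]) auto
  qed
  define c where "c i = (if n = 0 then - (2 * (K + 1)\<^sup>2 * q i) else 1 / 2)" for i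
  define e where "e i = (rerr (q i) 0)\<^sup>2 + (rerr' (q i) 0)\<^sup>2" for i
  define L where "L i = 2 * (K + 1)\<^sup>2 * (amp (q i))\<^sup>2 * B\<^sup>2 * q i * X i" for i
  have E: "\<forall>\<^sub>F i in F. (rerr (q i) (X i))\<^sup>2 + (rerr' (q i) (X i))\<^sup>2 \<le>
      e i * exp (- c i * X i) + L i * max 1 (exp (- c i * X i))"
  proof -
    have "((\<lambda>i. 4 * (K + 1)\<^sup>2 * q i) \<longlongrightarrow> 0) F" using tendsto_mult_right_zero[OF q0(1)] .
    then have "\<forall>\<^sub>F i in F. 4 * (K + 1)\<^sup>2 * q i < 1" by (rule order_tendstoD) simp
    moreover have "\<forall>\<^sub>F i in F. sqrt (q i) * exp (X i) < \<tau> + 1"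
      using X by (rule order_tendstoD) simp
    ultimately show ?thesis
      using mode X0
    proof eventually_elim
      case (elim i)
      show ?case
        unfolding e_def L_def c_def
        by (rule mathieu_mode.radial_part_close[OF elim(3,4)]) (use elim(1,2) B in auto)
    qed
  qed
  have m: "((\<lambda>i. exp (- c i * X i)) \<longlongrightarrow> (if n = 0 then 1 else 0)) F"
  proof (cases "n = 0")
    case True
    have "((\<lambda>i. exp (2 * (K + 1)\<^sup>2 * (q i * X i))) \<longlongrightarrow> exp (2 * (K + 1)\<^sup>2 * 0)) F"
      by (intro tendsto_intros qX)
    then show ?thesis using True by (simp add: c_def mult.assoc)
  next
    case False
    have "filterlim (\<lambda>i. (1 / 2) * X i) at_top F"
      by (rule filterlim_tendsto_pos_mult_at_top[OF tendsto_const _ X_top]) simp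
    then have "filterlim (\<lambda>i. - ((1 / 2) * X i)) at_bot F"
      by (simp add: filterlim_uminus_at_bot)
    from filterlim_compose[OF exp_at_bot this] show ?thesis using False by (simp add: c_def)
  qed
  \<comment> \<open>For n >= 1 this limit is 1/4: \<open>radial n 0\<close> is 1/2, while the
    angular value is 1 or 0. The gap is the decaying half of cosh or sinh.\<close>
  have e: "(e \<longlongrightarrow> (angular s n 0 - radial n 0)\<^sup>2 + 0\<^sup>2) F"
  proof -
    have r: "((\<lambda>i. radial n (sqrt (q i))) \<longlongrightarrow> radial n 0) F"
      by (rule isCont_tendsto_compose[OF isCont_radial(1) sq0])
    have "filterlim (\<lambda>i. sqrt (q i)) (at 0) F"
      using sq0 q0(2) by (auto simp: filterlim_at elim!: eventually_mono)
    from filterlim_compose[OF radial'_flat this]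
    have r': "((\<lambda>i. (real n - radial' n (sqrt (q i))) / sqrt (q i)) \<longlongrightarrow> 0) F" .
    have 1: "((\<lambda>i. rerr (q i) 0) \<longlongrightarrow> angular s n 0 - radial n 0) F"
    proof (rule Lim_transform_eventually)
      show "((\<lambda>i. amp (q i) * (angular s n 0 - radial n (sqrt (q i)))) \<longlongrightarrow> angular s n 0 - radial n 0) F"
        using tendsto_mult[OF amp tendsto_diff[OF tendsto_const r]] by simp
      show "\<forall>\<^sub>F i in F. amp (q i) * (angular s n 0 - radial n (sqrt (q i))) = rerr (q i) 0"
        using mode by eventually_elim
          (simp add: mathieu_mode.radial_error_def mathieu_mode.initial_amplitude(4) right_diff_distrib)
    qed
    have 2: "((\<lambda>i. rerr' (q i) 0) \<longlongrightarrow> 0) F"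
    proof (rule Lim_transform_eventually)
      show "((\<lambda>i. amp (q i) * ((real n - radial' n (sqrt (q i))) / sqrt (q i))) \<longlongrightarrow> 0) F"
        using tendsto_mult[OF amp r'] by simp
      show "\<forall>\<^sub>F i in F. amp (q i) * ((real n - radial' n (sqrt (q i))) / sqrt (q i)) = rerr' (q i) 0"
        using mode by eventually_elim
          (simp add: mathieu_mode.radial_error'_def mathieu_mode.initial_amplitude(3) algebra_simps)
    qed
    show ?thesis unfolding e_def by (intro tendsto_intros 1 2)
  qed
  have "((\<lambda>i. e i * exp (- c i * X i)) \<longlongrightarrow> 0) F"
  proof (cases "n = 0")
    case True
    have "((\<lambda>i. e i * exp (- c i * X i)) \<longlongrightarrow> ((angular s n 0 - radial n 0)\<^sup>2 + 0\<^sup>2) * 1) F"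
      using tendsto_mult[OF e m] True by simp
    then show ?thesis using radial_0(2)[OF n_ge_1 True] by simp
  next
    case False
    then show ?thesis using tendsto_mult[OF e m] by simp
  qed
  moreover have "((\<lambda>i. L i * max 1 (exp (- c i * X i))) \<longlongrightarrow> 0) F"
  proof -
    have "((\<lambda>i. (2 * (K + 1)\<^sup>2 * (amp (q i))\<^sup>2 * B\<^sup>2) * (q i * X i)) \<longlongrightarrow> (2 * (K + 1)\<^sup>2 * 1\<^sup>2 * B\<^sup>2) * 0) F"
      by (intro tendsto_intros amp qX)
    then have "(L \<longlongrightarrow> 0) F" by (simp add: L_def[abs_def] mult.assoc)
    from tendsto_mult[OF this tendsto_max[OF tendsto_const m]] show ?thesis by simp
  qed
  ultimately have "((\<lambda>i. e i * exp (- c i * X i) + L i * max 1 (exp (- c i * X i))) \<longlongrightarrow> 0) F"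
    using tendsto_add by fastforce
  then have "((\<lambda>i. sqrt (e i * exp (- c i * X i) + L i * max 1 (exp (- c i * X i)))) \<longlongrightarrow> 0) F"
    using tendsto_real_sqrt by fastforce
  moreover have "\<forall>\<^sub>F i in F. norm (rerr (q i) (X i)) \<le> sqrt (e i * exp (- c i * X i) + L i * max 1 (exp (- c i * X i)))"
    using E
  proof eventually_elim
    case (elim i)
    show ?case unfolding real_norm_def
      by (rule real_le_rsqrt) (use elim zero_le_power2[of "rerr' (q i) (X i)"] in \<open>unfold power2_abs, linarith\<close>)
  qed
  moreover have "\<forall>\<^sub>F i in F. norm (rerr' (q i) (X i)) \<le> sqrt (e i * exp (- c i * X i) + L i * max 1 (exp (- c i * X i)))"
    using E
  proof eventually_elim
    case (elim i)
    show ?case unfolding real_norm_def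
      by (rule real_le_rsqrt) (use elim zero_le_power2[of "rerr (q i) (X i)"] in \<open>unfold power2_abs, linarith\<close>)
  qed
  ultimately show "((\<lambda>i. rerr (q i) (X i)) \<longlongrightarrow> 0) F" "((\<lambda>i. rerr' (q i) (X i)) \<longlongrightarrow> 0) F"
    by (auto intro: Lim_null_comparison)
qed

end

section \<open>Convergence of the values, away from the origin and at it\<close>

lemma complex_cosh_pi_half: "cosh (\<i> * of_real (pi / 2)) = 0" "sinh (\<i> * of_real (pi / 2)) = \<i>"
  by (simp_all add: cosh_eq_Complex sinh_eq_Complex complex_eq_iff)

context mathieu_modes
begin

abbreviation mode_value :: "real \<Rightarrow> complex \<Rightarrow> quat" where
  "mode_value q \<equiv> mathieu_product.product_value q (C q) (C' q) (\<phi> q) (\<phi>' q) (q powr (real n / 2))"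

lemma mode_value_eq:
  assumes "mathieu_mode s q (a q) (C q) (C' q) (\<phi> q) (\<phi>' q) n K"
  shows "mode_value q \<omega> =
     quat_of (sqrt q ^ n * C q (Re \<omega>) * \<phi> q (Im \<omega>))
       (- (Complex (sqrt q ^ n * C' q (Re \<omega>) * \<phi> q (Im \<omega>)) (- (sqrt q ^ n * C q (Re \<omega>) * \<phi>' q (Im \<omega>)))
           / (of_real (2 * sqrt q) * sinh \<omega>)))"
proof -
  interpret mathieu_product s q "a q" "C q" "C' q" "\<phi> q" "\<phi>' q"
    by (rule mathieu_mode.axioms(1)[OF assms])
  have 1: "of_real c * Complex (x * y) (- z * v) = Complex (c * x * y) (- (c * z * v))" for c x y z v
    by (simp add: complex_eq_iff)
  have 2: "- (k * (P / S)) / d = - (k * P / (d * S))" for k P S d :: complex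
    by (simp add: mult.commute)
  show ?thesis
    unfolding product_value_def powr_half_eq[OF q_pos] product_def product_gradient_def 2 1
    by (simp only: mult.assoc)
qed

text \<open>The power q^(n/2) is t^n exp (- n\<xi>), so it turns C into t^n y with y convergent. The
  limit of the gradient term is w p / (\<tau> \<open>cis \<theta>\<close>) = p / \<alpha>, because
  \<tau> = \<alpha> r.\<close>

lemma mode_value_tendsto:
  assumes q: "filterlim q (at_right 0) F" and \<alpha>: "0 < \<alpha>" and r: "0 < r"
    and X: "((\<lambda>i. sqrt (q i) * exp (Re (\<omega> i))) \<longlongrightarrow> \<alpha> * r) F"
    and \<theta>: "((\<lambda>i. Im (\<omega> i)) \<longlongrightarrow> \<theta>) F" "\<bar>\<theta>\<bar> < 4"
    and w: "w = of_real r * cis \<theta>"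
  shows "((\<lambda>i. mode_value (q i) (\<omega> i)) \<longlongrightarrow> F_limit s n \<alpha> w) F"
proof -
  define \<tau> where "\<tau> = \<alpha> * r"
  have \<tau>: "0 < \<tau>" using \<alpha> r by (simp add: \<tau>_def)
  define t where "t i = sqrt (q i) * exp (Re (\<omega> i))" for i
  have t: "(t \<longlongrightarrow> \<tau>) F" using X unfolding t_def[abs_def] \<tau>_def .
  have mode: "\<forall>\<^sub>F i in F. mathieu_mode s (q i) (a (q i)) (C (q i)) (C' (q i)) (\<phi> (q i)) (\<phi>' (q i)) n K"
    by (rule eventually_compose_filterlim[OF modes q])
  have amp: "((\<lambda>i. amp (q i)) \<longlongrightarrow> 1) F" by (rule filterlim_compose[OF amp_tendsto q])
  note err = radial_part_tendsto[OF q t[unfolded t_def[abs_def]] \<tau>]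
  note ang = angular_part_tendsto[OF q \<theta>]
  note q0 = q_right[OF q]
  define y where "y i = rerr (q i) (Re (\<omega> i)) + amp (q i) * radial n (t i)" for i
  define y' where "y' i = t i * rerr' (q i) (Re (\<omega> i)) + amp (q i) * radial' n (t i)" for i
  have "(y \<longlongrightarrow> 0 + 1 * radial n \<tau>) F"
    unfolding y_def[abs_def] by (intro tendsto_intros err amp isCont_tendsto_compose[OF isCont_radial(1) t])
  then have y: "(y \<longlongrightarrow> radial n \<tau>) F" by simp
  have "(y' \<longlongrightarrow> \<tau> * 0 + 1 * radial' n \<tau>) F"
    unfolding y'_def[abs_def] by (intro tendsto_intros err amp t isCont_tendsto_compose[OF isCont_radial(2) t])
  then have y': "(y' \<longlongrightarrow> radial' n \<tau>) F" by simp
  define N where "N i = Complex (t i ^ n * (y' i - real n * y i) * \<phi> (q i) (Im (\<omega> i)))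
     (- (t i ^ n * y i * \<phi>' (q i) (Im (\<omega> i))))" for i
  \<comment> \<open>This is 2 \<open>sqrt q\<close> sinh \<omega>; in terms of t the decaying
    exponential has the coefficient q / t, which tends to 0.\<close>
  define D where "D i = of_real (t i) * cis (Im (\<omega> i)) - of_real (q i / t i) * cis (- Im (\<omega> i))" for i
  have N: "(N \<longlongrightarrow> Complex (\<tau> ^ n * (radial' n \<tau> - real n * radial n \<tau>) * angular s n \<theta>)
     (- (\<tau> ^ n * radial n \<tau> * angular' s n \<theta>))) F"
    unfolding N_def[abs_def] by (intro tendsto_intros y y' t ang)
  have cis: "((\<lambda>i. cis (x i)) \<longlongrightarrow> cis x0) F" if "(x \<longlongrightarrow> x0) F" for x x0
    unfolding cis.code by (intro tendsto_Complex isCont_tendsto_compose[OF isCont_cos that] isCont_tendsto_compose[OF isCont_sin that])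
  have "(D \<longlongrightarrow> of_real \<tau> * cis \<theta> - of_real (0 / \<tau>) * cis (- \<theta>)) F"
    unfolding D_def[abs_def] by (intro tendsto_intros t q0(1) cis \<theta>(1)) (use \<tau> in simp)
  then have D: "(D \<longlongrightarrow> of_real \<tau> * cis \<theta>) F" by simp
  have ev: "\<forall>\<^sub>F i in F. quat_of (t i ^ n * y i * \<phi> (q i) (Im (\<omega> i))) (- (N i / D i)) = mode_value (q i) (\<omega> i)"
    using mode
  proof eventually_elim
    case (elim i)
    interpret mathieu_mode s "q i" "a (q i)" "C (q i)" "C' (q i)" "\<phi> (q i)" "\<phi>' (q i)" n K by (rule elim)
    let ?X = "Re (\<omega> i)" and ?q = "q i"
    have y_eq: "y i = exp (- real n * ?X) * C ?q ?X"
      unfolding y_def radial_error_def t_def by simp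
    have y'_eq: "y' i = exp (- real n * ?X) * (C' ?q ?X + real n * C ?q ?X)"
      using q_pos unfolding y'_def radial_error'_def t_def by simp
    have tn: "t i ^ n * exp (- real n * ?X) = sqrt ?q ^ n"
      by (simp add: t_def power_mult_distrib exp_of_nat_mult[symmetric] exp_minus)
    have 1: "t i ^ n * y i = sqrt ?q ^ n * C ?q ?X"
      unfolding y_eq tn[symmetric] by simp
    have 2: "t i ^ n * (y' i - real n * y i) = sqrt ?q ^ n * C' ?q ?X"
      unfolding y'_eq y_eq tn[symmetric] by (simp add: algebra_simps)
    have "exp (\<omega> i) = of_real (exp ?X) * cis (Im (\<omega> i))"
      "exp (- \<omega> i) = of_real (exp (- ?X)) * cis (- Im (\<omega> i))"
      by (simp_all add: exp_eq_polar)
    then have "of_real (2 * sqrt ?q) * sinh (\<omega> i) =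
        of_real (sqrt ?q * exp ?X) * cis (Im (\<omega> i)) - of_real (sqrt ?q * exp (- ?X)) * cis (- Im (\<omega> i))"
      by (simp add: sinh_field_def field_simps)
    also have "sqrt ?q * exp (- ?X) = ?q / t i"
      using q_pos by (simp add: t_def exp_minus field_simps)
    finally have 3: "of_real (2 * sqrt ?q) * sinh (\<omega> i) = D i" by (simp add: D_def t_def)
    show ?case unfolding mode_value_eq[OF elim] 3 N_def 1 2 by simp
  qed
  have "((\<lambda>i. mode_value (q i) (\<omega> i)) \<longlongrightarrow> quat_of (\<tau> ^ n * radial n \<tau> * angular s n \<theta>)
     (- (Complex (\<tau> ^ n * (radial' n \<tau> - real n * radial n \<tau>) * angular s n \<theta>)
     (- (\<tau> ^ n * radial n \<tau> * angular' s n \<theta>)) / (of_real \<tau> * cis \<theta>)))) F"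
    by (rule Lim_transform_eventually[OF _ ev], intro tendsto_quat_of tendsto_intros N D t y ang) (use \<tau> in simp)
  also have "\<tau> ^ n * radial n \<tau> * angular s n \<theta> = limit_scalar s n \<alpha> w"
    unfolding limit_polar(1)[OF w] radial_def \<tau>_def[symmetric] by (simp add: mult_ac)
  also have "Complex (\<tau> ^ n * (radial' n \<tau> - real n * radial n \<tau>) * angular s n \<theta>)
     (- (\<tau> ^ n * radial n \<tau> * angular' s n \<theta>)) = w * limit_gradient s n \<alpha> w"
    unfolding limit_polar(2)[OF w] radial_def radial'_def \<tau>_def[symmetric] by (simp add: algebra_simps)
  also have "- (w * limit_gradient s n \<alpha> w / (of_real \<tau> * cis \<theta>)) = - limit_gradient s n \<alpha> w / of_real \<alpha>"
    using r \<alpha> by (simp add: w \<tau>_def)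
  finally show ?thesis unfolding F_limit_eq[OF \<alpha>] .
qed

text \<open>For \<open>n = 0\<close> the factor \<open>1 / \<surd>q\<close> in front of the gradient is not compensated, so that the
  value at the origin needs a bound of the derivative that is linear in \<open>q\<close>.\<close>

lemma \<phi>'_pi_half:
  assumes "n = 0"
  shows "((\<lambda>q. \<phi>' q (pi / 2) / sqrt q) \<longlongrightarrow> 0) (at_right 0)"
proof -
  have b: "\<forall>\<^sub>F q in at_right 0. norm (\<phi>' q (pi / 2) / sqrt q) \<le> (K + 2) * (2 * (1 + 1)) * 2 * sqrt q"
  proof -
    have "\<forall>\<^sub>F q in at_right 0. sqrt (M * q) < 1"
      by (rule order_tendstoD(2)[OF sqrt_M_null]) simp
    moreover have "\<forall>\<^sub>F q in at_right 0. \<bar>amp q\<bar> < 2"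
      by (rule order_tendstoD(2)[OF tendsto_rabs[OF amp_tendsto]]) simp
    ultimately show ?thesis
      using modes eventually_le_1
    proof eventually_elim
      case (elim q)
      interpret mathieu_mode s q "a q" "C q" "C' q" "\<phi> q" "\<phi>' q" n K by (rule elim)
      have "s = Plus" using n assms by (cases s) auto
      then have "\<phi>' q 0 = 0" using initial_amplitude(2) by (simp add: angular'_def)
      \<comment> \<open>As \<phi>'(0) = 0 by evenness, the mean value theorem bounds
        \<phi>'(\<pi>/2) by the second derivative, which for n = 0 is of order q.\<close>
      obtain x where x: "0 < x" "x < pi / 2"
        "\<phi>' q (pi / 2) - \<phi>' q 0 = (pi / 2 - 0) * (- (a q - 2 * q * cos (2 * x)) * \<phi> q x)"
        using MVT2[of 0 "pi / 2" "\<phi>' q" "\<lambda>x. - (a q - 2 * q * cos (2 * x)) * \<phi> q x"] \<phi>' by auto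
      have "\<bar>2 * q * cos (2 * x)\<bar> \<le> 2 * q" using q_pos by (simp add: abs_mult)
      then have 1: "\<bar>a q - 2 * q * cos (2 * x)\<bar> \<le> (K + 2) * q"
        using a_near assms unfolding distrib_right by simp
      have "\<bar>\<phi> q x - amp q * angular s n x\<bar> \<le> sqrt (M * q) * \<bar>amp q\<bar>"
        using angular_part_error(1)[OF _ elim(3,4), of x] x pi_less_4 by simp
      also have "\<dots> \<le> 1 * 2" using elim(1,2) by (intro mult_mono) auto
      finally have "\<bar>\<phi> q x\<bar> \<le> 2 + \<bar>amp q * angular s n x\<bar>" by linarith
      also have "\<bar>amp q * angular s n x\<bar> \<le> 2 * 1"
        unfolding abs_mult using elim(2) abs_angular_le_1 by (intro mult_mono) auto
      finally have 2: "\<bar>\<phi> q x\<bar> \<le> 2 * (1 + 1)" by simp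
      have "\<bar>\<phi>' q (pi / 2)\<bar> = pi / 2 * (\<bar>a q - 2 * q * cos (2 * x)\<bar> * \<bar>\<phi> q x\<bar>)"
      proof -
        have "\<phi>' q (pi / 2) = - (pi / 2 * ((a q - 2 * q * cos (2 * x)) * \<phi> q x))"
          using x(3) \<open>\<phi>' q 0 = 0\<close> by (simp add: algebra_simps)
        then show ?thesis by (simp add: abs_mult)
      qed
      also have "\<dots> \<le> 2 * ((K + 2) * q * (2 * (1 + 1)))"
        using 1 2 K_nonneg q_pos pi_less_4 by (intro mult_mono) auto
      also have "\<dots> = (K + 2) * (2 * (1 + 1)) * 2 * sqrt q * sqrt q"
      proof -
        have "sqrt q * sqrt q = q" using q_pos by simp
        then show ?thesis unfolding mult.assoc by simp
      qed
      finally show ?case using q_pos by (simp add: pos_divide_le_eq)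
    qed
  qed
  have "((\<lambda>q. (K + 2) * (2 * (1 + 1)) * 2 * sqrt q) \<longlongrightarrow> (K + 2) * (2 * (1 + 1)) * 2 * sqrt 0) (at_right 0)"
    by (intro tendsto_intros)
  then show ?thesis by (intro Lim_null_comparison[OF b]) simp
qed

text \<open>The point w/\<mu> is 0 for every \<mu>, with \<xi> = 0 and \<eta> = \<pi>/2. Only the
  initial values of C and the angular limits at \<pi>/2 enter.\<close>

lemma mode_value_origin_tendsto:
  assumes \<alpha>: "0 < \<alpha>"
  shows "((\<lambda>q. mode_value q (\<i> * of_real (pi / 2))) \<longlongrightarrow> F_limit s n \<alpha> 0) (at_right 0)"
proof -
  have q: "filterlim (\<lambda>q. q) (at_right 0) (at_right (0::real))" by (rule filterlim_ident)
  have sq0: "((\<lambda>q. sqrt q) \<longlongrightarrow> 0) (at_right 0)"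
    using tendsto_real_sqrt[OF q_right(1)[OF q]] by simp
  have "\<bar>pi / 2\<bar> < 4" using pi_less_4 by simp
  note ang = angular_part_tendsto[OF q tendsto_const this]
  have C0: "((\<lambda>q. C q 0) \<longlongrightarrow> angular s n 0) (at_right 0)"
  proof (rule Lim_transform_eventually)
    show "((\<lambda>q. amp q * angular s n 0) \<longlongrightarrow> angular s n 0) (at_right 0)"
      using tendsto_mult_right[OF amp_tendsto, of "angular s n 0"] by simp
    show "\<forall>\<^sub>F q in at_right 0. amp q * angular s n 0 = C q 0"
      using modes by eventually_elim (simp add: mathieu_mode.initial_amplitude(4))
  qed
  have C'0: "((\<lambda>q. C' q 0) \<longlongrightarrow> real n - real n * angular s n 0) (at_right 0)"
  proof (rule Lim_transform_eventually)
    show "((\<lambda>q. real n * amp q - real n * C q 0) \<longlongrightarrow> real n - real n * angular s n 0) (at_right 0)"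
      using tendsto_diff[OF tendsto_mult_left[OF amp_tendsto, of "real n"] tendsto_mult_left[OF C0, of "real n"]] by simp
    show "\<forall>\<^sub>F q in at_right 0. real n * amp q - real n * C q 0 = C' q 0"
      using modes by eventually_elim (simp add: mathieu_mode.initial_amplitude(3)[symmetric])
  qed
  let ?N = "\<lambda>q. Complex (C' q 0 * \<phi> q (pi / 2)) (- (C q 0 * \<phi>' q (pi / 2)))"
  have ev: "\<forall>\<^sub>F q in at_right 0. mode_value q (\<i> * of_real (pi / 2)) =
      quat_of (sqrt q ^ n * (C q 0 * \<phi> q (pi / 2))) (of_real (sqrt q ^ n / sqrt q / 2) * (\<i> * ?N q))"
    using modes
  proof eventually_elim
    case (elim q)
    have sq: "sqrt q \<noteq> 0" using mathieu_product.q_pos[OF mathieu_mode.axioms(1)[OF elim]] by simp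
    have "- (Complex (c * x) (- (c * y)) / (of_real (2 * d) * \<i>)) = of_real (c / d / 2) * (\<i> * Complex x (- y))"
      if "d \<noteq> 0" for c d x y
      using that by (simp add: complex_eq_iff Re_divide Im_divide power2_eq_square)
    then show ?case
      unfolding mode_value_eq[OF elim] complex_cosh_pi_half(2) using sq by (simp add: mult.assoc)
  qed
  show ?thesis
  proof (cases n)
    case 0
    then have s: "s = Plus" using n_ge_1 by (cases s) auto
    have "((\<lambda>q. quat_of (sqrt q ^ n * (C q 0 * \<phi> q (pi / 2))) (of_real (C q 0 * (\<phi>' q (pi / 2) / sqrt q) / 2)))
        \<longlongrightarrow> quat_of (0 ^ n * (angular s n 0 * angular s n (pi / 2))) (of_real (angular s n 0 * 0 / 2))) (at_right 0)"
      by (intro tendsto_quat_of tendsto_intros sq0 C0 ang \<phi>'_pi_half[OF 0]) auto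
    moreover have "\<forall>\<^sub>F q in at_right 0. quat_of (sqrt q ^ n * (C q 0 * \<phi> q (pi / 2)))
        (of_real (C q 0 * (\<phi>' q (pi / 2) / sqrt q) / 2)) = mode_value q (\<i> * of_real (pi / 2))"
      using ev modes
    proof eventually_elim
      case (elim q)
      have "C' q 0 = 0" using mathieu_mode.initial_amplitude(3)[OF elim(2)] 0 by simp
      then show ?case unfolding elim(1) using 0 by (simp add: complex_eq_iff quat_of_def)
    qed
    ultimately have "((\<lambda>q. mode_value q (\<i> * of_real (pi / 2))) \<longlongrightarrow>
        quat_of (0 ^ n * (angular s n 0 * angular s n (pi / 2))) (of_real (angular s n 0 * 0 / 2))) (at_right 0)"
      by (rule Lim_transform_eventually)
    then show ?thesis
      unfolding F_limit_eq[OF \<alpha>] limit_scalar_def limit_gradient_def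
      by (simp add: 0 s angular_def limit_beta_def)
  next
    \<comment> \<open>One factor \<open>sqrt q\<close> cancels against the denominator. The gradient
      therefore survives only for m = 0, that is for n = 1.\<close>
    case (Suc m)
    have "((\<lambda>q. quat_of (sqrt q ^ n * (C q 0 * \<phi> q (pi / 2))) (of_real (sqrt q ^ m / 2) * (\<i> * ?N q)))
        \<longlongrightarrow> quat_of (0 ^ n * (angular s n 0 * angular s n (pi / 2)))
          (of_real (0 ^ m / 2) * (\<i> * Complex ((real n - real n * angular s n 0) * angular s n (pi / 2))
             (- (angular s n 0 * angular' s n (pi / 2)))))) (at_right 0)"
      by (intro tendsto_quat_of tendsto_intros sq0 C0 C'0 ang) auto
    moreover have "\<forall>\<^sub>F q in at_right 0. quat_of (sqrt q ^ n * (C q 0 * \<phi> q (pi / 2)))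
        (of_real (sqrt q ^ m / 2) * (\<i> * ?N q)) = mode_value q (\<i> * of_real (pi / 2))"
      using ev modes
    proof eventually_elim
      case (elim q)
      have "sqrt q \<noteq> 0" using mathieu_product.q_pos[OF mathieu_mode.axioms(1)[OF elim(2)]] by simp
      then show ?case unfolding elim(1) using Suc by simp
    qed
    ultimately have "((\<lambda>q. mode_value q (\<i> * of_real (pi / 2))) \<longlongrightarrow>
        quat_of (0 ^ n * (angular s n 0 * angular s n (pi / 2)))
          (of_real (0 ^ m / 2) * (\<i> * Complex ((real n - real n * angular s n 0) * angular s n (pi / 2))
             (- (angular s n 0 * angular' s n (pi / 2)))))) (at_right 0)"
      by (rule Lim_transform_eventually)
    then show ?thesis
      unfolding F_limit_eq[OF \<alpha>] limit_scalar_def limit_gradient_def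
      using \<alpha> by (cases s; cases "m = 0")
        (simp_all add: Suc angular_def angular'_def limit_beta_def quat_of_def power_0_left)
  qed
qed

end

text \<open>An explicit inverse: exp \<omega> = z (1 + sqrt (1 - 1/z^2)) with z = w/\<mu>. Taking
  the logarithm of w apart from that of 1 + c avoids a jump of the argument, also for negative w,
  since 1 + c tends to 2. The principal root has nonnegative real part, so 1 + c is never 0.\<close>

lemma elliptic_coordinates_at_infinity:
  fixes w :: complex
  assumes w: "w \<noteq> 0"
  obtains \<omega> where "\<And>\<mu>. 0 < \<mu> \<Longrightarrow> cosh (\<omega> \<mu>) = w / of_real \<mu>"
    "((\<lambda>\<mu>. \<mu> * exp (Re (\<omega> \<mu>))) \<longlongrightarrow> 2 * cmod w) (at_right 0)"
    "((\<lambda>\<mu>. Im (\<omega> \<mu>)) \<longlongrightarrow> Arg w) (at_right 0)"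
proof
  define c where "c \<mu> = csqrt (1 - (of_real \<mu> / w)\<^sup>2)" for \<mu>
  define \<omega> where "\<omega> \<mu> = Ln w - of_real (ln \<mu>) + Ln (1 + c \<mu>)" for \<mu>
  have c_nonneg: "0 \<le> Re (c \<mu>)" for \<mu>
    unfolding c_def using csqrt_principal[of "1 - (of_real \<mu> / w)\<^sup>2"] by linarith
  have nz: "1 + c \<mu> \<noteq> 0" for \<mu>
  proof
    assume "1 + c \<mu> = 0"
    then have "1 + Re (c \<mu>) = 0" by (metis one_complex.sel(1) plus_complex.sel(1) zero_complex.sel(1))
    then show False using c_nonneg[of \<mu>] by linarith
  qed
  have exp: "exp (\<omega> \<mu>) = w / of_real \<mu> * (1 + c \<mu>)" if "0 < \<mu>" for \<mu>
  proof -
    have "exp (complex_of_real (ln \<mu>)) = of_real \<mu>" using that by (simp add: exp_of_real)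
    then show ?thesis
      unfolding \<omega>_def exp_add exp_diff using w nz by (simp add: exp_Ln)
  qed
  show "cosh (\<omega> \<mu>) = w / of_real \<mu>" if \<mu>: "0 < \<mu>" for \<mu>
  proof -
    define z where "z = w / of_real \<mu>"
    have z: "z \<noteq> 0" "of_real \<mu> / w = 1 / z" using w \<mu> by (simp_all add: z_def)
    have "(c \<mu>)\<^sup>2 = 1 - 1 / z\<^sup>2" by (simp add: c_def z power_divide)
    \<comment> \<open>Both values of exp (\<omega>) and exp (- \<omega>) appear here; their mean is
      z.\<close>
    then have "z * (1 + c \<mu>) * (z * (1 - c \<mu>)) = 1"
      using z by (simp add: field_simps power2_eq_square)
    then have "inverse (z * (1 + c \<mu>)) = z * (1 - c \<mu>)" by (rule inverse_unique)
    then show ?thesis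
      unfolding cosh_field_def exp_minus exp[OF \<mu>] z_def[symmetric] by (simp add: algebra_simps)
  qed
  have "((\<lambda>\<mu>. 1 - (of_real \<mu> / w)\<^sup>2) \<longlongrightarrow> 1 - (of_real 0 / w)\<^sup>2) (at_right 0)"
    by (intro tendsto_intros w)
  then have "((\<lambda>\<mu>. 1 - (of_real \<mu> / w)\<^sup>2) \<longlongrightarrow> 1) (at_right 0)" by simp
  then have "(c \<longlongrightarrow> csqrt 1) (at_right 0)"
    unfolding c_def[abs_def] by (intro isCont_tendsto_compose[OF continuous_at_csqrt]) auto
  then have "((\<lambda>\<mu>. 1 + c \<mu>) \<longlongrightarrow> 1 + 1) (at_right 0)"
    by (intro tendsto_intros) simp
  then have c: "((\<lambda>\<mu>. 1 + c \<mu>) \<longlongrightarrow> 2) (at_right 0)" by simp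
  have "((\<lambda>\<mu>. cmod (w * (1 + c \<mu>))) \<longlongrightarrow> cmod (w * 2)) (at_right 0)"
    by (intro tendsto_intros c)
  moreover have "\<forall>\<^sub>F \<mu> in at_right 0. cmod (w * (1 + c \<mu>)) = \<mu> * exp (Re (\<omega> \<mu>))"
    using eventually_at_right_less[of 0]
    by eventually_elim (simp add: norm_exp_eq_Re[symmetric] exp norm_mult norm_divide)
  ultimately show "((\<lambda>\<mu>. \<mu> * exp (Re (\<omega> \<mu>))) \<longlongrightarrow> 2 * cmod w) (at_right 0)"
    by (rule Lim_transform_eventually[THEN tendsto_eq_rhs]) (simp add: norm_mult)
  have "((\<lambda>\<mu>. Arg w + Im (Ln (1 + c \<mu>))) \<longlongrightarrow> Arg w + Im (Ln 2)) (at_right 0)"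
    by (intro tendsto_intros isCont_tendsto_compose[OF continuous_at_Ln c]) auto
  moreover have "Im (Ln 2) = 0"
    using Ln_of_real[of 2] by simp
  ultimately show "((\<lambda>\<mu>. Im (\<omega> \<mu>)) \<longlongrightarrow> Arg w) (at_right 0)"
    using w by (simp add: \<omega>_def Arg_def)
qed

lemma mathieu_family_products:
  assumes "mathieu_family s n f"
  obtains a C C' \<phi> \<phi>' where
    "\<And>q. 0 < q \<Longrightarrow> mathieu_product s q (a q) (C q) (C' q) (\<phi> q) (\<phi>' q)"
    "\<And>q \<xi> \<eta>. 0 < q \<Longrightarrow> mathieu_zeta s f q \<xi> \<eta> = C q \<xi> * \<phi> q \<eta>"
    "\<And>q. 0 < q \<Longrightarrow> integral {0..2 * pi} (\<lambda>x. (\<phi> q x)\<^sup>2) = (if s = Plus \<and> n = 0 then 2 * pi else pi)"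
    "\<And>x. ((\<lambda>q. \<phi> q x) \<longlongrightarrow> angular s n x) (at_right 0)"
proof -
  have "\<exists>a C C' \<phi> \<phi>'. mathieu_product s q a C C' \<phi> \<phi>' \<and> (\<forall>\<xi> \<eta>. mathieu_zeta s f q \<xi> \<eta> = C \<xi> * \<phi> \<eta>) \<and>
      integral {0..2 * pi} (\<lambda>x. (\<phi> x)\<^sup>2) = (if s = Plus \<and> n = 0 then 2 * pi else pi) \<and>
      (\<forall>x. f q (of_real x) = of_real (\<phi> x))" if q: "0 < q" for q
  proof -
    obtain a \<phi> where hol: "f q holomorphic_on UNIV" and ef: "mathieu_eigenfunction s q a \<phi>"
      and f: "\<And>x. f q (of_real x) = of_real (\<phi> x)"
      and norm: "sqrt (integral {0..2 * pi} (\<lambda>x. (\<phi> x)\<^sup>2)) = (if s = Plus \<and> n = 0 then sqrt (2 * pi) else sqrt pi)"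
      using assms q unfolding mathieu_family_def by blast
    obtain C C' \<phi>' where "mathieu_product s q a C C' \<phi> \<phi>'" "\<And>\<xi> \<eta>. mathieu_zeta s f q \<xi> \<eta> = C \<xi> * \<phi> \<eta>"
      using mathieu_product_exists[where f = f and \<phi> = \<phi>, OF q ef hol f] by blast
    moreover have "integral {0..2 * pi} (\<lambda>x. (\<phi> x)\<^sup>2) = (if s = Plus \<and> n = 0 then 2 * pi else pi)"
      using norm by (auto split: if_splits)
    ultimately show ?thesis using f by blast
  qed
  \<comment> \<open>The data exist for each q separately; packing them into one tuple lets a single
    use of \<open>choice\<close> turn them into functions of q.\<close>
  then have "\<forall>q. \<exists>x. 0 < q \<longrightarrow> (case x of (a, C, C', \<phi>, \<phi>') \<Rightarrow> mathieu_product s q a C C' \<phi> \<phi>' \<and>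
      (\<forall>\<xi> \<eta>. mathieu_zeta s f q \<xi> \<eta> = C \<xi> * \<phi> \<eta>) \<and>
      integral {0..2 * pi} (\<lambda>x. (\<phi> x)\<^sup>2) = (if s = Plus \<and> n = 0 then 2 * pi else pi) \<and>
      (\<forall>x. f q (of_real x) = of_real (\<phi> x)))"
    by (simp only: split_paired_Ex prod.case) blast
  from choice[OF this] obtain x where x: "\<forall>q. 0 < q \<longrightarrow> (case x q of (a, C, C', \<phi>, \<phi>') \<Rightarrow> mathieu_product s q a C C' \<phi> \<phi>' \<and>
      (\<forall>\<xi> \<eta>. mathieu_zeta s f q \<xi> \<eta> = C \<xi> * \<phi> \<eta>) \<and>
      integral {0..2 * pi} (\<lambda>x. (\<phi> x)\<^sup>2) = (if s = Plus \<and> n = 0 then 2 * pi else pi) \<and>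
      (\<forall>x. f q (of_real x) = of_real (\<phi> x)))" ..
  define a C C' \<phi> \<phi>' where "a q = fst (x q)" and "C q = fst (snd (x q))" and "C' q = fst (snd (snd (x q)))"
    and "\<phi> q = fst (snd (snd (snd (x q))))" and "\<phi>' q = snd (snd (snd (snd (x q))))" for q
  have *: "mathieu_product s q (a q) (C q) (C' q) (\<phi> q) (\<phi>' q) \<and>
      (\<forall>\<xi> \<eta>. mathieu_zeta s f q \<xi> \<eta> = C q \<xi> * \<phi> q \<eta>) \<and>
      integral {0..2 * pi} (\<lambda>x. (\<phi> q x)\<^sup>2) = (if s = Plus \<and> n = 0 then 2 * pi else pi) \<and>
      (\<forall>x. f q (of_real x) = of_real (\<phi> q x))" if "0 < q" for q
    using x[rule_format, OF that] unfolding a_def C_def C'_def \<phi>_def \<phi>'_def case_prod_beta .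
  have "((\<lambda>q. \<phi> q x) \<longlongrightarrow> angular s n x) (at_right 0)" for x
  proof (rule Lim_transform_eventually)
    have "((\<lambda>q. f q (of_real x)) \<longlongrightarrow> of_real (angular s n x)) (at_right 0)"
      using assms unfolding mathieu_family_def angular_def by blast
    from tendsto_Re[OF this] show "((\<lambda>q. Re (f q (of_real x))) \<longlongrightarrow> angular s n x) (at_right 0)" by simp
    show "\<forall>\<^sub>F q in at_right 0. Re (f q (of_real x)) = \<phi> q x"
      using eventually_at_right_less[of 0] by eventually_elim (simp add: *)
  qed
  with * show thesis by (intro that[of a C C' \<phi> \<phi>']) auto
qed

theorem theorem3p8:
  fixes q :: "real \<Rightarrow> real" and \<alpha> :: real and n :: nat and s :: parity
    and f :: "real \<Rightarrow> complex \<Rightarrow> complex"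
  assumes "\<And>\<mu>. 0 < \<mu> \<Longrightarrow> \<mu> < 1 \<Longrightarrow> 0 < q \<mu>"
    and "(q \<longlongrightarrow> 0) (at_right 0)"
    and "((\<lambda>\<mu>. 2 * sqrt (q \<mu>) / \<mu>) \<longlongrightarrow> \<alpha>) (at_right 0)"
    and "0 < \<alpha>"
    and "s = Minus \<Longrightarrow> 1 \<le> n"
    and "mathieu_family s n f"
  shows "(\<forall>\<mu>. 0 < \<mu> \<and> \<mu> < 1 \<longrightarrow>
            metamonogenic (2 * sqrt (q \<mu>)) (- {1, -1}) (F_approx s n f (q \<mu>)))
       \<and> metamonogenic \<alpha> (ball 0 1) (F_limit s n \<alpha>)
       \<and> (\<forall>w\<in>ball 0 1. ((\<lambda>\<mu>. F_approx s n f (q \<mu>) (w / of_real \<mu>)) \<longlongrightarrow> F_limit s n \<alpha> w)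
            (at_right 0))"
proof -
  have n: "s = Minus \<Longrightarrow> 1 \<le> n" by (rule assms(5))
  obtain a C C' \<phi> \<phi>' where prod: "\<And>q. 0 < q \<Longrightarrow> mathieu_product s q (a q) (C q) (C' q) (\<phi> q) (\<phi>' q)"
    and zeta: "\<And>q \<xi> \<eta>. 0 < q \<Longrightarrow> mathieu_zeta s f q \<xi> \<eta> = C q \<xi> * \<phi> q \<eta>"
    and norm: "\<And>q. 0 < q \<Longrightarrow> integral {0..2 * pi} (\<lambda>x. (\<phi> q x)\<^sup>2) = (if s = Plus \<and> n = 0 then 2 * pi else pi)"
    and lim: "\<And>x. ((\<lambda>q. \<phi> q x) \<longlongrightarrow> angular s n x) (at_right 0)"
    using mathieu_family_products[OF assms(6)] by blast
  have eig: "\<forall>\<^sub>F q in at_right 0. \<bar>a q - (real n)\<^sup>2\<bar> \<le> 4 * pi * q"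
    by (rule eigenvalue_asymptotics[OF prod n norm lim])
  interpret mathieu_modes s n "4 * pi" a C C' \<phi> \<phi>'
  proof
    show "\<forall>\<^sub>F q in at_right 0. mathieu_mode s q (a q) (C q) (C' q) (\<phi> q) (\<phi>' q) n (4 * pi)"
      using eig eventually_at_right_less[of 0]
      by eventually_elim (intro mathieu_mode.intro mathieu_mode_axioms.intro prod n)
  qed (rule lim)
  have F: "F_approx s n f q (cosh \<omega>) = mode_value q \<omega>" if "0 < q" for q \<omega>
    by (rule mathieu_product.F_approx_eq[OF prod zeta]) (rule that)+
  have \<mu>: "\<forall>\<^sub>F \<mu> in at_right 0. 0 < \<mu> \<and> \<mu> < (1::real)"
    by (rule eventually_at_rightI[of 0 1]) auto
  have q: "filterlim q (at_right 0) (at_right 0)"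
    using assms(2) eventually_mono[OF \<mu>, of "\<lambda>\<mu>. 0 < q \<mu>"] assms(1)
    by (auto simp: filterlim_at elim: eventually_mono)
  show ?thesis
  proof (intro conjI allI impI ballI)
    fix \<mu> :: real assume "0 < \<mu> \<and> \<mu> < 1"
    then have "0 < q \<mu>" using assms(1) by simp
    then show "metamonogenic (2 * sqrt (q \<mu>)) (- {1, -1}) (F_approx s n f (q \<mu>))"
      using mathieu_product.metamonogenic_F_approx[OF prod zeta] by blast
  next
    show "metamonogenic \<alpha> (ball 0 1) (F_limit s n \<alpha>)"
      by (rule metamonogenic_F_limit[OF assms(4)])
  next
    fix w :: complex
    obtain \<omega> where \<omega>: "\<And>\<mu>. 0 < \<mu> \<Longrightarrow> cosh (\<omega> \<mu>) = w / of_real \<mu>"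
      and limit: "((\<lambda>\<mu>. mode_value (q \<mu>) (\<omega> \<mu>)) \<longlongrightarrow> F_limit s n \<alpha> w) (at_right 0)"
    proof (cases "w = 0")
      case True
      show thesis
        by (rule that[of "\<lambda>_. \<i> * of_real (pi / 2)"])
          (use True complex_cosh_pi_half(1) filterlim_compose[OF mode_value_origin_tendsto[OF assms(4)] q] in auto)
    next
      case False
      obtain \<omega> where \<omega>: "\<And>\<mu>. 0 < \<mu> \<Longrightarrow> cosh (\<omega> \<mu>) = w / of_real \<mu>"
        and X: "((\<lambda>\<mu>. \<mu> * exp (Re (\<omega> \<mu>))) \<longlongrightarrow> 2 * cmod w) (at_right 0)"
        and \<theta>: "((\<lambda>\<mu>. Im (\<omega> \<mu>)) \<longlongrightarrow> Arg w) (at_right 0)"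
        using elliptic_coordinates_at_infinity[OF False] by blast
      \<comment> \<open>The two scales meet here: \<mu> exp (Re \<omega>) tends to 2 |w| and 2
        \<open>sqrt q\<close> / \<mu> to \<alpha>, so the Bessel variable t tends to \<alpha>
        |w|.\<close>
      have "((\<lambda>\<mu>. 2 * sqrt (q \<mu>) / \<mu> * (\<mu> * exp (Re (\<omega> \<mu>))) / 2) \<longlongrightarrow> \<alpha> * (2 * cmod w) / 2) (at_right 0)"
        by (intro tendsto_intros assms(3) X) simp
      moreover have "\<forall>\<^sub>F \<mu> in at_right 0. 2 * sqrt (q \<mu>) / \<mu> * (\<mu> * exp (Re (\<omega> \<mu>))) / 2 =
          sqrt (q \<mu>) * exp (Re (\<omega> \<mu>))"
        using \<mu> by eventually_elim simp
      ultimately have "((\<lambda>\<mu>. sqrt (q \<mu>) * exp (Re (\<omega> \<mu>))) \<longlongrightarrow> \<alpha> * (2 * cmod w) / 2) (at_right 0)"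
        by (rule Lim_transform_eventually)
      then have X': "((\<lambda>\<mu>. sqrt (q \<mu>) * exp (Re (\<omega> \<mu>))) \<longlongrightarrow> \<alpha> * cmod w) (at_right 0)" by simp
      have "\<bar>Arg w\<bar> < 4" using Arg_bounded[of w] pi_less_4 by linarith
      moreover have "w = of_real (cmod w) * cis (Arg w)"
        using Arg_eq[OF False] by (simp add: cis_conv_exp)
      ultimately show thesis
        using mode_value_tendsto[OF q assms(4) _ X' \<theta>] False by (intro that[OF \<omega>]) auto
    qed
    show "((\<lambda>\<mu>. F_approx s n f (q \<mu>) (w / of_real \<mu>)) \<longlongrightarrow> F_limit s n \<alpha> w) (at_right 0)"
    proof (rule Lim_transform_eventually[OF limit])
      show "\<forall>\<^sub>F \<mu> in at_right 0. mode_value (q \<mu>) (\<omega> \<mu>) = F_approx s n f (q \<mu>) (w / of_real \<mu>)"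
        using \<mu> by eventually_elim (simp add: F[symmetric] \<omega> assms(1))
    qed
  qed
qed

end
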